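(* The robust trace preservation problem is undecidable for PTA with one parameter; it remains undecidable when the parameter is restricted to range over a bounded interval.
   Context: Clocks are real-valued; parameters take nonnegative rational values. Atomic constraints: $x\sim p+c$, $x\sim c$, $p\sim c$ ($\sim\in\{<,\le,=,\ge,>\}$, $c\in\mathbb Z$); constraints are conjunctions. A PTA $(\Sigma,L,\ell_0,X,P,I,E)$ has invariants $I(\ell)$ and edges $(\ell,g,a,R,\ell')$. For parameter valuation $v$, $v(\mathcal A)$ is the timed automaton obtained by substituting parameter values, with steps $(\ell,w)\xrightarrow{d,e}(\ell',w')$ for delay $d\ge0$ when $w+d$ satisfies the guard and $w'=(w+d)[R\mapsto0]$. A run is a maximal sequence of steps $s_0\xrightarrow{d_0,e_0}s_1\cdots$ from $(\ell_0,\mathbf 0)$; its untimed trace is $(\ell_i,a_i)_i$ ($\ell_i$ location of $s_i$, $a_i$ action of $e_i$); $\mathrm{Traces}(v(\mathcal A))$ is the set of untimed traces of runs. The robust trace preservation problem: given $\mathcal A$ and $v$, decide whether there exists $v'\neq v$ such that $\mathrm{Traces}((\lambda v+(1-\lambda)v')(\mathcal A))=\mathrm{Traces}(v(\mathcal A))$ for all $\lambda\in[0,1]$. *)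

theory Defs
  imports "HOL-Analysis.Analysis" "HOL-Library.Nat_Bijection" "HOL-Library.Extended_Nat"
begin

section \<open>Computability: partial recursive functions\<close>

datatype recf =
    Zero
  | Succ
  | Proj nat
  | Comp recf "recf list"
  | PrimRec recf recf
  | Mu recf

text \<open>\<open>rec_eval f xs y\<close>: the partial recursive function \<open>f\<close> is defined on \<open>xs\<close> with value \<open>y\<close>.
  Primitive recursion and minimisation act on the first argument.\<close>

inductive rec_eval :: "recf \<Rightarrow> nat list \<Rightarrow> nat \<Rightarrow> bool" where
  eval_Zero: "rec_eval Zero xs 0"
| eval_Succ: "rec_eval Succ [x] (Suc x)"
| eval_Proj: "i < length xs \<Longrightarrow> rec_eval (Proj i) xs (xs ! i)"
| eval_Comp: "list_all2 (\<lambda>g y. rec_eval g xs y) gs ys \<Longrightarrow> rec_eval f ys z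
    \<Longrightarrow> rec_eval (Comp f gs) xs z"
| eval_PrimRec_0: "rec_eval f xs y \<Longrightarrow> rec_eval (PrimRec f g) (0 # xs) y"
| eval_PrimRec_Suc: "rec_eval (PrimRec f g) (n # xs) y \<Longrightarrow> rec_eval g (n # y # xs) z
    \<Longrightarrow> rec_eval (PrimRec f g) (Suc n # xs) z"
| eval_Mu: "rec_eval f (n # xs) 0 \<Longrightarrow> \<forall>i<n. \<exists>y. rec_eval f (i # xs) (Suc y)
    \<Longrightarrow> rec_eval (Mu f) xs n"

inductive_cases rec_eval_elims:
  "rec_eval Zero xs y"
  "rec_eval Succ xs y"
  "rec_eval (Proj i) xs y"
  "rec_eval (Comp f gs) xs y"
  "rec_eval (PrimRec f g) (0 # xs) y"
  "rec_eval (PrimRec f g) (Suc n # xs) y"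
  "rec_eval (Mu f) xs y"

lemma rec_eval_unique: "rec_eval f xs y \<Longrightarrow> rec_eval f xs z \<Longrightarrow> y = z"
proof (induction arbitrary: z rule: rec_eval.induct)
  case (eval_Zero xs)
  then show ?case by (rule rec_eval_elims) simp
next
  case (eval_Succ x)
  then show ?case by (rule rec_eval_elims) simp
next
  case (eval_Proj i xs)
  from eval_Proj.prems show ?case by (rule rec_eval_elims) simp
next
  case (eval_Comp xs gs ys f u)
  from eval_Comp.prems obtain zs where
    zs: "list_all2 (\<lambda>g y. rec_eval g xs y) gs zs" "rec_eval f zs z"
    by (rule rec_eval_elims)
  have "ys = zs"
  proof (rule nth_equalityI)
    show "length ys = length zs"
      using eval_Comp.IH(1) zs(1) by (simp add: list_all2_conv_all_nth)
    show "ys ! i = zs ! i" if "i < length ys" for i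
      using eval_Comp.IH(1) zs(1) that by (simp add: list_all2_conv_all_nth)
  qed
  then show ?case using eval_Comp.IH(2) zs(2) by blast
next
  case (eval_PrimRec_0 f xs y g)
  from eval_PrimRec_0.prems have "rec_eval f xs z" by (rule rec_eval_elims)
  then show ?case by (rule eval_PrimRec_0.IH)
next
  case (eval_PrimRec_Suc f g n xs y u)
  from eval_PrimRec_Suc.prems obtain y' where
    "rec_eval (PrimRec f g) (n # xs) y'" "rec_eval g (n # y' # xs) z"
    by (rule rec_eval_elims)
  then show ?case using eval_PrimRec_Suc.IH by blast
next
  case (eval_Mu f n xs)
  from eval_Mu.prems have z: "rec_eval f (z # xs) 0" "\<forall>i<z. \<exists>y. rec_eval f (i # xs) (Suc y)"
    by (rule rec_eval_elims, blast)+
  show ?case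
  proof (rule linorder_cases[of n z])
    assume "n < z"
    then obtain y where "rec_eval f (n # xs) (Suc y)" using z(2) by blast
    then show ?thesis using eval_Mu.IH(1)[of "Suc y"] by simp
  next
    assume "z < n"
    then obtain y where "\<forall>x. rec_eval f (z # xs) x \<longrightarrow> Suc y = x" using eval_Mu.IH(2) by blast
    then show ?thesis using z(1) by fastforce
  qed simp
qed

text \<open>The problem with instances \<open>I\<close>, presented to the algorithm through \<open>enc\<close>, and yes-instances
  \<open>{x \<in> I. Q x}\<close>. The algorithm may behave arbitrarily on numbers that encode no instance.\<close>

definition decidable_problem :: "('i \<Rightarrow> nat) \<Rightarrow> 'i set \<Rightarrow> ('i \<Rightarrow> bool) \<Rightarrow> bool" where
  "decidable_problem enc I Q \<longleftrightarrow>
     (\<exists>f. \<forall>x\<in>I. rec_eval f [enc x] (if Q x then 1 else 0))"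

section \<open>Parametric timed automata\<close>

type_synonym loc = nat
type_synonym act = nat
type_synonym clock = nat
type_synonym param = nat

datatype cmp = CLt | CLe | CEq | CGe | CGt

fun compare :: "cmp \<Rightarrow> real \<Rightarrow> real \<Rightarrow> bool" where
  "compare CLt a b \<longleftrightarrow> a < b"
| "compare CLe a b \<longleftrightarrow> a \<le> b"
| "compare CEq a b \<longleftrightarrow> a = b"
| "compare CGe a b \<longleftrightarrow> a \<ge> b"
| "compare CGt a b \<longleftrightarrow> a > b"

text \<open>The atoms \<open>x \<sim> p + c\<close>, \<open>x \<sim> c\<close> and \<open>p \<sim> c\<close>, and what becomes of them once parameters
  are replaced by numbers. A constraint is a list of atoms, read conjunctively.\<close>

datatype patom =
    ClockParam clock cmp param int
  | ClockConst clock cmp int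
  | ParamConst param cmp int

datatype tatom =
    ClockAtom clock cmp real
  | NumAtom real cmp real

text \<open>Finite sets are presented by lists; only the set of elements of \<open>actions\<close>, \<open>locs\<close>, \<open>clocks\<close>,
  \<open>params\<close>, \<open>edges\<close> and \<open>resets\<close> matters.\<close>

record 'c edge =
  source :: loc
  guard :: "'c list"
  label :: act
  resets :: "clock list"
  target :: loc

record 'c automaton =
  actions :: "act list"
  locs :: "loc list"
  init_loc :: loc
  clocks :: "clock list"
  invar :: "loc \<Rightarrow> 'c list"
  edges :: "'c edge list"

record pta = "patom automaton" +
  params :: "param list"

fun wf_atom :: "clock set \<Rightarrow> param set \<Rightarrow> patom \<Rightarrow> bool" where
  "wf_atom X P (ClockParam x r p c) \<longleftrightarrow> x \<in> X \<and> p \<in> P"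
| "wf_atom X P (ClockConst x r c) \<longleftrightarrow> x \<in> X"
| "wf_atom X P (ParamConst p r c) \<longleftrightarrow> p \<in> P"

definition wf_edge :: "pta \<Rightarrow> patom edge \<Rightarrow> bool" where
  "wf_edge A e \<longleftrightarrow>
     source e \<in> set (locs A) \<and> target e \<in> set (locs A) \<and> label e \<in> set (actions A) \<and>
     set (resets e) \<subseteq> set (clocks A) \<and>
     (\<forall>a\<in>set (guard e). wf_atom (set (clocks A)) (set (params A)) a)"

text \<open>The condition on \<open>invar\<close> outside \<open>locs\<close> normalises the irrelevant values of a function
  whose domain is meant to be the set of locations.\<close>

definition wf_pta :: "pta \<Rightarrow> bool" where
  "wf_pta A \<longleftrightarrow>
     init_loc A \<in> set (locs A) \<and>
     (\<forall>l\<in>set (locs A). \<forall>a\<in>set (invar A l). wf_atom (set (clocks A)) (set (params A)) a) \<and>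
     (\<forall>l. l \<notin> set (locs A) \<longrightarrow> invar A l = []) \<and>
     (\<forall>e\<in>set (edges A). wf_edge A e)"

subsection \<open>The timed automaton obtained from a parameter valuation\<close>

fun inst_atom :: "(param \<Rightarrow> real) \<Rightarrow> patom \<Rightarrow> tatom" where
  "inst_atom v (ClockParam x r p c) = ClockAtom x r (v p + of_int c)"
| "inst_atom v (ClockConst x r c) = ClockAtom x r (of_int c)"
| "inst_atom v (ParamConst p r c) = NumAtom (v p) r (of_int c)"

definition inst_edge :: "(param \<Rightarrow> real) \<Rightarrow> patom edge \<Rightarrow> tatom edge" where
  "inst_edge v e =
     \<lparr>source = source e, guard = map (inst_atom v) (guard e), label = label e,
      resets = resets e, target = target e\<rparr>"

definition instantiate :: "(param \<Rightarrow> real) \<Rightarrow> pta \<Rightarrow> tatom automaton" where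
  "instantiate v A =
     \<lparr>actions = actions A, locs = locs A, init_loc = init_loc A, clocks = clocks A,
      invar = (\<lambda>l. map (inst_atom v) (invar A l)), edges = map (inst_edge v) (edges A)\<rparr>"

subsection \<open>Runs and untimed traces\<close>

type_synonym cval = "clock \<Rightarrow> real"
type_synonym state = "loc \<times> cval"

fun sat_atom :: "cval \<Rightarrow> tatom \<Rightarrow> bool" where
  "sat_atom w (ClockAtom x r a) \<longleftrightarrow> compare r (w x) a"
| "sat_atom w (NumAtom a r b) \<longleftrightarrow> compare r a b"

definition sat :: "cval \<Rightarrow> tatom list \<Rightarrow> bool" where
  "sat w g \<longleftrightarrow> (\<forall>a\<in>set g. sat_atom w a)"

definition delay :: "cval \<Rightarrow> real \<Rightarrow> cval" where
  "delay w d = (\<lambda>x. w x + d)"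

definition reset :: "cval \<Rightarrow> clock set \<Rightarrow> cval" where
  "reset w R = (\<lambda>x. if x \<in> R then 0 else w x)"

text \<open>The invariant holds throughout the delay and on entering the target location.\<close>

definition step :: "tatom automaton \<Rightarrow> state \<Rightarrow> real \<Rightarrow> tatom edge \<Rightarrow> state \<Rightarrow> bool" where
  "step T s d e s' \<longleftrightarrow>
     (case (s, s') of ((l, w), (l', w')) \<Rightarrow>
        d \<ge> 0 \<and> e \<in> set (edges T) \<and> source e = l \<and> target e = l' \<and>
        (\<forall>d'\<in>{0..d}. sat (delay w d') (invar T l)) \<and>
        sat (delay w d) (guard e) \<and>
        w' = reset (delay w d) (set (resets e)) \<and>
        sat w' (invar T l'))"

text \<open>A run with \<open>N \<le> \<infinity>\<close> steps; it is maximal: if finite, its last state has no successor.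
  The values of \<open>s\<close> beyond \<open>N\<close>, and of \<open>d\<close> and \<open>e\<close> from \<open>N\<close> on, are irrelevant.\<close>

definition is_run ::
  "tatom automaton \<Rightarrow> enat \<Rightarrow> (nat \<Rightarrow> state) \<Rightarrow> (nat \<Rightarrow> real) \<Rightarrow> (nat \<Rightarrow> tatom edge) \<Rightarrow> bool" where
  "is_run T N s d e \<longleftrightarrow>
     s 0 = (init_loc T, \<lambda>_. 0) \<and> sat (\<lambda>_. 0) (invar T (init_loc T)) \<and>
     (\<forall>i. enat i < N \<longrightarrow> step T (s i) (d i) (e i) (s (Suc i))) \<and>
     (\<forall>n. N = enat n \<longrightarrow> \<not> (\<exists>d' e' s'. step T (s n) d' e' s'))"

text \<open>Finite and infinite sequences of pairs (location, action) as partial functions on \<open>nat\<close>.\<close>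

type_synonym trace = "nat \<Rightarrow> (loc \<times> act) option"

definition untimed_trace :: "enat \<Rightarrow> (nat \<Rightarrow> state) \<Rightarrow> (nat \<Rightarrow> tatom edge) \<Rightarrow> trace" where
  "untimed_trace N s e = (\<lambda>i. if enat i < N then Some (fst (s i), label (e i)) else None)"

definition Traces :: "tatom automaton \<Rightarrow> trace set" where
  "Traces T = {untimed_trace N s e | N s d e. is_run T N s d e}"

section \<open>Robust trace preservation\<close>

text \<open>\<open>J\<close> is the range of the parameters. Valuations are extensional functions on the set of
  parameters, so that \<open>v' \<noteq> v\<close> means that they differ on some parameter.\<close>

definition valuations :: "real set \<Rightarrow> pta \<Rightarrow> (param \<Rightarrow> rat) set" where
  "valuations J A = (\<Pi>\<^sub>E p\<in>set (params A). {q. 0 \<le> q \<and> real_of_rat q \<in> J})"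

definition robust_trace_preservation :: "real set \<Rightarrow> pta \<times> (param \<Rightarrow> rat) \<Rightarrow> bool" where
  "robust_trace_preservation J = (\<lambda>(A, v).
     \<exists>v'\<in>valuations J A. v' \<noteq> v \<and>
       (\<forall>k\<in>{0..1::real}.
          Traces (instantiate (\<lambda>p. k * real_of_rat (v p) + (1 - k) * real_of_rat (v' p)) A) =
          Traces (instantiate (\<lambda>p. real_of_rat (v p)) A)))"

definition one_param_instances :: "real set \<Rightarrow> (pta \<times> (param \<Rightarrow> rat)) set" where
  "one_param_instances J =
     {(A, v). wf_pta A \<and> card (set (params A)) = 1 \<and> v \<in> valuations J A}"

subsection \<open>Encoding of instances as natural numbers\<close>

fun enc_cmp :: "cmp \<Rightarrow> nat" where
  "enc_cmp CLt = 0"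
| "enc_cmp CLe = 1"
| "enc_cmp CEq = 2"
| "enc_cmp CGe = 3"
| "enc_cmp CGt = 4"

fun enc_atom :: "patom \<Rightarrow> nat" where
  "enc_atom (ClockParam x r p c) = list_encode [0, x, enc_cmp r, p, int_encode c]"
| "enc_atom (ClockConst x r c) = list_encode [1, x, enc_cmp r, int_encode c]"
| "enc_atom (ParamConst p r c) = list_encode [2, p, enc_cmp r, int_encode c]"

definition enc_constraint :: "patom list \<Rightarrow> nat" where
  "enc_constraint g = list_encode (map enc_atom g)"

definition enc_edge :: "patom edge \<Rightarrow> nat" where
  "enc_edge e = list_encode
     [source e, enc_constraint (guard e), label e, list_encode (resets e), target e]"

definition enc_pta :: "pta \<Rightarrow> nat" where
  "enc_pta A = list_encode
     [list_encode (actions A), list_encode (locs A), init_loc A, list_encode (clocks A),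
      list_encode (params A),
      list_encode (map (\<lambda>l. enc_constraint (invar A l)) (locs A)),
      list_encode (map enc_edge (edges A))]"

definition enc_rat :: "rat \<Rightarrow> nat" where
  "enc_rat q = (case quotient_of q of (a, b) \<Rightarrow> prod_encode (int_encode a, int_encode b))"

definition enc_instance :: "pta \<times> (param \<Rightarrow> rat) \<Rightarrow> nat" where
  "enc_instance = (\<lambda>(A, v).
     prod_encode (enc_pta A, list_encode (map (\<lambda>p. enc_rat (v p)) (params A))))"

lemma enc_cmp_inject: "enc_cmp r = enc_cmp r' \<longleftrightarrow> r = r'"
  by (cases r; cases r') auto

lemma inj_enc_atom: "inj enc_atom"
proof (rule injI)
  fix a b assume "enc_atom a = enc_atom b"
  then show "a = b"
    by (cases a; cases b) (auto simp: enc_cmp_inject list_encode_eq int_encode_eq simp del: list_encode.simps)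
qed

lemma enc_constraint_inject: "enc_constraint g = enc_constraint h \<longleftrightarrow> g = h"
  by (simp add: enc_constraint_def inj_map_eq_map[OF inj_enc_atom] list_encode_eq)

lemma inj_enc_edge: "inj enc_edge"
proof (rule injI)
  fix a b assume "enc_edge a = enc_edge b"
  then show "a = b"
    by (auto simp: enc_edge_def enc_constraint_inject list_encode_eq simp del: list_encode.simps
        intro!: edge.equality)
qed

lemma enc_rat_inject: "enc_rat q = enc_rat r \<longleftrightarrow> q = r"
  by (auto simp: enc_rat_def int_encode_eq split: prod.splits dest: quotient_of_div)

text \<open>The encoding loses no information.\<close>

lemma inj_on_enc_instance: "inj_on enc_instance (one_param_instances J)"
proof (rule inj_onI)
  fix x y
  assume xy: "x \<in> one_param_instances J" "y \<in> one_param_instances J"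
    and eq: "enc_instance x = enc_instance y"
  obtain A v B w where [simp]: "x = (A, v)" "y = (B, w)" by fastforce
  have wf: "wf_pta A" "wf_pta B" and val: "v \<in> valuations J A" "w \<in> valuations J B"
    using xy by (auto simp: one_param_instances_def)
  have fields: "actions A = actions B" "locs A = locs B" "init_loc A = init_loc B"
      "clocks A = clocks B" "params A = params B" "edges A = edges B"
    and inv_eq: "\<forall>l\<in>set (locs B). invar A l = invar B l"
    and v_eq: "\<forall>p\<in>set (params B). v p = w p"
    using eq
    by (auto simp: enc_instance_def enc_pta_def enc_constraint_inject enc_rat_inject
        inj_map_eq_map[OF inj_enc_edge] list_encode_eq simp del: list_encode.simps)
  have "invar A l = invar B l" for l
    using wf inv_eq fields(2) by (cases "l \<in> set (locs B)") (auto simp: wf_pta_def)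
  then have "invar A = invar B" ..
  then have "A = B" using fields by (cases A; cases B) simp
  moreover have "v = w"
    using val v_eq fields(5) unfolding valuations_def
    by (intro PiE_ext[of v "set (params B)" _ w]) auto
  ultimately show "x = y" by simp
qed

end

theory Submission
  imports Defs
begin

text \<open>A rational \<open>a / b\<close> in the interior of the parameter range serves as the given valuation. Put
  \<open>\<eta> = a - b p\<close>, so that \<open>\<eta>\<close> vanishes exactly there, and represent the value \<open>n\<close> of a register by
  the clock value \<open>1 + n \<eta>\<close>. Clocks can be shifted exactly by \<open>\<plusminus>p\<close> and \<open>\<plusminus>1\<close>, hence by \<open>\<plusminus>\<eta>\<close>, and
  comparing with \<open>1\<close> tests for zero. For \<open>\<eta> \<noteq> 0\<close> this simulates a counter program faithfully until
  some register exceeds about \<open>1 / \<bar>\<eta>\<bar>\<close>, whereas no register is ever seen to be positive if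
  \<open>\<eta> = 0\<close>. So a halting program reaches its final location for all \<open>p \<noteq> a / b\<close> close to \<open>a / b\<close>, but
  not for \<open>p = a / b\<close>, and a program that does not halt never reaches it. Additional
  edges make every path that avoids the final location possible for every \<open>p\<close>; hence the traces are
  preserved near \<open>a / b\<close> iff the program does not halt. Running a supposed decision procedure on the code of the
  automaton that simulates this very run yields the contradiction.\<close>

section \<open>Counter programs for recursive functions\<close>

text \<open>The program has to know the code of the automaton that runs it. This self-reference is
  resolved by the order of the construction: the inputs occur in the automaton only as constants of
  three guards, so the program is compiled first, its graph fixes the locations and all other edges,
  and only then are the inputs chosen as codes of these fixed components. The full code is a
  computable function of the inputs, which the program evaluates itself.

  A competing valuation \<open>v'\<close> may lie on either side of \<open>a / b\<close> and at any
  distance. The segment from \<open>v'\<close> to \<open>v\<close> always contains points that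
  differ from \<open>v\<close> and are as close to it as a given halting computation requires; so
  one halting run refutes all \<open>v'\<close> at once. As \<eta> can have both signs, the offset
  \<open>1\<close> is what keeps the clock values positive as long as
  \<open>n * \<bar>\<eta>\<bar> < 1\<close>. At \<eta> = 0 the registers cannot be read at all, and
  therefore the inputs are counted by elapsed time rather than by the registers themselves.\<close>

datatype (prog_ops: 'o) prog = Op 'o | Seq "'o prog" "'o prog" | Star "'o prog"

primrec sem :: "('o \<Rightarrow> ('s \<times> 's) set) \<Rightarrow> 'o prog \<Rightarrow> ('s \<times> 's) set" where
  "sem I (Op x) = I x"
| "sem I (Seq c d) = sem I c O sem I d"
| "sem I (Star c) = (sem I c)\<^sup>*"

lemma finite_prog_ops: "finite (prog_ops c)"
  by (induction c) auto

datatype counter_op = Inc nat | Dec nat | IsZero nat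

fun counter_sem :: "counter_op \<Rightarrow> ((nat \<Rightarrow> nat) \<times> (nat \<Rightarrow> nat)) set" where
  "counter_sem (Inc r) = {(s, s'). s' = s(r := Suc (s r))}"
| "counter_sem (Dec r) = {(s, s'). s r > 0 \<and> s' = s(r := s r - 1)}"
| "counter_sem (IsZero r) = {(s, s'). s r = 0 \<and> s' = s}"

abbreviation exec :: "counter_op prog \<Rightarrow> (nat \<Rightarrow> nat) \<Rightarrow> (nat \<Rightarrow> nat) \<Rightarrow> bool" where
  "exec c s s' \<equiv> (s, s') \<in> sem counter_sem c"

lemma exec_Seq: "exec (Seq c d) s s'' \<longleftrightarrow> (\<exists>s'. exec c s s' \<and> exec d s' s'')"
  by auto

section \<open>Draining, copying and clearing registers\<close>

primrec take_and_inc :: "nat \<Rightarrow> nat list \<Rightarrow> counter_op prog" where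
  "take_and_inc r [] = Op (Dec r)"
| "take_and_inc r (a # as) = Seq (take_and_inc r as) (Op (Inc a))"

definition drain :: "nat \<Rightarrow> nat list \<Rightarrow> counter_op prog" where
  "drain r as = Seq (Star (take_and_inc r as)) (Op (IsZero r))"

lemma exec_take_and_inc:
  assumes "distinct as" "r \<notin> set as"
  shows "exec (take_and_inc r as) s s' \<longleftrightarrow> s r > 0 \<and>
    s' = (\<lambda>x. if x = r then s r - 1 else if x \<in> set as then Suc (s x) else s x)"
  using assms
proof (induction as arbitrary: s')
  case Nil
  have "s(r := s r - 1) = (\<lambda>x. if x = r then s r - 1 else if x \<in> set [] then Suc (s x) else s x)"
    by auto
  then show ?case unfolding take_and_inc.simps sem.simps counter_sem.simps by simp
next
  case (Cons a as)
  let ?f = "\<lambda>as x. if x = r then s r - 1 else if x \<in> set as then Suc (s x) else s x"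
  have "(?f as)(a := Suc (?f as a)) = ?f (a # as)"
    using Cons.prems by (auto simp: fun_eq_iff)
  moreover have "exec (take_and_inc r (a # as)) s s' \<longleftrightarrow>
      s r > 0 \<and> s' = (?f as)(a := Suc (?f as a))"
    using Cons by (auto simp: exec_Seq simp del: sem.simps(2))
  ultimately show ?case by simp
qed

text \<open>\<open>Star\<close> may stop after any number of rounds, but the zero test admits only a
  run that empties \<open>r\<close>. The map \<open>?f\<close> takes the same value before and after
  a round and fixes the states with \<open>s r = 0\<close>, so the result is unique.\<close>

lemma exec_drain:
  assumes "distinct as" "r \<notin> set as"
  shows "exec (drain r as) s s' \<longleftrightarrow>
    s' = (\<lambda>x. if x = r then 0 else if x \<in> set as then s x + s r else s x)"
    (is "_ \<longleftrightarrow> s' = ?f s")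
proof
  let ?B = "sem counter_sem (take_and_inc r as)"
  let ?g = "\<lambda>s x. if x = r then s r - 1 else if x \<in> set as then Suc (s x) else s x"
  have B: "(s, s') \<in> ?B \<longleftrightarrow> s r > 0 \<and> s' = ?g s" for s s'
    by (rule exec_take_and_inc[OF assms])
  {
    assume "exec (drain r as) s s'"
    then have star: "(s, s') \<in> ?B\<^sup>*" and 0: "s' r = 0"
      by (auto simp: drain_def)
    have "?f s1 = ?f s2" if "(s1, s2) \<in> ?B" for s1 s2
      using that unfolding B by (auto simp: fun_eq_iff)
    note inv = this
    from star have "?f s = ?f s'"
    proof (induction rule: rtrancl_induct)
      case (step s1 s2)
      show ?case by (rule trans[OF step.IH inv[OF step.hyps(2)]])
    qed (rule refl)
    also have "\<dots> = s'" using 0 by (auto simp: fun_eq_iff)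
    finally show "s' = ?f s" ..
  next
    have "(s, ?f s) \<in> ?B\<^sup>*"
    proof (induction "s r" arbitrary: s)
      case 0
      have "?f s = s" using 0 by (auto simp: fun_eq_iff)
      then show ?case by simp
    next
      case (Suc n)
      have first: "(s, ?g s) \<in> ?B" using Suc.hyps(2) unfolding B by simp
      have "n = ?g s r" using Suc.hyps(2) by simp
      then have "(?g s, ?f (?g s)) \<in> ?B\<^sup>*" by (rule Suc.hyps(1))
      moreover have "?f (?g s) = ?f s"
        using Suc.hyps(2) by (auto simp: fun_eq_iff)
      ultimately have "(?g s, ?f s) \<in> ?B\<^sup>*" by (simp only:)
      with first show ?case by (rule converse_rtrancl_into_rtrancl)
    qed
    moreover assume "s' = ?f s"
    ultimately show "exec (drain r as) s s'"
      unfolding drain_def sem.simps by (intro relcompI[of _ s']) simp_all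
  }
qed

text \<open>Draining destroys its source, so a second copy is kept in \<open>tmp\<close> and moved
  back. The value is added to \<open>b\<close>, which has to be zero for a genuine copy.\<close>

definition copy :: "nat \<Rightarrow> nat \<Rightarrow> nat \<Rightarrow> counter_op prog" where
  "copy a b tmp = Seq (drain a [b, tmp]) (drain tmp [a])"

lemma exec_copy:
  assumes "a \<noteq> b" "tmp \<noteq> a" "tmp \<noteq> b" "s tmp = 0"
  shows "exec (copy a b tmp) s s' \<longleftrightarrow> s' = s(b := s b + s a)"
proof -
  let ?s = "\<lambda>x. if x = a then 0 else if x \<in> set [b, tmp] then s x + s a else s x"
  have "exec (copy a b tmp) s s' \<longleftrightarrow>
      s' = (\<lambda>x. if x = tmp then 0 else if x \<in> set [a] then ?s x + ?s tmp else ?s x)"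
    using assms by (simp add: copy_def exec_Seq exec_drain del: sem.simps)
  also have "(\<lambda>x. if x = tmp then 0 else if x \<in> set [a] then ?s x + ?s tmp else ?s x) =
      s(b := s b + s a)"
    using assms by (auto simp: fun_eq_iff)
  finally show ?thesis .
qed

lemma exec_clear: "exec (drain r []) s s' \<longleftrightarrow> s' = s(r := 0)"
proof -
  have "(\<lambda>x. if x = r then 0 else if x \<in> set [] then s x + s r else s x) = s(r := 0)" by auto
  then show ?thesis by (subst exec_drain) (simp_all only:, simp_all)
qed

lemma exec_move: "a \<noteq> b \<Longrightarrow> exec (drain a [b]) s s' \<longleftrightarrow> s' = s(b := s b + s a, a := 0)"
proof -
  assume "a \<noteq> b"
  moreover have "(\<lambda>x. if x = a then 0 else if x \<in> set [b] then s x + s a else s x) =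
      s(b := s b + s a, a := 0)"
    by auto
  ultimately show ?thesis by (subst exec_drain) (simp_all only:, simp_all)
qed

text \<open>Having no final state is the relational counterpart of an undefined value; this is the
  code for a wrong number of arguments.\<close>

definition fail :: "nat \<Rightarrow> counter_op prog" where
  "fail r = Seq (Op (Inc r)) (Op (IsZero r))"

lemma exec_fail: "\<not> exec (fail r) s s'"
  by (auto simp: fail_def)

primrec clears :: "nat \<Rightarrow> nat \<Rightarrow> counter_op prog \<Rightarrow> counter_op prog" where
  "clears k 0 c = c"
| "clears k (Suc m) c = Seq (clears k m c) (drain (k + m) [])"

lemma exec_clears:
  "exec (clears k m c) s s' \<longleftrightarrow>
    (\<exists>s1. exec c s s1 \<and> s' = (\<lambda>x. if k \<le> x \<and> x < k + m then 0 else s1 x))"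
proof (induction m arbitrary: s')
  case 0
  have "(\<lambda>x. if k \<le> x \<and> x < k + 0 then 0 else s1 x) = s1" for s1 :: "nat \<Rightarrow> nat"
    by (auto simp: fun_eq_iff)
  then show ?case by (simp only: clears.simps) blast
next
  case (Suc m)
  have "(\<lambda>x. if k \<le> x \<and> x < k + m then 0 else s1 x)(k + m := 0) =
      (\<lambda>x. if k \<le> x \<and> x < k + Suc m then 0 else s1 x)" for s1 :: "nat \<Rightarrow> nat"
    by (auto simp: fun_eq_iff)
  then show ?case
    by (auto simp: exec_Seq exec_clear Suc simp del: sem.simps)
qed

section \<open>Compiling recursive functions to counter programs\<close>

type_synonym compiled = "nat list \<Rightarrow> nat \<Rightarrow> nat \<Rightarrow> counter_op prog"

primrec eval_args ::
  "compiled list \<Rightarrow> nat list \<Rightarrow> nat \<Rightarrow> nat \<Rightarrow> counter_op prog \<Rightarrow> counter_op prog" where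
  "eval_args [] args i k d = d"
| "eval_args (c # cs) args i k d = Seq (c args i k) (eval_args cs args (Suc i) k d)"

text \<open>\<open>code f args out k\<close> reads its arguments from the registers \<open>args\<close>, writes the value into
  \<open>out\<close>, and uses the registers from \<open>k\<close> on as work space, which is zero before and after.\<close>

primrec code :: "recf \<Rightarrow> compiled" where
  "code Zero = (\<lambda>args out k. Op (IsZero out))"
| "code Succ = (\<lambda>args out k.
     if length args = 1 then Seq (copy (args ! 0) out k) (Op (Inc out)) else fail k)"
| "code (Proj i) = (\<lambda>args out k. if i < length args then copy (args ! i) out k else fail k)"
| "code (Comp f gs) = (\<lambda>args out k.
     clears k (length gs) (eval_args (map code gs) args k (k + length gs)
       (code f [k..<k + length gs] out (k + length gs))))"
| "code (PrimRec f g) = (\<lambda>args out k.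
     if args = [] then fail k else
     Seq (code f (tl args) (k + 1) (k + 4))
    (Seq (copy (hd args) (k + 2) (k + 3))
    (Seq (Star (Seq (Op (Dec (k + 2)))
               (Seq (code g (k # (k + 1) # tl args) (k + 3) (k + 4))
               (Seq (drain (k + 1) [])
               (Seq (drain (k + 3) [k + 1])
                    (Op (Inc k)))))))
    (Seq (Op (IsZero (k + 2)))
    (Seq (drain k []) (drain (k + 1) [out]))))))"
| "code (Mu f) = (\<lambda>args out k.
     Seq (code f (k # args) (k + 1) (k + 2))
    (Seq (Star (Seq (Op (Dec (k + 1)))
               (Seq (drain (k + 1) [])
               (Seq (Op (Inc k))
                    (code f (k # args) (k + 1) (k + 2))))))
    (Seq (Op (IsZero (k + 1)))
         (drain k [out]))))"

definition ready :: "nat list \<Rightarrow> nat \<Rightarrow> nat \<Rightarrow> (nat \<Rightarrow> nat) \<Rightarrow> bool" where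
  "ready args out k s \<longleftrightarrow>
     (\<forall>a\<in>set args. a < k) \<and> out < k \<and> out \<notin> set args \<and> s out = 0 \<and> (\<forall>r\<ge>k. s r = 0)"

text \<open>The equivalence also covers divergence: where the function is undefined, the program has
  no final state.\<close>

definition implements :: "compiled \<Rightarrow> recf \<Rightarrow> bool" where
  "implements c f \<longleftrightarrow> (\<forall>args out k s s'. ready args out k s \<longrightarrow>
     (exec (c args out k) s s' \<longleftrightarrow> (\<exists>y. rec_eval f (map s args) y \<and> s' = s(out := y))))"

lemma implementsD:
  assumes "implements c f" "ready args out k s"
  shows "exec (c args out k) s s' \<longleftrightarrow> (\<exists>y. rec_eval f (map s args) y \<and> s' = s(out := y))"
  using assms by (auto simp: implements_def)

lemma exec_eval_args:
  assumes "\<forall>g\<in>set gs. implements (code g) g" "i + length gs \<le> k"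
    "\<forall>a\<in>set args. a < i" "\<forall>r\<ge>i. s r = 0"
  shows "exec (eval_args (map code gs) args i k d) s s' \<longleftrightarrow>
    (\<exists>ys. list_all2 (\<lambda>g y. rec_eval g (map s args) y) gs ys \<and>
       exec d (\<lambda>x. if i \<le> x \<and> x < i + length ys then ys ! (x - i) else s x) s')"
  using assms
proof (induction gs arbitrary: i s)
  case Nil
  have "(\<lambda>x. if i \<le> x \<and> x < i then z x else s x) = s" for z
    by (auto simp: fun_eq_iff)
  then show ?case by simp
next
  case (Cons g gs)
  have r: "ready args i k s" using Cons.prems by (auto simp: ready_def)
  have same: "map (s(i := y)) args = map s args" for y
    using Cons.prems(3) by auto
  have upd: "(\<lambda>x. if Suc i \<le> x \<and> x < Suc i + length ys then ys ! (x - Suc i) else (s(i := y)) x) =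
      (\<lambda>x. if i \<le> x \<and> x < i + length (y # ys) then (y # ys) ! (x - i) else s x)"
    for y and ys :: "nat list"
    by (auto simp: fun_eq_iff nth_Cons')
  have "exec (eval_args (map code gs) args (Suc i) k d) (s(i := y)) s' \<longleftrightarrow>
    (\<exists>ys. list_all2 (\<lambda>g y. rec_eval g (map s args) y) gs ys \<and>
       exec d (\<lambda>x. if i \<le> x \<and> x < i + length (y # ys) then (y # ys) ! (x - i) else s x) s')" for y
    using Cons.prems by (subst Cons.IH) (auto simp only: same upd, auto)
  moreover have "exec (code g args i k) s s1 \<longleftrightarrow>
      (\<exists>y. rec_eval g (map s args) y \<and> s1 = s(i := y))" for s1
    using Cons.prems r by (auto simp: implementsD)
  ultimately have "exec (eval_args (map code (g # gs)) args i k d) s s' \<longleftrightarrow>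
    (\<exists>y. rec_eval g (map s args) y \<and> (\<exists>ys. list_all2 (\<lambda>g y. rec_eval g (map s args) y) gs ys \<and>
       exec d (\<lambda>x. if i \<le> x \<and> x < i + length (y # ys) then (y # ys) ! (x - i) else s x) s'))"
    by (simp only: list.map eval_args.simps exec_Seq) blast
  then show ?case
    by (simp only: list_all2_Cons1) blast
qed

lemma implements_Comp:
  assumes f: "implements (code f) f" and gs: "\<forall>g\<in>set gs. implements (code g) g"
  shows "implements (code (Comp f gs)) (Comp f gs)"
  unfolding implements_def
proof (intro allI impI)
  fix args out k s s'
  assume r: "ready args out k s"
  let ?m = "length gs"
  let ?fill = "\<lambda>ys x. if k \<le> x \<and> x < k + length ys then ys ! (x - k) else s x"
  have sub: "exec (code f [k..<k + ?m] out (k + ?m)) (?fill ys) s1 \<longleftrightarrow>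
      (\<exists>y. rec_eval f ys y \<and> s1 = (?fill ys)(out := y))" if "length ys = ?m" for ys s1
  proof -
    have vals: "map (?fill ys) [k..<k + ?m] = ys"
      using that by (intro nth_equalityI) auto
    have "ready [k..<k + ?m] out (k + ?m) (?fill ys)"
      using r that by (auto simp: ready_def)
    from implementsD[OF f this, of s1] show ?thesis unfolding vals .
  qed
  \<comment> \<open>The argument values occupy registers from \<open>k\<close> on, which
    \<open>ready\<close> guarantees to be zero in \<open>s\<close>; clearing them restores
    \<open>s\<close> except at \<open>out\<close>.\<close>
  have restore: "(\<lambda>x. if k \<le> x \<and> x < k + ?m then 0 else ((?fill ys)(out := y)) x) = s(out := y)"
    if "length ys = ?m" for ys y
    using r that by (auto simp: fun_eq_iff ready_def)
  have "exec (code (Comp f gs) args out k) s s' \<longleftrightarrow>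
    (\<exists>ys. list_all2 (\<lambda>g y. rec_eval g (map s args) y) gs ys \<and>
      (\<exists>s1. exec (code f [k..<k + ?m] out (k + ?m)) (?fill ys) s1 \<and>
        s' = (\<lambda>x. if k \<le> x \<and> x < k + ?m then 0 else s1 x)))"
  proof -
    have "\<forall>a\<in>set args. a < k" "\<forall>r\<ge>k. s r = 0" using r by (auto simp: ready_def)
    from exec_eval_args[OF gs order_refl this]
    have args: "exec (eval_args (map code gs) args k (k + ?m) d) s s1 \<longleftrightarrow>
      (\<exists>ys. list_all2 (\<lambda>g y. rec_eval g (map s args) y) gs ys \<and> exec d (?fill ys) s1)" for d s1 .
    show ?thesis unfolding code.simps exec_clears args by blast
  qed
  also have "\<dots> \<longleftrightarrow> (\<exists>ys. list_all2 (\<lambda>g y. rec_eval g (map s args) y) gs ys \<and>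
      (\<exists>y. rec_eval f ys y \<and> s' = s(out := y)))"
  proof (rule ex_cong1, rule conj_cong[OF refl])
    fix ys assume "list_all2 (\<lambda>g y. rec_eval g (map s args) y) gs ys"
    then have l: "length ys = ?m" by (simp add: list_all2_lengthD)
    show "(\<exists>s1. exec (code f [k..<k + ?m] out (k + ?m)) (?fill ys) s1 \<and>
        s' = (\<lambda>x. if k \<le> x \<and> x < k + ?m then 0 else s1 x)) \<longleftrightarrow>
      (\<exists>y. rec_eval f ys y \<and> s' = s(out := y))"
      unfolding sub[OF l] using restore[OF l] by (auto simp only:)
  qed
  also have "\<dots> \<longleftrightarrow> (\<exists>y. rec_eval (Comp f gs) (map s args) y \<and> s' = s(out := y))"
  proof -
    have "rec_eval (Comp f gs) xs y \<longleftrightarrow>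
        (\<exists>ys. list_all2 (\<lambda>g y. rec_eval g xs y) gs ys \<and> rec_eval f ys y)" for xs y
      by (blast intro: eval_Comp elim: rec_eval_elims(4))
    then show ?thesis by blast
  qed
  finally show "exec (code (Comp f gs) args out k) s s' \<longleftrightarrow>
      (\<exists>y. rec_eval (Comp f gs) (map s args) y \<and> s' = s(out := y))" .
qed

lemma ex_conj_image: "(\<exists>s. (\<exists>y. P y \<and> s = g y) \<and> Q s) \<longleftrightarrow> (\<exists>y. P y \<and> Q (g y))"
  by blast

lemma implements_PrimRec:
  assumes f: "implements (code f) f" and g: "implements (code g) g"
  shows "implements (code (PrimRec f g)) (PrimRec f g)"
  unfolding implements_def
proof (intro allI impI)
  fix args out k s s'
  assume r: "ready args out k s"
  show "exec (code (PrimRec f g) args out k) s s' \<longleftrightarrow>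
      (\<exists>y. rec_eval (PrimRec f g) (map s args) y \<and> s' = s(out := y))"
  proof (cases args)
    case Nil
    have "\<not> rec_eval (PrimRec f g) [] y" for y
      by (auto elim: rec_eval.cases)
    with Nil show ?thesis by (simp add: exec_fail del: sem.simps)
  next
    case (Cons a as)
    define r1 r2 r3 r4 where "r1 = k + 1" and "r2 = k + 2" and "r3 = k + 3" and "r4 = k + 4"
    note r_defs = r1_def r2_def r3_def r4_def
    have neq: "r1 \<noteq> k" "r2 \<noteq> k" "r3 \<noteq> k" "r2 \<noteq> r1" "r3 \<noteq> r1" "r3 \<noteq> r2"
      "k \<noteq> r1" "k \<noteq> r2" "k \<noteq> r3" "r1 \<noteq> r2" "r1 \<noteq> r3" "r2 \<noteq> r3"
      by (simp_all add: r_defs)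
    have lt: "a < k" "out < k" "\<forall>b\<in>set as. b < k" "out \<noteq> a" "out \<notin> set as"
      and zero: "s out = 0" "\<And>r. r \<ge> k \<Longrightarrow> s r = 0"
      using r Cons by (auto simp: ready_def)
    have out: "out \<noteq> k" "out \<noteq> r1" "out \<noteq> r2" "out \<noteq> r3" and a: "a \<noteq> k" "a \<noteq> r1" "a \<noteq> r2" "a \<noteq> r3"
      using lt by (auto simp: r_defs)
    have as: "k \<notin> set as" "r1 \<notin> set as" "r2 \<notin> set as" "r3 \<notin> set as"
      using lt by (auto simp: r_defs)
    have zero_r: "s k = 0" "s r1 = 0" "s r2 = 0" "s r3 = 0"
      by (simp_all add: zero r_defs)
    define xs where "xs = map s as"
    define n where "n = s a"
    \<comment> \<open>The state after \<open>j\<close> rounds: \<open>k\<close> holds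
      \<open>j\<close>, \<open>r1\<close> the value at \<open>j\<close>, and \<open>r2\<close> the
      number of remaining rounds. The next value is computed into \<open>r3\<close>, which is zero
      between rounds.\<close>
    define st where "st j y = s(k := j, r1 := y, r2 := n - j)" for j y
    define ret where "ret s = s(r1 := s r3, r3 := 0, k := Suc (s k))" for s :: "nat \<Rightarrow> nat"
    define body where "body = Seq (Op (Dec r2))
               (Seq (code g (k # r1 # as) r3 r4)
               (Seq (drain r1 []) (Seq (drain r3 [r1]) (Op (Inc k)))))"
    define final where "final = Seq (Op (IsZero r2)) (Seq (drain k []) (drain r1 [out]))"
    have body: "exec body (st j y) s1 \<longleftrightarrow>
        j < n \<and> (\<exists>z. rec_eval g (j # y # xs) z \<and> s1 = st (Suc j) z)" for j y s1
    proof -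
      let ?s = "(st j y)(r2 := n - j - 1)"
      have rd: "ready (k # r1 # as) r3 r4 ?s"
        using lt zero by (auto simp: ready_def st_def r_defs)
      have args: "map ?s (k # r1 # as) = j # y # xs"
        using neq as by (auto simp: st_def xs_def)
      have ret: "ret (?s(r3 := z)) = st (Suc j) z" for z
        by (rule ext) (simp add: st_def ret_def zero_r neq)
      have dec: "exec (Seq (Op (Dec r2)) d) (st j y) s1 \<longleftrightarrow> j < n \<and> exec d ?s s1" for d
      proof -
        have "st j y r2 = n - j" by (simp add: st_def)
        then show ?thesis by (simp add: exec_Seq del: sem.simps(2))
      qed
      have tail: "exec (Seq (drain r1 []) (Seq (drain r3 [r1]) (Op (Inc k)))) s2 s1 \<longleftrightarrow> s1 = ret s2" for s2
        using neq by (simp add: exec_Seq exec_clear exec_move ret_def del: sem.simps(2))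
      have "exec body (st j y) s1 \<longleftrightarrow> j < n \<and>
          (\<exists>s2. exec (code g (k # r1 # as) r3 r4) ?s s2 \<and> s1 = ret s2)"
        unfolding body_def by (subst dec, subst exec_Seq, subst tail) (rule refl)
      also have "\<dots> \<longleftrightarrow> j < n \<and>
          (\<exists>s2. (\<exists>z. rec_eval g (j # y # xs) z \<and> s2 = ?s(r3 := z)) \<and> s1 = ret s2)"
        using implementsD[OF g rd] unfolding args by simp
      also have "\<dots> \<longleftrightarrow> j < n \<and> (\<exists>z. rec_eval g (j # y # xs) z \<and> s1 = ret (?s(r3 := z)))"
        by blast
      finally show ?thesis unfolding ret .
    qed
    \<comment> \<open>Subtraction is truncated, so \<open>j \<le> n\<close> is carried along; it
      lets the final test on \<open>r2\<close> yield \<open>j = n\<close>.\<close>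
    have sound: "\<exists>j y. j \<le> n \<and> s1 = st j y \<and> rec_eval (PrimRec f g) (j # xs) y"
      if "(st 0 y0, s1) \<in> (sem counter_sem body)\<^sup>*" "rec_eval f xs y0" for y0 s1
      using that
    proof (induction rule: rtrancl_induct)
      case base
      then show ?case by (auto intro: rec_eval.intros)
    next
      case (step s1 s2)
      then obtain j y where *: "j \<le> n" "s1 = st j y" "rec_eval (PrimRec f g) (j # xs) y" by blast
      obtain z where "j < n" "rec_eval g (j # y # xs) z" "s2 = st (Suc j) z"
        using step.hyps(2) unfolding *(2) body by blast
      with * show ?case
        by (intro exI[of _ "Suc j"] exI[of _ z]) (auto intro: rec_eval.intros)
    qed
    have complete: "\<exists>y0. rec_eval f xs y0 \<and> (st 0 y0, st j y) \<in> (sem counter_sem body)\<^sup>*"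
      if "rec_eval (PrimRec f g) (j # xs) y" "j \<le> n" for j y
      using that
    proof (induction j arbitrary: y)
      case 0
      from 0(1) have "rec_eval f xs y" by (rule rec_eval_elims)
      then show ?case by blast
    next
      case (Suc j)
      from Suc.prems(1) obtain z where
        z: "rec_eval (PrimRec f g) (j # xs) z" "rec_eval g (j # z # xs) y"
        by (rule rec_eval_elims)
      from Suc.prems have "j \<le> n" by simp
      from Suc.IH[OF z(1) this] obtain y0 where
        *: "rec_eval f xs y0" "(st 0 y0, st j z) \<in> (sem counter_sem body)\<^sup>*"
        by blast
      have "exec body (st j z) (st (Suc j) y)"
        using z Suc.prems unfolding body by auto
      with * show ?case by (blast intro: rtrancl.rtrancl_into_rtrancl)
    qed
    have first: "exec (code f as r1 r4) s s1 \<longleftrightarrow> (\<exists>y0. rec_eval f xs y0 \<and> s1 = s(r1 := y0))" for s1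
      unfolding xs_def using lt zero by (intro implementsD[OF f]) (auto simp: ready_def r_defs)
    have cp: "exec (copy a r2 r3) (s(r1 := y0)) s1 \<longleftrightarrow> s1 = st 0 y0" for y0 s1
    proof -
      have "(s(r1 := y0))(r2 := (s(r1 := y0)) r2 + (s(r1 := y0)) a) = st 0 y0"
        using a neq zero_r by (auto simp: st_def n_def fun_eq_iff)
      then show ?thesis using a neq zero_r by (subst exec_copy) simp_all
    qed
    have final: "exec final (st j y) s' \<longleftrightarrow> j = n \<and> s' = s(out := y)" if "j \<le> n" for j y
    proof -
      let ?s = "(st j y)(k := 0)"
      have "exec final (st j y) s' \<longleftrightarrow> st j y r2 = 0 \<and> s' = ?s(out := ?s out + ?s r1, r1 := 0)"
        unfolding final_def using out neq
        by (simp add: exec_Seq exec_clear exec_move del: sem.simps(2))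
      moreover have "st j y r2 = 0 \<longleftrightarrow> j = n"
        using that neq by (auto simp: st_def)
      moreover have "?s(out := ?s out + ?s r1, r1 := 0) = s(out := y)" if "j = n"
        using that out neq zero zero_r by (auto simp: st_def fun_eq_iff)
      ultimately show ?thesis by auto
    qed
    have "code (PrimRec f g) args out k =
        Seq (code f as r1 r4) (Seq (copy a r2 r3) (Seq (Star body) final))"
      by (simp add: Cons body_def final_def r_defs)
    then have "exec (code (PrimRec f g) args out k) s s' \<longleftrightarrow>
      (\<exists>y0. rec_eval f xs y0 \<and> (\<exists>s1. (st 0 y0, s1) \<in> (sem counter_sem body)\<^sup>* \<and> exec final s1 s'))"
      by (simp only: exec_Seq first cp sem.simps(3) ex_conj_image simp_thms)
    also have "\<dots> \<longleftrightarrow> (\<exists>y. rec_eval (PrimRec f g) (n # xs) y \<and> s' = s(out := y))"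
    proof
      assume "\<exists>y0. rec_eval f xs y0 \<and>
        (\<exists>s1. (st 0 y0, s1) \<in> (sem counter_sem body)\<^sup>* \<and> exec final s1 s')"
      then obtain y0 s1 where *: "rec_eval f xs y0" "(st 0 y0, s1) \<in> (sem counter_sem body)\<^sup>*"
        "exec final s1 s'"
        by blast
      from sound[OF *(2,1)] obtain j y where
        "j \<le> n" "s1 = st j y" "rec_eval (PrimRec f g) (j # xs) y" by blast
      with *(3) final show "\<exists>y. rec_eval (PrimRec f g) (n # xs) y \<and> s' = s(out := y)" by blast
    next
      assume "\<exists>y. rec_eval (PrimRec f g) (n # xs) y \<and> s' = s(out := y)"
      then show "\<exists>y0. rec_eval f xs y0 \<and>
        (\<exists>s1. (st 0 y0, s1) \<in> (sem counter_sem body)\<^sup>* \<and> exec final s1 s')"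
        using complete final by blast
    qed
    finally show ?thesis by (simp add: Cons n_def xs_def)
  qed
qed

lemma implements_Mu:
  assumes f: "implements (code f) f"
  shows "implements (code (Mu f)) (Mu f)"
  unfolding implements_def
proof (intro allI impI)
  fix args out k s s'
  assume r: "ready args out k s"
  define r1 r2 where "r1 = k + 1" and "r2 = k + 2"
  have neq: "r1 \<noteq> k" "k \<noteq> r1"
    by (simp_all add: r1_def)
  have lt: "out < k" "\<forall>b\<in>set args. b < k" "out \<notin> set args"
    and zero: "s out = 0" "\<And>r. r \<ge> k \<Longrightarrow> s r = 0"
    using r by (auto simp: ready_def)
  have out: "out \<noteq> k" "out \<noteq> r1" and args: "k \<notin> set args" "r1 \<notin> set args"
    using lt by (auto simp: r1_def)
  have zero_r: "s k = 0" "s r1 = 0"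
    by (simp_all add: zero r1_def)
  define xs where "xs = map s args"
  \<comment> \<open>\<open>k\<close> holds the candidate \<open>i\<close> and \<open>r1\<close> the
    value of \<open>f\<close> there. The decrement that opens \<open>body\<close> tests that this
    value is positive, as minimisation demands of every rejected candidate.\<close>
  define st where "st i y = s(k := i, r1 := y)" for i y
  define body where "body = Seq (Op (Dec r1))
               (Seq (drain r1 []) (Seq (Op (Inc k)) (code f (k # args) r1 r2)))"
  define final where "final = Seq (Op (IsZero r1)) (drain k [out])"
  have call: "exec (code f (k # args) r1 r2) (st i 0) s1 \<longleftrightarrow>
      (\<exists>y. rec_eval f (i # xs) y \<and> s1 = st i y)" for i s1
  proof -
    have rd: "ready (k # args) r1 r2 (st i 0)"
      using lt zero by (auto simp: ready_def st_def r1_def r2_def)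
    have vals: "map (st i 0) (k # args) = i # xs"
      using args neq by (auto simp: st_def xs_def)
    have upd: "(st i 0)(r1 := y) = st i y" for y
      by (simp add: st_def)
    show ?thesis unfolding implementsD[OF f rd] vals upd by (rule refl)
  qed
  have body: "exec body (st i y) s1 \<longleftrightarrow>
      y > 0 \<and> (\<exists>z. rec_eval f (Suc i # xs) z \<and> s1 = st (Suc i) z)" for i y s1
  proof -
    have upd: "(st i y)(r1 := 0, k := Suc i) = st (Suc i) 0"
      using neq by (auto simp: st_def fun_eq_iff)
    have "st i y r1 = y" "st i y k = i" using neq by (simp_all add: st_def)
    then show ?thesis
      unfolding body_def using neq
      by (simp add: exec_Seq exec_clear upd call del: sem.simps(2))
  qed
  have sound: "\<exists>i y. s1 = st i y \<and> rec_eval f (i # xs) y \<and> (\<forall>i'<i. \<exists>y. rec_eval f (i' # xs) (Suc y))"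
    if "(st 0 y0, s1) \<in> (sem counter_sem body)\<^sup>*" "rec_eval f (0 # xs) y0" for y0 s1
    using that
  proof (induction rule: rtrancl_induct)
    case base
    then show ?case by blast
  next
    case (step s1 s2)
    then obtain i y where iy: "s1 = st i y" "rec_eval f (i # xs) y"
      "\<forall>i'<i. \<exists>y. rec_eval f (i' # xs) (Suc y)" by blast
    obtain z where z: "y > 0" "rec_eval f (Suc i # xs) z" "s2 = st (Suc i) z"
      using step.hyps(2) unfolding iy(1) body by blast
    obtain u where "y = Suc u" using z(1) by (cases y) auto
    with iy(2,3) have "\<forall>i'<Suc i. \<exists>y. rec_eval f (i' # xs) (Suc y)"
      by (auto simp: less_Suc_eq)
    with z show ?case by blast
  qed
  have complete: "\<exists>y0. rec_eval f (0 # xs) y0 \<and> (st 0 y0, st i y) \<in> (sem counter_sem body)\<^sup>*"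
    if "rec_eval f (i # xs) y" "\<forall>i'<i. \<exists>y. rec_eval f (i' # xs) (Suc y)" for i y
    using that
  proof (induction i arbitrary: y)
    case 0
    then show ?case by blast
  next
    case (Suc i)
    then obtain u where u: "rec_eval f (i # xs) (Suc u)" by blast
    have "\<forall>i'<i. \<exists>y. rec_eval f (i' # xs) (Suc y)" using Suc.prems(2) by simp
    from Suc.IH[OF u this] obtain y0 where *: "rec_eval f (0 # xs) y0"
      "(st 0 y0, st i (Suc u)) \<in> (sem counter_sem body)\<^sup>*"
      by blast
    have "exec body (st i (Suc u)) (st (Suc i) y)"
      using Suc.prems unfolding body by auto
    with * show ?case by (blast intro: rtrancl.rtrancl_into_rtrancl)
  qed
  have final: "exec final (st i y) s' \<longleftrightarrow> y = 0 \<and> s' = s(out := i)" for i y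
  proof -
    have "exec final (st i y) s' \<longleftrightarrow>
        st i y r1 = 0 \<and> s' = (st i y)(out := st i y out + st i y k, k := 0)"
      unfolding final_def using out neq
      by (simp add: exec_Seq exec_move del: sem.simps(2))
    moreover have "st i y r1 = y" by (simp add: st_def)
    moreover have "(st i y)(out := st i y out + st i y k, k := 0) = s(out := i)" if "y = 0"
      using that out neq zero zero_r by (auto simp: st_def fun_eq_iff)
    ultimately show ?thesis by auto
  qed
  have "s = st 0 0" using zero_r by (auto simp: st_def fun_eq_iff)
  moreover have "code (Mu f) args out k =
      Seq (code f (k # args) r1 r2) (Seq (Star body) final)"
    by (simp add: body_def final_def r1_def r2_def)
  ultimately have "exec (code (Mu f) args out k) s s' \<longleftrightarrow>
      exec (Seq (code f (k # args) r1 r2) (Seq (Star body) final)) (st 0 0) s'"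
    by (simp only:)
  also have "\<dots> \<longleftrightarrow> (\<exists>y0. rec_eval f (0 # xs) y0 \<and>
      (\<exists>s1. (st 0 y0, s1) \<in> (sem counter_sem body)\<^sup>* \<and> exec final s1 s'))"
    by (simp only: exec_Seq call sem.simps(3) ex_conj_image)
  also have "\<dots> \<longleftrightarrow> (\<exists>y. rec_eval (Mu f) (map s args) y \<and> s' = s(out := y))"
    unfolding xs_def[symmetric]
  proof
    assume "\<exists>y0. rec_eval f (0 # xs) y0 \<and>
      (\<exists>s1. (st 0 y0, s1) \<in> (sem counter_sem body)\<^sup>* \<and> exec final s1 s')"
    then obtain y0 s1 where *: "rec_eval f (0 # xs) y0" "(st 0 y0, s1) \<in> (sem counter_sem body)\<^sup>*"
      "exec final s1 s'" by blast
    from sound[OF *(2,1)] obtain i y where iy: "s1 = st i y" "rec_eval f (i # xs) y"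
      "\<forall>i'<i. \<exists>y. rec_eval f (i' # xs) (Suc y)" by blast
    from *(3) have "y = 0" "s' = s(out := i)" unfolding iy(1) final by simp_all
    moreover from this iy have "rec_eval (Mu f) xs i" by (intro eval_Mu) simp_all
    ultimately show "\<exists>y. rec_eval (Mu f) xs y \<and> s' = s(out := y)" by blast
  next
    assume "\<exists>y. rec_eval (Mu f) xs y \<and> s' = s(out := y)"
    then obtain i where i: "rec_eval (Mu f) xs i" "s' = s(out := i)" by blast
    from i(1) have "rec_eval f (i # xs) 0" "\<forall>i'<i. \<exists>y. rec_eval f (i' # xs) (Suc y)"
      by (rule rec_eval_elims, blast)+
    from complete[OF this] i(2) final show "\<exists>y0. rec_eval f (0 # xs) y0 \<and>
      (\<exists>s1. (st 0 y0, s1) \<in> (sem counter_sem body)\<^sup>* \<and> exec final s1 s')"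
      by blast
  qed
  finally show "exec (code (Mu f) args out k) s s' \<longleftrightarrow>
    (\<exists>y. rec_eval (Mu f) (map s args) y \<and> s' = s(out := y))" .
qed

lemma implements_code: "implements (code f) f"
proof (induction f)
  case Zero
  then show ?case
    by (auto simp: implements_def ready_def fun_eq_iff intro: rec_eval.intros elim!: rec_eval_elims)
next
  case Succ
  show ?case
    unfolding implements_def
  proof (intro allI impI)
    fix args out k s s'
    assume r: "ready args out k s"
    show "exec (code Succ args out k) s s' \<longleftrightarrow>
      (\<exists>y. rec_eval Succ (map s args) y \<and> s' = s(out := y))"
    proof (cases "length args = 1")
      case True
      then obtain a where a: "args = [a]" by (auto simp: length_Suc_conv)
      then have "exec (copy a out k) s s1 \<longleftrightarrow> s1 = s(out := s a)" for s1
        using r by (subst exec_copy) (auto simp: ready_def)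
      then show ?thesis
        using a by (auto simp: exec_Seq intro: rec_eval.intros elim!: rec_eval_elims
            simp del: sem.simps(2))
    next
      case False
      then have "\<not> rec_eval Succ (map s args) y" for y
        by (auto elim!: rec_eval_elims)
      then show ?thesis using False by (simp add: exec_fail del: sem.simps)
    qed
  qed
next
  case (Proj i)
  show ?case
    unfolding implements_def
  proof (intro allI impI)
    fix args out k s s'
    assume r: "ready args out k s"
    show "exec (code (Proj i) args out k) s s' \<longleftrightarrow>
      (\<exists>y. rec_eval (Proj i) (map s args) y \<and> s' = s(out := y))"
    proof (cases "i < length args")
      case True
      then have "args ! i \<in> set args" by simp
      then have "exec (copy (args ! i) out k) s s1 \<longleftrightarrow> s1 = s(out := s (args ! i))" for s1
        using r by (subst exec_copy) (auto simp: ready_def)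
      moreover have eval_nth: "rec_eval (Proj i) (map s args) (s (args ! i))"
        using eval_Proj[of i "map s args"] True by simp
      have "rec_eval (Proj i) (map s args) y \<longleftrightarrow> y = s (args ! i)" for y
        using True by (auto elim!: rec_eval_elims simp: eval_nth)
      ultimately show ?thesis using True by simp
    next
      case False
      then have "\<not> rec_eval (Proj i) (map s args) y" for y
        by (auto elim!: rec_eval_elims)
      then show ?thesis using False by (simp add: exec_fail del: sem.simps)
    qed
  qed
next
  case (Comp f gs)
  then show ?case by (intro implements_Comp ballI)
next
  case (PrimRec f g)
  then show ?case by (rule implements_PrimRec)
next
  case (Mu f)
  then show ?case by (rule implements_Mu)
qed

section \<open>Control graphs\<close>

type_synonym 'o graph = "(nat \<times> 'o option \<times> nat) list"

primrec fresh :: "'o prog \<Rightarrow> nat" where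
  "fresh (Op x) = 0"
| "fresh (Seq c d) = Suc (fresh c + fresh d)"
| "fresh (Star c) = Suc (fresh c)"

text \<open>\<open>graph c i j n\<close> leads from node \<open>i\<close> to node \<open>j\<close>; its inner nodes are \<open>n, \<dots>, n + fresh c - 1\<close>.\<close>

primrec graph :: "'o prog \<Rightarrow> nat \<Rightarrow> nat \<Rightarrow> nat \<Rightarrow> 'o graph" where
  "graph (Op x) i j n = [(i, Some x, j)]"
| "graph (Seq c d) i j n = graph c i n (Suc n) @ graph d n j (Suc n + fresh c)"
| "graph (Star c) i j n = (i, None, n) # (n, None, j) # graph c n n (Suc n)"

lemma graph_nodes:
  "(x, e, y) \<in> set (graph c i j n) \<Longrightarrow>
    x \<in> {i, j} \<union> {n..<n + fresh c} \<and> y \<in> {i, j} \<union> {n..<n + fresh c}"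
proof (induction c arbitrary: i j n)
  case (Seq c d)
  then consider "(x, e, y) \<in> set (graph c i n (Suc n))"
    | "(x, e, y) \<in> set (graph d n j (Suc n + fresh c))" by auto
  then show ?case
  proof cases
    case 1
    from Seq.IH(1)[OF this] show ?thesis by auto
  next
    case 2
    from Seq.IH(2)[OF this] show ?thesis by auto
  qed
next
  case (Star c)
  then consider "(x, y) = (i, n)" | "(x, y) = (n, j)" | "(x, e, y) \<in> set (graph c n n (Suc n))" by auto
  then show ?case
  proof cases
    case 3
    from Star.IH[OF this] show ?thesis by auto
  qed auto
qed auto

definition label_sem :: "('o \<Rightarrow> ('s \<times> 's) set) \<Rightarrow> 'o option \<Rightarrow> ('s \<times> 's) set" where
  "label_sem I e = (case e of None \<Rightarrow> Id | Some x \<Rightarrow> I x)"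

lemma label_sem_simps [simp]: "label_sem I None = Id" "label_sem I (Some x) = I x"
  by (simp_all add: label_sem_def)

text \<open>A Floyd annotation: assertions at the nodes that are preserved along the edges.\<close>

definition inductive_on :: "('o \<Rightarrow> ('s \<times> 's) set) \<Rightarrow> 'o graph \<Rightarrow> (nat \<Rightarrow> 's set) \<Rightarrow> bool" where
  "inductive_on I G A \<longleftrightarrow> (\<forall>(x, e, y)\<in>set G. label_sem I e `` A x \<subseteq> A y)"

lemma inductive_on_append:
  "inductive_on I (G @ H) A \<longleftrightarrow> inductive_on I G A \<and> inductive_on I H A"
  by (simp add: inductive_on_def ball_Un)

lemma inductive_on_cong:
  assumes "inductive_on I G A" "\<And>x e y. (x, e, y) \<in> set G \<Longrightarrow> A' x = A x \<and> A' y = A y"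
  shows "inductive_on I G A'"
  unfolding inductive_on_def
proof (rule ballI, clarify)
  fix x e y s s'
  assume "(x, e, y) \<in> set G" "s \<in> A' x" "(s, s') \<in> label_sem I e"
  then show "s' \<in> A' y" using assms unfolding inductive_on_def by blast
qed

text \<open>Strongest postconditions serve at the inner nodes: the image of \<open>A i\<close>
  between the parts of a sequence, and its closure under iteration at the head of a loop. The
  assertions at \<open>i\<close> and \<open>j\<close> stay as given, so annotations of several
  programs can be combined; the case \<open>i = j\<close> covers the loading loops.\<close>

lemma graph_annotation:
  assumes "i < n" "j < n" "sem I c `` A i \<subseteq> A j"
  shows "\<exists>A'. (\<forall>x. x \<notin> {n..<n + fresh c} \<longrightarrow> A' x = A x) \<and> inductive_on I (graph c i j n) A'"
  using assms
proof (induction c arbitrary: i j n A)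
  case (Op x)
  then show ?case by (intro exI[of _ A]) (auto simp: inductive_on_def)
next
  case (Seq c d)
  define A0 where "A0 = A(n := sem I c `` A i)"
  have "sem I c `` A0 i \<subseteq> A0 n" using Seq.prems by (simp add: A0_def)
  with Seq.IH(1)[where i = i and j = n and n = "Suc n" and A = A0] Seq.prems obtain A1 where
    A1: "\<And>x. x \<notin> {Suc n..<Suc n + fresh c} \<Longrightarrow> A1 x = A0 x" "inductive_on I (graph c i n (Suc n)) A1"
    by auto
  have "A1 n = sem I c `` A i" "A1 j = A j"
    using A1(1)[of n] A1(1)[of j] Seq.prems by (simp_all add: A0_def)
  then have "sem I d `` A1 n \<subseteq> A1 j" using Seq.prems(3) by (simp add: relcomp_Image)
  with Seq.IH(2)[where i = n and j = j and n = "Suc n + fresh c" and A = A1] Seq.prems obtain A2 where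
    A2: "\<And>x. x \<notin> {Suc n + fresh c..<Suc n + fresh c + fresh d} \<Longrightarrow> A2 x = A1 x"
      "inductive_on I (graph d n j (Suc n + fresh c)) A2"
    by auto
  have "inductive_on I (graph c i n (Suc n)) A2"
  proof (rule inductive_on_cong[OF A1(2)])
    fix x e y assume "(x, e, y) \<in> set (graph c i n (Suc n))"
    from graph_nodes[OF this] Seq.prems show "A2 x = A1 x \<and> A2 y = A1 y"
      by (auto intro!: A2(1))
  qed
  moreover have "A2 x = A x" if "x \<notin> {n..<n + fresh (Seq c d)}" for x
  proof -
    have "A2 x = A1 x" using that by (intro A2(1)) auto
    also have "\<dots> = A0 x" using that by (intro A1(1)) auto
    finally show ?thesis using that by (auto simp: A0_def)
  qed
  ultimately show ?case
    using A2(2) by (intro exI[of _ A2]) (auto simp: inductive_on_append)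
next
  case (Star c)
  define A0 where "A0 = A(n := (sem I c)\<^sup>* `` A i)"
  have "sem I c `` A0 n \<subseteq> A0 n"
    by (auto simp: A0_def intro: rtrancl.rtrancl_into_rtrancl)
  with Star.IH[where i = n and j = n and n = "Suc n" and A = A0] obtain A1 where
    A1: "\<And>x. x \<notin> {Suc n..<Suc n + fresh c} \<Longrightarrow> A1 x = A0 x" "inductive_on I (graph c n n (Suc n)) A1"
    by auto
  have vals: "A1 n = (sem I c)\<^sup>* `` A i" "A1 i = A i" "A1 j = A j"
    using A1(1)[of n] A1(1)[of i] A1(1)[of j] Star.prems by (simp_all add: A0_def)
  have "inductive_on I (graph (Star c) i j n) A1"
    using A1(2) vals Star.prems by (auto simp: inductive_on_def)
  moreover have "A1 x = A x" if "x \<notin> {n..<n + fresh (Star c)}" for x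
  proof -
    have "A1 x = A0 x" using that by (intro A1(1)) auto
    then show ?thesis using that by (auto simp: A0_def)
  qed
  ultimately show ?case by blast
qed

definition graph_step ::
  "('o \<Rightarrow> ('s \<times> 's) set) \<Rightarrow> 'o graph \<Rightarrow> ((nat \<times> 's) \<times> (nat \<times> 's)) set" where
  "graph_step I G = {((x, s), (y, s')). \<exists>e. (x, e, y) \<in> set G \<and> (s, s') \<in> label_sem I e}"

lemma graph_path:
  assumes "(s, s') \<in> sem I c" "set (graph c i j n) \<subseteq> set G"
  shows "((i, s), (j, s')) \<in> (graph_step I G)\<^sup>*"
  using assms
proof (induction c arbitrary: i j n s s')
  case (Op x)
  then show ?case by (intro r_into_rtrancl) (auto simp: graph_step_def intro!: exI[of _ "Some x"])
next
  case (Seq c d)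
  from Seq.prems(1) obtain s1 where s1: "(s, s1) \<in> sem I c" "(s1, s') \<in> sem I d" by auto
  have "((i, s), (n, s1)) \<in> (graph_step I G)\<^sup>*"
    using Seq.prems(2) by (intro Seq.IH(1)[OF s1(1), of _ _ "Suc n"]) simp
  also have "((n, s1), (j, s')) \<in> (graph_step I G)\<^sup>*"
    using Seq.prems(2) by (intro Seq.IH(2)[OF s1(2), of _ _ "Suc n + fresh c"]) simp
  finally show ?case .
next
  case (Star c)
  have skip: "((x, t), (y, t)) \<in> graph_step I G" if "(x, None, y) \<in> set G" for x y t
    using that by (auto simp: graph_step_def intro!: exI[of _ None])
  from Star.prems(1) have "(s, s') \<in> (sem I c)\<^sup>*" by simp
  then have "((n, s), (n, s')) \<in> (graph_step I G)\<^sup>*"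
  proof (induction rule: rtrancl_induct)
    case (step s1 s2)
    have "((n, s1), (n, s2)) \<in> (graph_step I G)\<^sup>*"
      using Star.prems(2) by (intro Star.IH[OF step.hyps(2), of _ _ "Suc n"]) simp
    with step.IH show ?case by (rule rtrancl_trans)
  qed simp
  moreover have "((i, s), (n, s)) \<in> graph_step I G" "((n, s'), (j, s')) \<in> graph_step I G"
    using Star.prems(2) by (auto intro: skip)
  ultimately show ?case
    by (meson converse_rtrancl_into_rtrancl rtrancl.rtrancl_into_rtrancl)
qed

section \<open>Counters as clock values\<close>

text \<open>Clock \<open>0\<close> measures the current cycle, clock \<open>1\<close> the time since the last input was loaded, and
  clock \<open>r + 2\<close> holds register \<open>r\<close>. A move changes the value of one register during a cycle of
  length \<open>period\<close>: all other registers are reset when they reach \<open>period\<close> and so return to their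
  value, whereas the moved register is reset when it reaches \<open>reset_at\<close>. Thresholds are pairs
  \<open>(q, c)\<close> standing for \<open>p + c\<close> or \<open>c\<close>.\<close>

datatype move = AddP | SubP | Add1 | Sub1

text \<open>Period minus reset time is the change of the moved register: \<open>p\<close>,
  \<open>- p\<close>, \<open>1\<close> or \<open>- 1\<close>. The base \<open>2 * a + 6\<close>
  exceeds every admissible register value, and for \<open>p \<le> a + 1\<close> twice a reset time
  minus such a value exceeds every period, so that a second reset comes too late.\<close>

fun period :: "nat \<Rightarrow> move \<Rightarrow> bool \<times> nat" where
  "period a AddP = (True, 2 * a + 6)"
| "period a SubP = (False, 2 * a + 6)"
| "period a Add1 = (False, 2 * a + 7)"
| "period a Sub1 = (False, 2 * a + 6)"

fun reset_at :: "nat \<Rightarrow> move \<Rightarrow> bool \<times> nat" where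
  "reset_at a AddP = (False, 2 * a + 6)"
| "reset_at a SubP = (True, 2 * a + 6)"
| "reset_at a Add1 = (False, 2 * a + 6)"
| "reset_at a Sub1 = (False, 2 * a + 7)"

definition threshold :: "real \<Rightarrow> bool \<times> nat \<Rightarrow> real" where
  "threshold p e = (if fst e then p else 0) + real (snd e)"

definition is_reg :: "nat \<Rightarrow> clock \<Rightarrow> bool" where
  "is_reg K x \<longleftrightarrow> 2 \<le> x \<and> x < K + 2"

text \<open>The upper bound leaves room for the intermediate values of an increment or decrement,
  which stay below \<open>a + 2\<close> when the represented values lie between \<open>0\<close> and
  \<open>2\<close>.\<close>

definition bounded_regs :: "nat \<Rightarrow> nat \<Rightarrow> cval \<Rightarrow> bool" where
  "bounded_regs a K w \<longleftrightarrow> (\<forall>x. is_reg K x \<longrightarrow> 0 < w x \<and> w x < real (a + 4))"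

definition shift :: "nat \<Rightarrow> nat \<Rightarrow> real \<Rightarrow> real \<Rightarrow> cval \<Rightarrow> cval" where
  "shift K r \<delta> \<tau> w =
     (\<lambda>x. if x = 0 then w 0 else if is_reg K x then (if x = r + 2 then w x + \<delta> else w x) else w x + \<tau>)"

datatype clock_op = Shift nat move | IsOne nat | NotOne nat | Elapsed nat

definition move_shift :: "nat \<Rightarrow> nat \<Rightarrow> real \<Rightarrow> nat \<Rightarrow> move \<Rightarrow> cval \<Rightarrow> cval" where
  "move_shift a K p r m =
     shift K r (threshold p (period a m) - threshold p (reset_at a m)) (threshold p (period a m))"

fun clock_sem :: "nat \<Rightarrow> nat \<Rightarrow> real \<Rightarrow> clock_op \<Rightarrow> (cval \<times> cval) set" where
  "clock_sem a K p (Shift r m) = {(w, w'). w' = move_shift a K p r m w \<and> bounded_regs a K w'}"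
| "clock_sem a K p (IsOne r) = {(w, w'). w (r + 2) = 1 \<and> w' = w}"
| "clock_sem a K p (NotOne r) = {(w, w'). w (r + 2) \<noteq> 1 \<and> w' = w}"
| "clock_sem a K p (Elapsed n) = {(w, w'). w 1 = real n \<and> w' = w(1 := 0)}"

text \<open>The operation runs \<open>Suc n\<close> times, as programs have no skip; callers pass
  \<open>a - 1\<close> and \<open>b - 1\<close> for positive \<open>a\<close> and
  \<open>b\<close>.\<close>

primrec repeat :: "'o \<Rightarrow> nat \<Rightarrow> 'o prog" where
  "repeat x 0 = Op x"
| "repeat x (Suc n) = Seq (Op x) (repeat x n)"

lemma sem_repeat: "sem I (repeat x n) = I x ^^ Suc n"
  by (induction n) (simp_all add: relpow_commute[symmetric] O_assoc)

text \<open>Incrementing uses only moves whose length does not depend on the parameter, so that the number of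
  increments can be read off clock \<open>1\<close>.\<close>

fun counter_impl :: "nat \<Rightarrow> nat \<Rightarrow> counter_op \<Rightarrow> clock_op prog" where
  "counter_impl a b (Inc r) =
     Seq (repeat (Shift r Add1) (a - 1)) (repeat (Shift r SubP) (b - 1))"
| "counter_impl a b (Dec r) = Seq (Op (NotOne r))
     (Seq (repeat (Shift r AddP) (b - 1)) (repeat (Shift r Sub1) (a - 1)))"
| "counter_impl a b (IsZero r) = Op (IsOne r)"

definition inc_time :: "nat \<Rightarrow> nat \<Rightarrow> nat" where
  "inc_time a b = a * (2 * a + 7) + b * (2 * a + 6)"

primrec expand :: "('o \<Rightarrow> 'q prog) \<Rightarrow> 'o prog \<Rightarrow> 'q prog" where
  "expand f (Op x) = f x"
| "expand f (Seq c d) = Seq (expand f c) (expand f d)"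
| "expand f (Star c) = Star (expand f c)"

fun reg_of :: "counter_op \<Rightarrow> nat" where
  "reg_of (Inc r) = r"
| "reg_of (Dec r) = r"
| "reg_of (IsZero r) = r"

definition represents :: "nat \<Rightarrow> real \<Rightarrow> (nat \<Rightarrow> nat) \<Rightarrow> cval \<Rightarrow> bool" where
  "represents K \<eta> n w \<longleftrightarrow> w 0 = 0 \<and> (\<forall>r<K. w (r + 2) = 1 + real (n r) * \<eta>)"

section \<open>Counter operations as sequences of moves\<close>

lemma shift_shift: "shift K r \<delta> \<tau> (shift K r \<delta>' \<tau>' w) = shift K r (\<delta> + \<delta>') (\<tau> + \<tau>') w"
  by (rule ext) (simp add: shift_def)

lemma shift_0: "shift K r 0 0 w = w"
  by (rule ext) (simp add: shift_def)

lemma represents_shift: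
  assumes "represents K \<eta> n w" "r < K" "1 + real (n r) * \<eta> + \<delta> = 1 + real m * \<eta>"
  shows "represents K \<eta> (n(r := m)) (shift K r \<delta> \<tau> w)"
  using assms by (auto simp: represents_def shift_def is_reg_def)

lemma shift_pow_sound:
  assumes "(w, w') \<in> clock_sem a K p (Shift r m) ^^ n"
  shows "w' = shift K r (real n * (threshold p (period a m) - threshold p (reset_at a m)))
    (real n * threshold p (period a m)) w"
  using assms
proof (induction n arbitrary: w')
  case 0
  then show ?case by (simp add: shift_0)
next
  case (Suc n)
  from Suc.prems obtain w1 where w1: "(w, w1) \<in> clock_sem a K p (Shift r m) ^^ n"
    "w' = move_shift a K p r m w1"
    by auto
  show ?case
    unfolding w1(2) move_shift_def Suc.IH[OF w1(1)] shift_shift by (simp add: algebra_simps)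
qed

lemma shift_pow_complete:
  assumes "\<And>j. 0 < j \<Longrightarrow> j \<le> n \<Longrightarrow> bounded_regs a K
    (shift K r (real j * (threshold p (period a m) - threshold p (reset_at a m)))
      (real j * threshold p (period a m)) w)"
  shows "(w, shift K r (real n * (threshold p (period a m) - threshold p (reset_at a m)))
    (real n * threshold p (period a m)) w) \<in> clock_sem a K p (Shift r m) ^^ n"
  using assms
proof (induction n)
  case 0
  then show ?case by (simp add: shift_0)
next
  case (Suc n)
  let ?f = "\<lambda>j. shift K r (real j * (threshold p (period a m) - threshold p (reset_at a m)))
    (real j * threshold p (period a m)) w"
  have "(w, ?f n) \<in> clock_sem a K p (Shift r m) ^^ n" using Suc by simp
  moreover have "move_shift a K p r m (?f n) = ?f (Suc n)"
    unfolding move_shift_def shift_shift by (simp add: algebra_simps)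
  then have "(?f n, ?f (Suc n)) \<in> clock_sem a K p (Shift r m)"
    using Suc.prems[of "Suc n"] by simp
  ultimately show ?case by (rule relpow_Suc_I)
qed

lemma threshold_simps:
  "threshold p (period a AddP) = p + 2 * real a + 6" "threshold p (reset_at a AddP) = 2 * real a + 6"
  "threshold p (period a SubP) = 2 * real a + 6" "threshold p (reset_at a SubP) = p + 2 * real a + 6"
  "threshold p (period a Add1) = 2 * real a + 7" "threshold p (reset_at a Add1) = 2 * real a + 6"
  "threshold p (period a Sub1) = 2 * real a + 6" "threshold p (reset_at a Sub1) = 2 * real a + 7"
  by (simp_all add: threshold_def)

lemma inc_sound:
  assumes "0 < a" "0 < b" "(w, w') \<in> sem (clock_sem a K p) (counter_impl a b (Inc r))"
  shows "w' = shift K r (real a - real b * p) (real (inc_time a b)) w"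
proof -
  from assms obtain w1 where "(w, w1) \<in> clock_sem a K p (Shift r Add1) ^^ a"
    "(w1, w') \<in> clock_sem a K p (Shift r SubP) ^^ b"
    by (auto simp: sem_repeat simp del: clock_sem.simps relpow.simps)
  from this[THEN shift_pow_sound] show ?thesis
    by (simp add: shift_shift threshold_simps inc_time_def algebra_simps del: period.simps reset_at.simps)
qed

lemma dec_sound:
  assumes "0 < a" "0 < b" "(w, w') \<in> sem (clock_sem a K p) (counter_impl a b (Dec r))"
  shows "w (r + 2) \<noteq> 1 \<and> (\<exists>\<tau>. w' = shift K r (real b * p - real a) \<tau> w)"
proof -
  from assms obtain w1 where "w (r + 2) \<noteq> 1" "(w, w1) \<in> clock_sem a K p (Shift r AddP) ^^ b"
    "(w1, w') \<in> clock_sem a K p (Shift r Sub1) ^^ a"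
    by (auto simp: sem_repeat simp del: clock_sem.simps(1,2,4) relpow.simps)
  from this(1) this(2,3)[THEN shift_pow_sound] show ?thesis
    by (auto simp: shift_shift threshold_simps algebra_simps simp del: period.simps reset_at.simps)
qed

text \<open>For \<open>\<eta> \<noteq> 0\<close> a register clock equals \<open>1\<close> exactly if
  the register is zero, so the tests are faithful. For \<open>\<eta> = 0\<close> all register clocks
  equal \<open>1\<close> and every zero test passes; what survives is the representation, which is
  then the same for all register contents.\<close>

lemma expand_sound:
  assumes pos: "0 < a" "0 < b" and \<eta>: "\<eta> = real a - real b * p"
  assumes "\<forall>x\<in>prog_ops c. reg_of x < K" "represents K \<eta> n w"
    "(w, w') \<in> sem (clock_sem a K p) (expand (counter_impl a b) c)"
  shows "\<exists>n'. represents K \<eta> n' w' \<and> (\<eta> \<noteq> 0 \<longrightarrow> exec c n n')"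
  using assms(4-)
proof (induction c arbitrary: n w w')
  case (Op x)
  show ?case
  proof (cases x)
    case (Inc r)
    then have "w' = shift K r \<eta> (real (inc_time a b)) w"
      using Op inc_sound[OF pos] by (simp add: \<eta> del: counter_impl.simps)
    moreover have "represents K \<eta> (n(r := Suc (n r))) (shift K r \<eta> (real (inc_time a b)) w)"
      using Op Inc by (intro represents_shift) (auto simp: algebra_simps)
    ultimately show ?thesis using Inc by auto
  next
    case (Dec r)
    then obtain \<tau> where ne: "w (r + 2) \<noteq> 1" and w': "w' = shift K r (- \<eta>) \<tau> w"
      using Op dec_sound[OF pos, of w w' K p r] by (auto simp: \<eta> simp del: counter_impl.simps)
    have r: "r < K" using Op Dec by simp
    then have "w (r + 2) = 1 + real (n r) * \<eta>" using Op by (simp add: represents_def)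
    with ne have "n r > 0" by (cases "n r") auto
    then have "represents K \<eta> (n(r := n r - 1)) w'"
      unfolding w' using Op r by (intro represents_shift) (auto simp: algebra_simps of_nat_diff)
    with \<open>n r > 0\<close> Dec show ?thesis by auto
  next
    case (IsZero r)
    then have "w' = w" "w (r + 2) = 1" using Op by auto
    moreover have "w (r + 2) = 1 + real (n r) * \<eta>" using Op IsZero by (simp add: represents_def)
    ultimately show ?thesis using Op IsZero by auto
  qed
next
  case (Seq c d)
  then obtain w1 where w1: "(w, w1) \<in> sem (clock_sem a K p) (expand (counter_impl a b) c)"
    "(w1, w') \<in> sem (clock_sem a K p) (expand (counter_impl a b) d)"
    by auto
  obtain n1 where n1: "represents K \<eta> n1 w1" "\<eta> \<noteq> 0 \<longrightarrow> exec c n n1"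
    using Seq.IH(1)[OF _ _ w1(1)] Seq.prems by auto
  obtain n2 where "represents K \<eta> n2 w'" "\<eta> \<noteq> 0 \<longrightarrow> exec d n1 n2"
    using Seq.IH(2)[OF _ n1(1) w1(2)] Seq.prems by auto
  with n1 show ?case by auto
next
  case (Star c)
  have regs: "\<forall>x\<in>prog_ops c. reg_of x < K" using Star.prems by simp
  from Star.prems have "(w, w') \<in> (sem (clock_sem a K p) (expand (counter_impl a b) c))\<^sup>*" by simp
  then have "\<exists>n'. represents K \<eta> n' w' \<and> (\<eta> \<noteq> 0 \<longrightarrow> (n, n') \<in> (sem counter_sem c)\<^sup>*)"
  proof (induction rule: rtrancl_induct)
    case base
    then show ?case using Star.prems by auto
  next
    case (step w1 w2)
    then obtain n1 where n1: "represents K \<eta> n1 w1" "\<eta> \<noteq> 0 \<longrightarrow> (n, n1) \<in> (sem counter_sem c)\<^sup>*" by blast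
    from Star.IH[OF regs n1(1) step.hyps(2)] n1(2) show ?case
      by (blast intro: rtrancl.rtrancl_into_rtrancl)
  qed
  then show ?case by simp
qed

definition reg_sum :: "nat \<Rightarrow> (nat \<Rightarrow> nat) \<Rightarrow> nat" where
  "reg_sum K n = (\<Sum>r<K. n r)"

lemma small_register:
  assumes "\<bar>\<eta>\<bar> * real (reg_sum K n + 2) < 1" "r < K" "m \<le> n r + 2"
  shows "\<bar>real m * \<eta>\<bar> < 1"
proof -
  have "n r \<le> reg_sum K n" unfolding reg_sum_def using assms(2) by (intro member_le_sum) auto
  then have "\<bar>real m * \<eta>\<bar> \<le> \<bar>\<eta>\<bar> * real (reg_sum K n + 2)"
    using assms(3) by (simp add: abs_mult mult.commute mult_left_mono)
  with assms(1) show ?thesis by simp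
qed

lemma bounded_shift:
  assumes "represents K \<eta> n w" "\<bar>\<eta>\<bar> * real (reg_sum K n + 2) < 1" "r < K"
    "0 < 1 + real (n r) * \<eta> + \<delta>" "1 + real (n r) * \<eta> + \<delta> < real a + 4"
  shows "bounded_regs a K (shift K r \<delta> \<tau> w)"
  unfolding bounded_regs_def
proof (intro allI impI)
  fix x assume x: "is_reg K x"
  define q where "q = x - 2"
  have q: "x = q + 2" "q < K" using x by (auto simp: q_def is_reg_def)
  have "w (q + 2) = 1 + real (n q) * \<eta>" using assms(1) q(2) by (simp add: represents_def)
  moreover have "\<bar>real (n q) * \<eta>\<bar> < 1" using assms(2) q(2) by (rule small_register) simp
  ultimately have "0 < w x \<and> w x < 2" "x = r + 2 \<Longrightarrow> w x = 1 + real (n r) * \<eta>" using q by auto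
  then show "0 < shift K r \<delta> \<tau> w x \<and> shift K r \<delta> \<tau> w x < real (a + 4)"
    using x assms(4,5) by (auto simp: shift_def is_reg_def)
qed

text \<open>With the additions first, every intermediate value is at least the smaller of the old
  and the new value, hence positive, and it stays below \<open>a + 2\<close>. The decrement behaves
  alike, because \<open>b * p = a - \<eta>\<close>.\<close>

lemma inc_complete:
  assumes pos: "0 < a" "0 < b" and \<eta>: "\<eta> = real a - real b * p" and "0 \<le> p"
    and rep: "represents K \<eta> n w" and small: "\<bar>\<eta>\<bar> * real (reg_sum K n + 2) < 1" and r: "r < K"
  shows "(w, shift K r \<eta> (real (inc_time a b)) w) \<in> sem (clock_sem a K p) (counter_impl a b (Inc r))"
proof -
  have b0: "\<bar>real (n r) * \<eta>\<bar> < 1" "\<bar>real (Suc (n r)) * \<eta>\<bar> < 1"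
    using small r by (rule small_register; simp)+
  let ?w1 = "shift K r (real a) (real a * (2 * real a + 7)) w"
  have "(w, ?w1) \<in> clock_sem a K p (Shift r Add1) ^^ a"
    using shift_pow_complete[of a a K r p Add1 w]
  proof (simp add: threshold_simps del: period.simps reset_at.simps, elim meta_mp)
    fix j :: nat assume "j \<le> a"
    then show "bounded_regs a K (shift K r (real j) (real j * (2 * real a + 7)) w)"
      using b0 by (intro bounded_shift[OF rep small r]) auto
  qed
  moreover have "(?w1, shift K r \<eta> (real (inc_time a b)) w) \<in> clock_sem a K p (Shift r SubP) ^^ b"
  proof -
    have "bounded_regs a K (shift K r (real j * (- p)) (real j * (2 * real a + 6)) ?w1)" if "j \<le> b" for j
    proof -
      have "real j * p \<le> real b * p" using that \<open>0 \<le> p\<close> by (intro mult_right_mono) auto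
      moreover have "0 \<le> real j * p" using \<open>0 \<le> p\<close> by simp
      ultimately show ?thesis
        unfolding shift_shift using b0
        by (intro bounded_shift[OF rep small r]) (auto simp: \<eta> algebra_simps)
    qed
    then have "(?w1, shift K r (real b * (- p)) (real b * (2 * real a + 6)) ?w1)
        \<in> clock_sem a K p (Shift r SubP) ^^ b"
      using shift_pow_complete[of b a K r p SubP ?w1] by (simp add: threshold_simps del: period.simps reset_at.simps)
    moreover have "shift K r (real b * (- p)) (real b * (2 * real a + 6)) ?w1 =
        shift K r \<eta> (real (inc_time a b)) w"
      unfolding shift_shift by (simp add: \<eta> inc_time_def algebra_simps)
    ultimately show ?thesis by simp
  qed
  ultimately show ?thesis
    using pos by (auto simp: sem_repeat simp del: clock_sem.simps relpow.simps)
qed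

lemma dec_complete:
  assumes pos: "0 < a" "0 < b" and \<eta>: "\<eta> = real a - real b * p" "\<eta> \<noteq> 0" and "0 \<le> p"
    and rep: "represents K \<eta> n w" and small: "\<bar>\<eta>\<bar> * real (reg_sum K n + 2) < 1"
    and r: "r < K" "0 < n r"
  shows "\<exists>\<tau>. (w, shift K r (- \<eta>) \<tau> w) \<in> sem (clock_sem a K p) (counter_impl a b (Dec r))"
proof -
  have b0: "\<bar>real (n r) * \<eta>\<bar> < 1" "\<bar>real (n r - 1) * \<eta>\<bar> < 1"
    using small r(1) by (rule small_register; simp)+
  have dec: "real (n r - 1) * \<eta> = real (n r) * \<eta> - \<eta>" using r(2) by (simp add: of_nat_diff algebra_simps)
  let ?w1 = "shift K r (real b * p) (real b * (p + 2 * real a + 6)) w"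
  have "w (r + 2) \<noteq> 1" using rep r \<eta> by (simp add: represents_def)
  moreover have "(w, ?w1) \<in> clock_sem a K p (Shift r AddP) ^^ b"
  proof -
    have "bounded_regs a K (shift K r (real j * p) (real j * (p + 2 * real a + 6)) w)" if "j \<le> b" for j
    proof -
      have "real j * p \<le> real b * p" using that \<open>0 \<le> p\<close> by (intro mult_right_mono) auto
      moreover have "0 \<le> real j * p" using \<open>0 \<le> p\<close> by simp
      moreover have "real b * p = real a - \<eta>" by (simp add: \<eta>)
      ultimately show ?thesis
        using b0 unfolding dec by (intro bounded_shift[OF rep small r(1)]) auto
    qed
    then show ?thesis
      using shift_pow_complete[of b a K r p AddP w] by (simp add: threshold_simps del: period.simps reset_at.simps)
  qed
  moreover obtain \<tau> where "(?w1, shift K r (- \<eta>) \<tau> w) \<in> clock_sem a K p (Shift r Sub1) ^^ a"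
  proof -
    have "bounded_regs a K (shift K r (real j * (- 1)) (real j * (2 * real a + 6)) ?w1)" if "j \<le> a" for j
    proof -
      have "real b * p = real a - \<eta>" by (simp add: \<eta>)
      with that show ?thesis
        unfolding shift_shift using b0 unfolding dec
        by (intro bounded_shift[OF rep small r(1)]) (auto simp: algebra_simps)
    qed
    then have "(?w1, shift K r (real a * (- 1)) (real a * (2 * real a + 6)) ?w1)
        \<in> clock_sem a K p (Shift r Sub1) ^^ a"
      using shift_pow_complete[of a a K r p Sub1 ?w1] by (simp add: threshold_simps del: period.simps reset_at.simps)
    then show ?thesis
      using that unfolding shift_shift by (simp add: \<eta> algebra_simps)
  qed
  ultimately show ?thesis
    using pos by (intro exI[of _ \<tau>]) (auto simp: sem_repeat simp del: clock_sem.simps(1,2,4) relpow.simps)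
qed

text \<open>A single computation meets finitely many register contents, so one bound
  \<open>M\<close> serves it for all \<open>p\<close> and \<open>w\<close>. The bounds of
  consecutive parts are added, and likewise those of the rounds of a loop.\<close>

lemma expand_complete:
  assumes pos: "0 < a" "0 < b" and "\<forall>x\<in>prog_ops c. reg_of x < K" "exec c n n'"
  shows "\<exists>M::nat. \<forall>p w. 0 \<le> p \<longrightarrow> real a - real b * p \<noteq> 0 \<longrightarrow> \<bar>real a - real b * p\<bar> * real M < 1 \<longrightarrow>
    represents K (real a - real b * p) n w \<longrightarrow>
    (\<exists>w'. represents K (real a - real b * p) n' w' \<and>
      (w, w') \<in> sem (clock_sem a K p) (expand (counter_impl a b) c))"
    (is "\<exists>M. ?P c n n' M")
  using assms(3-)
proof (induction c arbitrary: n n')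
  case (Op x)
  have r: "reg_of x < K" using Op by simp
  have "?P (Op x) n n' (reg_sum K n + 2)"
  proof (intro allI impI)
    fix p w
    assume p: "0 \<le> p" "real a - real b * p \<noteq> 0"
      and small: "\<bar>real a - real b * p\<bar> * real (reg_sum K n + 2) < 1"
      and rep: "represents K (real a - real b * p) n w"
    show "\<exists>w'. represents K (real a - real b * p) n' w' \<and>
      (w, w') \<in> sem (clock_sem a K p) (expand (counter_impl a b) (Op x))"
    proof (cases x)
      case (Inc r)
      let ?w = "shift K r (real a - real b * p) (real (inc_time a b)) w"
      have r: "r < K" and n': "n' = n(r := Suc (n r))" using Op Inc by auto
      have "represents K (real a - real b * p) n' ?w"
        unfolding n' using r by (intro represents_shift[OF rep]) (auto simp: algebra_simps)
      with inc_complete[OF pos refl p(1) rep small r] Inc show ?thesis by auto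
    next
      case (Dec r)
      then have r: "r < K" "0 < n r" and n': "n' = n(r := n r - 1)" using Op by auto
      obtain \<tau> where \<tau>: "(w, shift K r (- (real a - real b * p)) \<tau> w)
          \<in> sem (clock_sem a K p) (counter_impl a b (Dec r))"
        using dec_complete[OF pos refl p(2,1) rep small r] by auto
      have "represents K (real a - real b * p) n' (shift K r (- (real a - real b * p)) \<tau> w)"
        unfolding n' using r by (intro represents_shift[OF rep]) (auto simp: algebra_simps of_nat_diff)
      with \<tau> Dec show ?thesis by auto
    next
      case (IsZero r)
      then show ?thesis using Op r rep by (intro exI[of _ w]) (auto simp: represents_def)
    qed
  qed
  then show ?case by blast
next
  case (Seq c d)
  then obtain n1 where n1: "exec c n n1" "exec d n1 n'" by auto
  obtain M1 where M1: "?P c n n1 M1" using Seq.IH(1)[OF _ n1(1)] Seq.prems by auto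
  obtain M2 where M2: "?P d n1 n' M2" using Seq.IH(2)[OF _ n1(2)] Seq.prems by auto
  have "?P (Seq c d) n n' (M1 + M2)"
  proof (intro allI impI)
    fix p w
    assume p: "0 \<le> p" "real a - real b * p \<noteq> 0"
      and small: "\<bar>real a - real b * p\<bar> * real (M1 + M2) < 1"
      and rep: "represents K (real a - real b * p) n w"
    have "\<bar>real a - real b * p\<bar> * real M1 \<le> \<bar>real a - real b * p\<bar> * real (M1 + M2)"
      "\<bar>real a - real b * p\<bar> * real M2 \<le> \<bar>real a - real b * p\<bar> * real (M1 + M2)"
      by (intro mult_left_mono; simp)+
    with small have s: "\<bar>real a - real b * p\<bar> * real M1 < 1" "\<bar>real a - real b * p\<bar> * real M2 < 1"
      by linarith+
    from M1 p s(1) rep obtain w1 where w1: "represents K (real a - real b * p) n1 w1"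
      "(w, w1) \<in> sem (clock_sem a K p) (expand (counter_impl a b) c)" by blast
    from M2 p s(2) w1(1) obtain w2 where w2: "represents K (real a - real b * p) n' w2"
      "(w1, w2) \<in> sem (clock_sem a K p) (expand (counter_impl a b) d)" by blast
    from w1 w2 show "\<exists>w'. represents K (real a - real b * p) n' w' \<and>
      (w, w') \<in> sem (clock_sem a K p) (expand (counter_impl a b) (Seq c d))" by auto
  qed
  then show ?case by blast
next
  case (Star c)
  have regs: "\<forall>x\<in>prog_ops c. reg_of x < K" using Star.prems by simp
  from Star.prems have "(n, n') \<in> (sem counter_sem c)\<^sup>*" by simp
  then show ?case
  proof (induction rule: rtrancl_induct)
    case base
    then show ?case by (intro exI[of _ 0]) auto
  next
    case (step n1 n2)
    then obtain M1 where M1: "?P (Star c) n n1 M1" by blast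
    obtain M2 where M2: "?P c n1 n2 M2" using Star.IH[OF regs step.hyps(2)] by blast
    have "?P (Star c) n n2 (M1 + M2)"
    proof (intro allI impI)
      fix p w
      assume p: "0 \<le> p" "real a - real b * p \<noteq> 0"
        and small: "\<bar>real a - real b * p\<bar> * real (M1 + M2) < 1"
        and rep: "represents K (real a - real b * p) n w"
      have "\<bar>real a - real b * p\<bar> * real M1 \<le> \<bar>real a - real b * p\<bar> * real (M1 + M2)"
        "\<bar>real a - real b * p\<bar> * real M2 \<le> \<bar>real a - real b * p\<bar> * real (M1 + M2)"
        by (intro mult_left_mono; simp)+
      with small have s: "\<bar>real a - real b * p\<bar> * real M1 < 1" "\<bar>real a - real b * p\<bar> * real M2 < 1"
        by linarith+
      from M1 p s(1) rep obtain w1 where w1: "represents K (real a - real b * p) n1 w1"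
        "(w, w1) \<in> sem (clock_sem a K p) (expand (counter_impl a b) (Star c))" by blast
      from M2 p s(2) w1(1) obtain w2 where w2: "represents K (real a - real b * p) n2 w2"
        "(w1, w2) \<in> sem (clock_sem a K p) (expand (counter_impl a b) c)" by blast
      from w1 w2 show "\<exists>w'. represents K (real a - real b * p) n2 w' \<and>
        (w, w') \<in> sem (clock_sem a K p) (expand (counter_impl a b) (Star c))"
        by (auto intro: rtrancl.rtrancl_into_rtrancl)
    qed
    then show ?case by blast
  qed
qed

lemma clock_sem_preserves:
  assumes "(w, w') \<in> label_sem (clock_sem a K p) e" "bounded_regs a K w" "w 0 = 0"
  shows "bounded_regs a K w' \<and> w' 0 = 0"
proof (cases e)
  case None
  then show ?thesis using assms by simp
next
  case (Some x)
  show ?thesis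
  proof (cases x)
    case (Shift r m)
    with Some assms have "w' = move_shift a K p r m w" "bounded_regs a K w'" by auto
    with assms(3) show ?thesis by (simp add: move_shift_def shift_def)
  qed (use assms Some in \<open>auto simp: bounded_regs_def is_reg_def\<close>)
qed

section \<open>The automaton of a control graph\<close>

definition mk_edge :: "loc \<Rightarrow> patom list \<Rightarrow> clock list \<Rightarrow> loc \<Rightarrow> patom edge" where
  "mk_edge l g R l' = \<lparr>source = l, guard = g, label = 0, resets = R, target = l'\<rparr>"

lemma mk_edge_simps [simp]:
  "source (mk_edge l g R l') = l" "guard (mk_edge l g R l') = g" "label (mk_edge l g R l') = 0"
  "resets (mk_edge l g R l') = R" "target (mk_edge l g R l') = l'"
  by (simp_all add: mk_edge_def)

definition equals_atom :: "clock \<Rightarrow> bool \<times> nat \<Rightarrow> patom" where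
  "equals_atom x e =
     (if fst e then ClockParam x CEq 0 (int (snd e)) else ClockConst x CEq (int (snd e)))"

definition bounded_guard :: "nat \<Rightarrow> nat \<Rightarrow> patom list" where
  "bounded_guard a K =
     map (\<lambda>q. ClockConst (q + 2) CGt 0) [0..<K] @ map (\<lambda>q. ClockConst (q + 2) CLt (int (a + 4))) [0..<K]"

text \<open>Node \<open>i\<close> becomes location \<open>2 i\<close>, and the cycle of the \<open>k\<close>-th graph edge is spent in location
  \<open>2 k + 1\<close>.\<close>

fun op_edges :: "nat \<Rightarrow> nat \<Rightarrow> nat \<Rightarrow> nat \<times> clock_op option \<times> nat \<Rightarrow> patom edge list" where
  "op_edges a K k (i, None, j) = [mk_edge (2 * i) [ClockConst 0 CEq 0] [] (2 * j)]"
| "op_edges a K k (i, Some (IsOne r), j) =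
     [mk_edge (2 * i) [ClockConst 0 CEq 0, ClockConst (r + 2) CEq 1] [] (2 * j)]"
| "op_edges a K k (i, Some (NotOne r), j) =
     [mk_edge (2 * i) [ClockConst 0 CEq 0, ClockConst (r + 2) CLt 1] [] (2 * j),
      mk_edge (2 * i) [ClockConst 0 CEq 0, ClockConst (r + 2) CGt 1] [] (2 * j)]"
| "op_edges a K k (i, Some (Elapsed n), j) =
     [mk_edge (2 * i) [ClockConst 0 CEq 0, ClockConst 1 CEq (int n)] [1] (2 * j)]"
| "op_edges a K k (i, Some (Shift r m), j) =
     mk_edge (2 * i) [ClockConst 0 CEq 0] [] (2 * k + 1) #
     mk_edge (2 * k + 1) (equals_atom 0 (period a m) # bounded_guard a K) [0] (2 * j) #
     map (\<lambda>q. mk_edge (2 * k + 1)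
         [equals_atom (q + 2) (if q = r then reset_at a m else period a m)] [q + 2] (2 * k + 1))
       [0..<K]"

text \<open>Waiting one time unit brings every register clock to \<open>1\<close>, which represents
  zero for every parameter value. Location \<open>10\<close> belongs to node \<open>5\<close>, which
  is kept out of the control graph.\<close>

definition start_edge :: "patom edge" where
  "start_edge = mk_edge 10 [ClockConst 0 CEq 1] [0, 1] 0"

text \<open>Node \<open>4\<close> is the final node. A run that waits until clock \<open>0\<close> exceeds every cycle length can
  move freely between all other locations, but it never gets back to the simulation. Hence the final
  location alone decides which traces are possible.\<close>

definition free_edges :: "nat \<Rightarrow> nat \<Rightarrow> patom edge list" where
  "free_edges a M = [mk_edge l [ClockConst 0 CGe (int (4 * a + 10))] [] l'.
     l \<leftarrow> [0..<M], l' \<leftarrow> [0..<M], l = 8 \<longleftrightarrow> l' = 8]"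

definition edges_of :: "nat \<Rightarrow> nat \<Rightarrow> nat \<Rightarrow> clock_op graph \<Rightarrow> patom edge list" where
  "edges_of a K k G = concat (map (\<lambda>(k, e). op_edges a K k e) (List.enumerate k G))"

text \<open>The invariants are empty, so time can pass everywhere. Clocks and locations are the same
  list, which lets one input stand for both codes.\<close>

definition simulator :: "nat \<Rightarrow> nat \<Rightarrow> nat \<Rightarrow> clock_op graph \<Rightarrow> pta" where
  "simulator a K M G =
     \<lparr>actions = [0], locs = [0..<M], init_loc = 10, clocks = [0..<M], invar = (\<lambda>_. []),
      edges = edges_of a K 0 G @ start_edge # free_edges a M, params = [0]\<rparr>"

lemma simulator_simps [simp]:
  "actions (simulator a K M G) = [0]" "locs (simulator a K M G) = [0..<M]"
  "init_loc (simulator a K M G) = 10" "clocks (simulator a K M G) = [0..<M]"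
  "invar (simulator a K M G) = (\<lambda>_. [])" "params (simulator a K M G) = [0]"
  by (simp_all add: simulator_def)

lemma edge_simulator_iff:
  "e \<in> set (edges (simulator a K M G)) \<longleftrightarrow>
    (\<exists>k<length G. e \<in> set (op_edges a K k (G ! k))) \<or> e = start_edge \<or>
    (\<exists>l<M. \<exists>l'<M. (l = 8 \<longleftrightarrow> l' = 8) \<and> e = mk_edge l [ClockConst 0 CGe (int (4 * a + 10))] [] l')"
proof -
  have "e \<in> set (edges_of a K 0 G) \<longleftrightarrow> (\<exists>k<length G. e \<in> set (op_edges a K k (G ! k)))"
  proof -
    have "set (List.enumerate 0 G) = (\<lambda>k. (k, G ! k)) ` {..<length G}"
      by (auto simp: in_set_enumerate_eq image_iff)
    then show ?thesis
      unfolding edges_of_def set_concat set_map by (simp only: image_image prod.case) auto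
  qed
  moreover have "e \<in> set (free_edges a M) \<longleftrightarrow>
    (\<exists>l<M. \<exists>l'<M. (l = 8 \<longleftrightarrow> l' = 8) \<and> e = mk_edge l [ClockConst 0 CGe (int (4 * a + 10))] [] l')"
    by (auto simp: free_edges_def mk_edge_def)
  ultimately show ?thesis by (simp add: simulator_def) blast
qed

section \<open>Transitions at a fixed parameter value\<close>

definition enabled :: "real \<Rightarrow> cval \<Rightarrow> patom list \<Rightarrow> bool" where
  "enabled p w g \<longleftrightarrow> (\<forall>a\<in>set g. sat_atom w (inst_atom (\<lambda>_. p) a))"

lemma enabled_simps [simp]:
  "enabled p w []"
  "enabled p w (a # g) \<longleftrightarrow> sat_atom w (inst_atom (\<lambda>_. p) a) \<and> enabled p w g"
  by (simp_all add: enabled_def)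

lemma sat_equals_atom [simp]: "sat_atom w (inst_atom (\<lambda>_. p) (equals_atom x e)) \<longleftrightarrow> w x = threshold p e"
  by (simp add: equals_atom_def threshold_def)

lemma enabled_bounded_guard [simp]: "enabled p w (bounded_guard a K) \<longleftrightarrow> bounded_regs a K w"
proof -
  have "(\<forall>x. is_reg K x \<longrightarrow> P x) \<longleftrightarrow> (\<forall>q<K. P (q + 2))" for P
  proof
    assume *: "\<forall>q<K. P (q + 2)"
    show "\<forall>x. is_reg K x \<longrightarrow> P x"
    proof (intro allI impI)
      fix x assume "is_reg K x"
      then have "x - 2 < K" "x - 2 + 2 = x" by (auto simp: is_reg_def)
      with * show "P x" by metis
    qed
  qed (simp add: is_reg_def)
  from this[of "\<lambda>x. 0 < w x \<and> w x < real (a + 4)"] show ?thesis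
    by (auto simp: enabled_def bounded_guard_def bounded_regs_def ball_Un)
qed

definition moves :: "real \<Rightarrow> pta \<Rightarrow> (state \<times> state) set" where
  "moves p A = {((l, w), (l', w')). \<exists>d\<ge>0. \<exists>e\<in>set (edges A). source e = l \<and> target e = l' \<and>
     enabled p (delay w d) (guard e) \<and> w' = reset (delay w d) (set (resets e))}"

lemma movesI:
  assumes "e \<in> set (edges A)" "d \<ge> 0" "source e = l" "target e = l'" "enabled p (delay w d) (guard e)"
    "w' = reset (delay w d) (set (resets e))"
  shows "((l, w), (l', w')) \<in> moves p A"
  using assms by (auto simp: moves_def)

lemma delay_0 [simp]: "delay w 0 = w"
  by (simp add: delay_def)

lemma reset_empty [simp]: "reset w {} = w"
  by (simp add: reset_def)

text \<open>The valuation at time \<open>t\<close> of a cycle that started in \<open>w\<close> with reset thresholds \<open>\<theta>\<close>, where the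
  registers in \<open>S\<close> have not been reset yet.\<close>

definition in_cycle :: "nat \<Rightarrow> (clock \<Rightarrow> real) \<Rightarrow> cval \<Rightarrow> real \<Rightarrow> clock set \<Rightarrow> cval" where
  "in_cycle K \<theta> w t S = (\<lambda>x. if is_reg K x \<and> x \<notin> S then t - (\<theta> x - w x) else w x + t)"

definition reset_threshold :: "nat \<Rightarrow> real \<Rightarrow> nat \<Rightarrow> move \<Rightarrow> clock \<Rightarrow> real" where
  "reset_threshold a p r m x = threshold p (if x = r + 2 then reset_at a m else period a m)"

lemma delay_in_cycle: "delay (in_cycle K \<theta> w t S) d = in_cycle K \<theta> w (t + d) S"
  by (rule ext) (simp add: delay_def in_cycle_def)

lemma reset_in_cycle:
  assumes "is_reg K x" "x \<in> S" "w x + t = \<theta> x"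
  shows "reset (in_cycle K \<theta> w t S) {x} = in_cycle K \<theta> w t (S - {x})"
  by (rule ext) (use assms in \<open>auto simp: reset_def in_cycle_def\<close>)

lemma in_cycle_all: "in_cycle K \<theta> w 0 {x. is_reg K x} = w"
  by (rule ext) (simp add: in_cycle_def)

lemma in_cycle_end:
  assumes "w 0 = 0"
  shows "reset (in_cycle K (reset_threshold a p r m) w (threshold p (period a m)) {}) {0} =
    move_shift a K p r m w"
  by (rule ext)
    (use assms in \<open>auto simp: reset_def in_cycle_def reset_threshold_def move_shift_def shift_def is_reg_def\<close>)

text \<open>The bound \<open>a + 1\<close> comes from \<open>a / b \<le> a\<close> together with a
  deviation of at most \<open>1\<close> from \<open>a / b\<close>.\<close>

lemma threshold_bounds:
  assumes "0 \<le> p" "p \<le> real a + 1"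
  shows "2 * real a + 6 \<le> threshold p (period a m)" "threshold p (period a m) \<le> 3 * real a + 7"
    "2 * real a + 6 \<le> threshold p (reset_at a m)" "threshold p (reset_at a m) \<le> 3 * real a + 7"
  using assms by (cases m; simp add: threshold_def)+

definition start_val :: cval where
  "start_val = (\<lambda>x. if x = 0 \<or> x = 1 then 0 else 1)"

text \<open>Register \<open>x\<close> is due at time \<open>\<theta> x - w x\<close>, and the resets
  have to be taken in the order of these times. The induction removes an earliest register from the
  set of those still to be reset.\<close>

lemma cycle_path:
  assumes k: "k < length G" "G ! k = (i, Some (Shift r m), j)"
    and p: "0 \<le> p" "p \<le> real a + 1"
    and w: "w 0 = 0" "bounded_regs a K w" "bounded_regs a K (move_shift a K p r m w)"
  shows "((2 * i, w), (2 * j, move_shift a K p r m w)) \<in> (moves p (simulator a K M G))\<^sup>*"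
proof -
  let ?T = "moves p (simulator a K M G)"
  let ?P = "threshold p (period a m)"
  define \<theta> where "\<theta> = reset_threshold a p r m"
  have edge: "e \<in> set (edges (simulator a K M G))" if "e \<in> set (op_edges a K k (G ! k))" for e
    using that k(1) by (auto simp: edge_simulator_iff)
  have times: "0 \<le> \<theta> x - w x \<and> \<theta> x - w x \<le> ?P" if "is_reg K x" for x
  proof -
    have "0 < w x" "w x < real a + 4" using w(2) that by (auto simp: bounded_regs_def)
    \<comment> \<open>The time that remains after the reset of the moved register is its new value;
      as this is positive, the reset falls within the cycle.\<close>
    moreover have "0 < w x + (?P - threshold p (reset_at a m))" if "x = r + 2"
    proof -
      have "0 < move_shift a K p r m w x" using w(3) \<open>is_reg K x\<close> by (simp add: bounded_regs_def)
      with that \<open>is_reg K x\<close> show ?thesis by (simp add: move_shift_def shift_def)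
    qed
    ultimately show ?thesis
      using threshold_bounds[OF p, of m] by (auto simp: \<theta>_def reset_threshold_def)
  qed
  have enter: "((2 * i, w), (2 * k + 1, w)) \<in> ?T"
    by (rule movesI[where d = 0, OF edge]) (auto simp: k(2) w(1) intro!: disjI1)
  \<comment> \<open>\<open>t'\<close> is the last due time; the rest of the period is spent in the
    delay of the exit edge.\<close>
  have cycle: "((2 * k + 1, in_cycle K \<theta> w t S), (2 * k + 1, in_cycle K \<theta> w t' {})) \<in> ?T\<^sup>*"
    if "finite S" "S \<subseteq> {x. is_reg K x}" "\<forall>x\<in>S. t \<le> \<theta> x - w x"
      "t' = Max (insert t ((\<lambda>x. \<theta> x - w x) ` S))" for S t t'
    using that
  proof (induction "card S" arbitrary: S t t')
    case 0
    then show ?case by simp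
  next
    case (Suc n)
    let ?\<tau> = "\<lambda>x. \<theta> x - w x"
    have "S \<noteq> {}" using Suc.hyps(2) by auto
    with Suc.prems(1) obtain x where x: "x \<in> S" "\<forall>y\<in>S. ?\<tau> x \<le> ?\<tau> y"
      using arg_min_if_finite[of S ?\<tau>] by (metis linorder_not_less)
    have reg: "is_reg K x" using x Suc.prems by auto
    define q where "q = x - 2"
    have q: "x = q + 2" "q < K" using reg by (auto simp: q_def is_reg_def)
    have "((2 * k + 1, in_cycle K \<theta> w t S), (2 * k + 1, in_cycle K \<theta> w (?\<tau> x) (S - {x}))) \<in> ?T"
    proof (rule movesI[where d = "?\<tau> x - t", OF edge])
      let ?e = "mk_edge (2 * k + 1)
         [equals_atom (q + 2) (if q = r then reset_at a m else period a m)] [q + 2] (2 * k + 1)"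
      show "?e \<in> set (op_edges a K k (G ! k))" using q(2) by (auto simp: k(2))
      show "?\<tau> x - t \<ge> 0" using Suc.prems(3) x by auto
      show "enabled p (delay (in_cycle K \<theta> w t S) (?\<tau> x - t)) (guard ?e)"
        unfolding delay_in_cycle using x(1) q
        by (auto simp: in_cycle_def \<theta>_def reset_threshold_def)
      show "in_cycle K \<theta> w (?\<tau> x) (S - {x}) =
          reset (delay (in_cycle K \<theta> w t S) (?\<tau> x - t)) (set (resets ?e))"
        unfolding delay_in_cycle using reset_in_cycle[OF reg x(1), of w "?\<tau> x" \<theta>] q(1) by simp
    qed simp_all
    also have "((2 * k + 1, in_cycle K \<theta> w (?\<tau> x) (S - {x})), (2 * k + 1, in_cycle K \<theta> w t' {})) \<in> ?T\<^sup>*"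
    proof (rule Suc.hyps(1))
      show "n = card (S - {x})" using Suc.hyps(2) x(1) by simp
      have "?\<tau> ` S = insert (?\<tau> x) (?\<tau> ` (S - {x}))" using x(1) by auto
      moreover have "t \<le> ?\<tau> x" using Suc.prems(3) x(1) by auto
      ultimately show "t' = Max (insert (?\<tau> x) (?\<tau> ` (S - {x})))"
        using Suc.prems(1) x(1) unfolding Suc.prems(4)
        by (subst Max_insert) (auto simp: max_def intro: order_trans[OF _ Max_ge])
    qed (use Suc.prems x in auto)
    finally show ?case .
  qed
  let ?S = "{x. is_reg K x}"
  define t' where "t' = Max (insert 0 ((\<lambda>x. \<theta> x - w x) ` ?S))"
  have fin: "finite ?S" by (rule finite_subset[of _ "{..<K + 2}"]) (auto simp: is_reg_def)
  have "t' \<le> ?P"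
    unfolding t'_def using fin times threshold_bounds(1)[OF p, of m]
    by (subst Max_le_iff) auto
  note enter
  also have "((2 * k + 1, w), (2 * k + 1, in_cycle K \<theta> w t' {})) \<in> ?T\<^sup>*"
    using cycle[OF fin subset_refl _ t'_def] times unfolding in_cycle_all by auto
  also have "((2 * k + 1, in_cycle K \<theta> w t' {}), (2 * j, move_shift a K p r m w)) \<in> ?T"
  proof (rule movesI[where d = "?P - t'", OF edge])
    let ?e = "mk_edge (2 * k + 1) (equals_atom 0 (period a m) # bounded_guard a K) [0] (2 * j)"
    show "?e \<in> set (op_edges a K k (G ! k))" by (simp add: k(2))
    show "?P - t' \<ge> 0" using \<open>t' \<le> ?P\<close> by simp
    have final: "move_shift a K p r m w = reset (in_cycle K \<theta> w ?P {}) {0}"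
      unfolding \<theta>_def by (rule in_cycle_end[symmetric]) (rule w(1))
    then show "move_shift a K p r m w =
        reset (delay (in_cycle K \<theta> w t' {}) (?P - t')) (set (resets ?e))"
      by (simp add: delay_in_cycle)
    have "bounded_regs a K (in_cycle K \<theta> w ?P {})"
      using w(3) unfolding final by (auto simp: bounded_regs_def reset_def is_reg_def)
    then show "enabled p (delay (in_cycle K \<theta> w t' {}) (?P - t')) (guard ?e)"
      using w(1) by (simp add: delay_in_cycle) (simp add: in_cycle_def is_reg_def)
  qed simp_all
  finally show ?thesis .
qed

lemma simulator_complete:
  assumes path: "((i, w), (j, w')) \<in> (graph_step (clock_sem a K p) G)\<^sup>*"
    and p: "0 \<le> p" "p \<le> real a + 1"
    and w: "w 0 = 0" "bounded_regs a K w"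
  shows "((2 * i, w), (2 * j, w')) \<in> (moves p (simulator a K M G))\<^sup>* \<and> w' 0 = 0 \<and> bounded_regs a K w'"
  using path
proof (induction rule: rtrancl_induct2)
  case refl
  then show ?case using w by simp
next
  case (step i1 w1 i2 w2)
  from step.hyps(2) obtain e where e: "(i1, e, i2) \<in> set G" "(w1, w2) \<in> label_sem (clock_sem a K p) e"
    by (auto simp: graph_step_def)
  obtain k where k: "k < length G" "G ! k = (i1, e, i2)"
    using e(1) by (auto simp: in_set_conv_nth)
  have edge: "e \<in> set (edges (simulator a K M G))" if "e \<in> set (op_edges a K k (G ! k))" for e
    using that k(1) by (auto simp: edge_simulator_iff)
  have w1: "w1 0 = 0" "bounded_regs a K w1" using step.IH by auto
  have w2: "bounded_regs a K w2 \<and> w2 0 = 0" by (rule clock_sem_preserves[OF e(2) w1(2,1)])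
  have "((2 * i1, w1), (2 * i2, w2)) \<in> (moves p (simulator a K M G))\<^sup>*"
  proof (cases e)
    case None
    then have "w2 = w1" using e(2) by simp
    show ?thesis
      unfolding \<open>w2 = w1\<close>
      by (rule r_into_rtrancl, rule movesI[where d = 0, OF edge]) (auto simp: k(2) None w1)
  next
    case (Some x)
    show ?thesis
    proof (cases x)
      case (Shift r m)
      then have "w2 = move_shift a K p r m w1" using e(2) Some by simp
      with k Some Shift w1 w2 p show ?thesis by (metis cycle_path)
    next
      case (IsOne r)
      then have "w2 = w1" "w1 (r + 2) = 1" using e(2) Some by auto
      then show ?thesis
        by (intro r_into_rtrancl movesI[where d = 0, OF edge]) (auto simp: k(2) Some IsOne w1)
    next
      case (NotOne r)
      then have w: "w2 = w1" "w1 (r + 2) < 1 \<or> w1 (r + 2) > 1" using e(2) Some by auto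
      show ?thesis
        unfolding w(1) using w(2)
      proof
        assume *: "w1 (r + 2) < 1"
        show "((2 * i1, w1), (2 * i2, w1)) \<in> (moves p (simulator a K M G))\<^sup>*"
          by (rule r_into_rtrancl,
              rule movesI[where d = 0 and e = "mk_edge (2 * i1) [ClockConst 0 CEq 0, ClockConst (r + 2) CLt 1] [] (2 * i2)", OF edge])
            (use * in \<open>auto simp: k(2) Some NotOne w1\<close>)
      next
        assume *: "w1 (r + 2) > 1"
        show "((2 * i1, w1), (2 * i2, w1)) \<in> (moves p (simulator a K M G))\<^sup>*"
          by (rule r_into_rtrancl,
              rule movesI[where d = 0 and e = "mk_edge (2 * i1) [ClockConst 0 CEq 0, ClockConst (r + 2) CGt 1] [] (2 * i2)", OF edge])
            (use * in \<open>auto simp: k(2) Some NotOne w1\<close>)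
      qed
    next
      case (Elapsed n)
      then have "w2 = w1(1 := 0)" "w1 1 = real n" using e(2) Some by auto
      then show ?thesis
        by (intro r_into_rtrancl movesI[where d = 0, OF edge])
          (auto simp: k(2) Some Elapsed w1 reset_def fun_upd_def)
    qed
  qed
  with step.IH w2 show ?case by (blast intro: rtrancl_trans)
qed

lemma simulator_start: "((10, \<lambda>_. 0), (0, start_val)) \<in> moves p (simulator a K M G)"
  by (rule movesI[where d = 1 and e = start_edge])
    (auto simp: edge_simulator_iff start_edge_def delay_def reset_def start_val_def fun_eq_iff)

text \<open>A register that misses its reset is out of bounds at the end of the cycle, and a register can
  be reset for a second time only when the cycle is \<open>overdue\<close>; both prevent the cycle from ending.\<close>

inductive sim_inv ::
  "nat \<Rightarrow> nat \<Rightarrow> real \<Rightarrow> clock_op graph \<Rightarrow> (nat \<Rightarrow> cval set) \<Rightarrow> state \<Rightarrow> bool"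
  for a K p G A where
  free: "w 0 \<ge> 4 * real a + 10 \<Longrightarrow> l \<noteq> 8 \<Longrightarrow> sim_inv a K p G A (l, w)"
| start: "sim_inv a K p G A (10, \<lambda>_. 0)"
| node: "w \<in> A i \<Longrightarrow> l = 2 * i \<Longrightarrow> sim_inv a K p G A (l, w)"
| overdue: "k < length G \<Longrightarrow> G ! k = (i, Some (Shift r m), j) \<Longrightarrow> w 0 > threshold p (period a m) \<Longrightarrow>
    sim_inv a K p G A (2 * k + 1, w)"
| cycle: "k < length G \<Longrightarrow> G ! k = (i, Some (Shift r m), j) \<Longrightarrow> w \<in> A i \<Longrightarrow>
    sim_inv a K p G A (2 * k + 1, in_cycle K (reset_threshold a p r m) w t S)"

lemma sim_inv_8:
  assumes "sim_inv a K p G A (8, w)" "A 4 = {}"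
  shows False
  using assms by (cases rule: sim_inv.cases) (auto, presburger+)

text \<open>A zero value of clock \<open>0\<close> excludes \<open>free\<close>, parity excludes the
  cycle locations, and \<open>i \<noteq> 5\<close> excludes the initial location; what remains is a
  node of the simulation.\<close>

lemma sim_inv_even:
  assumes "sim_inv a K p G A (2 * i, w)" "w 0 + d = 0" "0 \<le> d" "i \<noteq> 5" "\<And>i w. w \<in> A i \<Longrightarrow> w 0 = 0"
  shows "w \<in> A i \<and> d = 0"
  using assms(1)
proof (cases rule: sim_inv.cases)
  case free
  then show ?thesis using assms(2,3) by auto
next
  case (node i')
  then show ?thesis using assms(2,3,5) by force
qed (use assms(4) in \<open>auto, presburger+\<close>)

text \<open>A cycle location is left either by a free edge or with clock \<open>0\<close> equal to
  the period. In the latter case the bounds guard certifies that each register was reset exactly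
  once, so the simulated move has taken place and the annotation carries over to the target
  node.\<close>

lemma sim_inv_step:
  assumes A: "inductive_on (clock_sem a K p) G A" "A 4 = {}" "A 5 = {}" "start_val \<in> A 0"
      "\<And>i w. w \<in> A i \<Longrightarrow> w 0 = 0 \<and> bounded_regs a K w"
    and G: "\<And>x e y. (x, e, y) \<in> set G \<Longrightarrow> x \<noteq> 5"
    and p: "0 \<le> p" "p \<le> real a + 1"
    and inv: "sim_inv a K p G A (l, w)"
    and step: "((l, w), (l', w')) \<in> moves p (simulator a K M G)"
  shows "sim_inv a K p G A (l', w')"
proof -
  from step obtain d e where d: "d \<ge> 0" and e: "e \<in> set (edges (simulator a K M G))"
    and ends: "source e = l" "target e = l'" and guard: "enabled p (delay w d) (guard e)"
    and w': "w' = reset (delay w d) (set (resets e))"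
    by (auto simp: moves_def)
  from e consider (op) k where "k < length G" "e \<in> set (op_edges a K k (G ! k))"
    | (start) "e = start_edge"
    | (free) l1 l2 where "(l1 = 8) = (l2 = 8)" "e = mk_edge l1 [ClockConst 0 CGe (int (4 * a + 10))] [] l2"
    by (auto simp: edge_simulator_iff)
  then show ?thesis
  proof cases
    case free
    then have "l \<noteq> 8" using sim_inv_8 inv A(2) by blast
    then show ?thesis
      using free ends guard w' by (intro sim_inv.free) (auto simp: delay_def)
  next
    case start
    have t: "w 0 + d = 1" and l: "l = 10" "l' = 0" and w': "w' = reset (delay w d) {0, 1}"
      using start ends guard w' by (auto simp: start_edge_def delay_def)
    from inv show ?thesis
    proof (cases rule: sim_inv.cases)
      case start
      then have "w' = start_val" using t w' by (auto simp: reset_def delay_def start_val_def)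
      then show ?thesis using A(4) l by (intro sim_inv.node[of _ _ 0]) auto
    next
      case (node i)
      then have "i = 5" using l by simp
      then show ?thesis using node A(3) by simp
    qed (use t d l in \<open>auto, presburger+\<close>)
  next
    case op
    obtain i x j where k: "G ! k = (i, x, j)" by (cases "G ! k") auto
    then have mem: "(i, x, j) \<in> set G" using op(1) by (metis nth_mem)
    have node_step: "v' \<in> A j" if "v \<in> A i" "(v, v') \<in> label_sem (clock_sem a K p) x" for v v'
      using A(1) mem that unfolding inductive_on_def by blast
    have at_node: "w \<in> A i \<and> d = 0" if "l = 2 * i" "w 0 + d = 0"
      using inv that d G[OF mem] A(5) by (intro sim_inv_even) auto
    show ?thesis
    proof (cases x)
      case None
      then have *: "l = 2 * i" "l' = 2 * j" "w 0 + d = 0" "w' = delay w d"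
        using op(2) k ends guard w' by (auto simp: delay_def)
      with at_node node_step None show ?thesis by (intro sim_inv.node[of _ _ j]) auto
    next
      case (Some y)
      show ?thesis
      proof (cases y)
        case (IsOne r)
        then have *: "l = 2 * i" "l' = 2 * j" "w 0 + d = 0" "w' = delay w d" "delay w d (r + 2) = 1"
          using op(2) k Some ends guard w' by (auto simp: delay_def)
        with at_node have "w \<in> A i" "d = 0" by auto
        with * node_step[of w w] Some IsOne show ?thesis by (intro sim_inv.node[of _ _ j]) auto
      next
        case (NotOne r)
        then have *: "l = 2 * i" "l' = 2 * j" "w 0 + d = 0" "w' = delay w d" "delay w d (r + 2) \<noteq> 1"
          using op(2) k Some ends guard w' by (auto simp: delay_def)
        with at_node have "w \<in> A i" "d = 0" by auto
        with * node_step[of w w] Some NotOne show ?thesis by (intro sim_inv.node[of _ _ j]) auto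
      next
        case (Elapsed n)
        then have *: "l = 2 * i" "l' = 2 * j" "w 0 + d = 0" "w' = reset (delay w d) {1}" "delay w d 1 = real n"
          using op(2) k Some ends guard w' by (auto simp: delay_def)
        with at_node have "w \<in> A i" "d = 0" by auto
        moreover have "reset w {1} = w(1 := 0)" by (auto simp: reset_def)
        ultimately show ?thesis
          using * node_step[of w "w(1 := 0)"] Some Elapsed by (intro sim_inv.node[of _ _ j]) auto
      next
        case (Shift r m)
        let ?P = "threshold p (period a m)" and ?\<theta> = "reset_threshold a p r m"
        have k': "G ! k = (i, Some (Shift r m), j)" using k Some Shift by simp
        note tb = threshold_bounds[OF p, of m]
        from op(2)[unfolded k'] consider
            (enter) "e = mk_edge (2 * i) [ClockConst 0 CEq 0] [] (2 * k + 1)"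
          | (exit) "e = mk_edge (2 * k + 1) (equals_atom 0 (period a m) # bounded_guard a K) [0] (2 * j)"
          | (reset) q where "q < K" "e = mk_edge (2 * k + 1)
              [equals_atom (q + 2) (if q = r then reset_at a m else period a m)] [q + 2] (2 * k + 1)"
          by auto
        then show ?thesis
        proof cases
          case enter
          then have *: "l = 2 * i" "l' = 2 * k + 1" "w 0 + d = 0" "w' = delay w d"
            using ends guard w' by (auto simp: delay_def)
          with at_node have w: "w \<in> A i" "d = 0" by auto
          have "sim_inv a K p G A (2 * k + 1, in_cycle K ?\<theta> w 0 {x. is_reg K x})"
            by (rule sim_inv.cycle[OF op(1) k'], rule w(1))
          then show ?thesis unfolding in_cycle_all using * w(2) by simp
        next
          case exit
          have *: "l = 2 * k + 1" "l' = 2 * j" "w 0 + d = ?P" "bounded_regs a K (delay w d)"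
            "w' = reset (delay w d) {0}"
            using exit ends guard w' by (auto simp: delay_def)
          from inv[unfolded *(1)] show ?thesis
          proof (cases rule: sim_inv.cases)
            case free
            then show ?thesis using *(3) d tb by simp
          next
            case (overdue k1 i1 r1 m1 j1)
            then show ?thesis using *(3) d k' by simp
          next
            case (cycle k1 i1 r1 m1 j1 v t S)
            then have v: "w = in_cycle K ?\<theta> v t S" "v \<in> A i" using k' by auto
            have v0: "v 0 = 0" "bounded_regs a K v" using A(5)[OF v(2)] by auto
            have t: "t + d = ?P" using *(3) v0 unfolding v(1) by (simp add: in_cycle_def is_reg_def)
            have bd: "bounded_regs a K (in_cycle K ?\<theta> v ?P S)"
              using *(4) unfolding v(1) delay_in_cycle t .
            \<comment> \<open>A register without a reset would show more than the period, which is
              at least \<open>2 * a + 6\<close>, and violate its upper bound.\<close>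
            have "x \<notin> S" if "is_reg K x" for x
            proof
              assume "x \<in> S"
              with bd that have "v x + ?P < real (a + 4)" by (auto simp: bounded_regs_def in_cycle_def)
              moreover have "0 < v x" using v0(2) that by (auto simp: bounded_regs_def)
              ultimately show False using tb by simp
            qed
            then have "in_cycle K ?\<theta> v ?P S = in_cycle K ?\<theta> v ?P {}"
              by (auto simp: in_cycle_def)
            with bd *(5) have bd': "bounded_regs a K (in_cycle K ?\<theta> v ?P {})"
              and w'2: "w' = reset (in_cycle K ?\<theta> v ?P {}) {0}"
              unfolding v(1) delay_in_cycle t by simp_all
            have "w' = move_shift a K p r m v" unfolding w'2 by (rule in_cycle_end) (rule v0(1))
            moreover have "bounded_regs a K w'"
              using bd' unfolding w'2 by (auto simp: bounded_regs_def reset_def is_reg_def)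
            ultimately have "w' \<in> A j" using v(2) Some Shift by (intro node_step[of v]) auto
            then show ?thesis using *(2) by (intro sim_inv.node[of _ _ j]) auto
          qed presburger+
        next
          case reset
          let ?x = "q + 2"
          have reg: "is_reg K ?x" using reset(1) by (simp add: is_reg_def)
          have *: "l = 2 * k + 1" "l' = 2 * k + 1" "delay w d ?x = ?\<theta> ?x" "w' = reset (delay w d) {?x}"
            using reset ends guard w' by (auto simp: reset_threshold_def)
          have w'0: "w' 0 = w 0 + d" unfolding *(4) by (simp add: reset_def delay_def)
          from inv[unfolded *(1)] show ?thesis
          proof (cases rule: sim_inv.cases)
            case free
            have "2 * k + 1 \<noteq> 8" by presburger
            with free show ?thesis using w'0 d *(2) by (intro sim_inv.free) auto
          next
            case (overdue k1 i1 r1 m1 j1)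
            then have "w' 0 > ?P" using w'0 d k' by auto
            then show ?thesis unfolding *(2) by (rule sim_inv.overdue[OF op(1) k'])
          next
            case (cycle k1 i1 r1 m1 j1 v t S)
            then have v: "w = in_cycle K ?\<theta> v t S" "v \<in> A i" using k' by auto
            have v0: "v 0 = 0" "bounded_regs a K v" using A(5)[OF v(2)] by auto
            have vx: "v ?x < real a + 4" using v0(2) reg by (auto simp: bounded_regs_def)
            show ?thesis
            proof (cases "?x \<in> S")
              case True
              then have "v ?x + (t + d) = ?\<theta> ?x"
                using *(3) unfolding v(1) delay_in_cycle by (simp add: in_cycle_def)
              then have "w' = in_cycle K ?\<theta> v (t + d) (S - {?x})"
                unfolding *(4) v(1) delay_in_cycle by (rule reset_in_cycle[OF reg True])
              then show ?thesis unfolding *(2) by (simp only:) (rule sim_inv.cycle[OF op(1) k'], rule v(2))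
            next
              case False
              \<comment> \<open>The first reset was at time \<open>?\<theta> ?x - v ?x\<close>, and
                the clock needs another \<open>?\<theta> ?x\<close> to reach its threshold again.
                The sum exceeds \<open>3 * a + 8\<close>, whereas periods are at most
                \<open>3 * a + 7\<close>.\<close>
              then have "t + d = 2 * ?\<theta> ?x - v ?x"
                using *(3) reg unfolding v(1) delay_in_cycle by (simp add: in_cycle_def)
              moreover have "w' 0 = t + d"
                unfolding w'0 v(1) using v0 by (simp add: in_cycle_def is_reg_def)
              moreover have "2 * real a + 6 \<le> ?\<theta> ?x" using tb by (simp add: reset_threshold_def)
              ultimately have "w' 0 > ?P" using vx tb by linarith
              then show ?thesis unfolding *(2) by (rule sim_inv.overdue[OF op(1) k'])
            qed
          qed presburger+
        qed
      qed
    qed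
  qed
qed

lemma simulator_sound:
  assumes A: "inductive_on (clock_sem a K p) G A" "A 4 = {}" "A 5 = {}" "start_val \<in> A 0"
      "\<And>i w. w \<in> A i \<Longrightarrow> w 0 = 0 \<and> bounded_regs a K w"
    and G: "\<And>x e y. (x, e, y) \<in> set G \<Longrightarrow> x \<noteq> 5"
    and p: "0 \<le> p" "p \<le> real a + 1"
  shows "((10, \<lambda>_. 0), (8, w)) \<notin> (moves p (simulator a K M G))\<^sup>*"
proof
  assume "((10, \<lambda>_. 0), (8, w)) \<in> (moves p (simulator a K M G))\<^sup>*"
  then have "sim_inv a K p G A (8, w)"
  proof (induction rule: rtrancl_induct2)
    case refl
    then show ?case by (rule sim_inv.start)
  next
    case (step l1 w1 l2 w2)
    show ?case by (rule sim_inv_step[OF A G p step.IH step.hyps(2)])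
  qed
  then show False using A(2) by (rule sim_inv_8)
qed

section \<open>Traces of the automaton\<close>

fun op_reg :: "clock_op \<Rightarrow> nat" where
  "op_reg (Shift r m) = r"
| "op_reg (IsOne r) = r"
| "op_reg (NotOne r) = r"
| "op_reg (Elapsed n) = 0"

definition fits :: "nat \<Rightarrow> nat \<Rightarrow> clock_op graph \<Rightarrow> bool" where
  "fits K M G \<longleftrightarrow> 2 * length G < M \<and> K + 2 < M \<and> 10 < M \<and> 0 < K \<and>
     (\<forall>(x, e, y)\<in>set G. 2 * x < M \<and> 2 * y < M \<and> (\<forall>z. e = Some z \<longrightarrow> op_reg z < K))"

lemma wf_simulator:
  assumes "fits K M G"
  shows "wf_pta (simulator a K M G)"
proof -
  have edge: "wf_edge (simulator a K M G) e" if e: "e \<in> set (op_edges a K k (x, y, z))"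
    "k < length G" "(x, y, z) \<in> set G" for e k x y z
  proof -
    have b: "2 * x < M" "2 * z < M" "2 * k + 1 < M" "K + 2 < M" "0 < K"
      "\<And>u. y = Some u \<Longrightarrow> op_reg u < K"
      using assms that by (auto simp: fits_def)
    show ?thesis
    proof (cases y)
      case None
      then show ?thesis using e(1) b by (auto simp: wf_edge_def)
    next
      case (Some u)
      then show ?thesis using e(1) b
        by (cases u) (auto simp: wf_edge_def bounded_guard_def equals_atom_def)
    qed
  qed
  have "wf_edge (simulator a K M G) e" if "e \<in> set (edges (simulator a K M G))" for e
  proof -
    from that consider k where "k < length G" "e \<in> set (op_edges a K k (G ! k))" | "e = start_edge"
      | l l' where "l < M" "l' < M" "e = mk_edge l [ClockConst 0 CGe (int (4 * a + 10))] [] l'"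
      by (auto simp: edge_simulator_iff)
    then show ?thesis
    proof cases
      case 1
      obtain x y z where g: "G ! k = (x, y, z)" by (cases "G ! k") auto
      with 1 have "(x, y, z) \<in> set G" by (metis nth_mem)
      with 1 g edge show ?thesis by auto
    qed (use assms in \<open>auto simp: wf_edge_def start_edge_def fits_def\<close>)
  qed
  then show ?thesis using assms by (auto simp: wf_pta_def fits_def)
qed

lemma inst_atom_single: "wf_atom X {0} g \<Longrightarrow> inst_atom v g = inst_atom (\<lambda>_. v 0) g"
  by (cases g) auto

lemma step_simulator:
  assumes "fits K M G"
  shows "step (instantiate v (simulator a K M G)) (l, w) d e' (l', w') \<longleftrightarrow> d \<ge> 0 \<and>
    (\<exists>e\<in>set (edges (simulator a K M G)). e' = inst_edge v e \<and> source e = l \<and> target e = l' \<and>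
      enabled (v 0) (delay w d) (guard e) \<and> w' = reset (delay w d) (set (resets e)))"
proof -
  have "sat w (map (inst_atom v) (guard e)) \<longleftrightarrow> enabled (v 0) w (guard e)"
    if "e \<in> set (edges (simulator a K M G))" for e w
  proof -
    have "inst_atom v g = inst_atom (\<lambda>_. v 0) g" if "g \<in> set (guard e)" for g
      using wf_simulator[OF assms, of a] \<open>e \<in> _\<close> that
      by (intro inst_atom_single[of "set [0..<M]"]) (auto simp: wf_pta_def wf_edge_def)
    then show ?thesis by (simp add: sat_def enabled_def)
  qed
  then show ?thesis
    by (auto simp: step_def instantiate_def inst_edge_def sat_def[of _ "[]"])
qed

lemma label_simulator: "e \<in> set (edges (simulator a K M G)) \<Longrightarrow> label e = 0"
  unfolding edge_simulator_iff
proof (elim disjE exE conjE)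
  fix k assume "e \<in> set (op_edges a K k (G ! k))"
  then show ?thesis by (cases "(a, K, k, G ! k)" rule: op_edges.cases) auto
qed (auto simp: start_edge_def)

lemma step_moves:
  assumes "fits K M G" "step (instantiate v (simulator a K M G)) s d e s'"
  shows "(s, s') \<in> moves (v 0) (simulator a K M G) \<and> label e = 0"
proof (cases s; cases s')
  fix l w l' w' assume "s = (l, w)" "s' = (l', w')"
  with assms show ?thesis
    by (auto simp: step_simulator moves_def inst_edge_def label_simulator)
qed

lemma moves_step:
  assumes "fits K M G" "(s, s') \<in> moves (v 0) (simulator a K M G)"
  shows "\<exists>d e. step (instantiate v (simulator a K M G)) s d e s' \<and> label e = 0"
proof (cases s; cases s')
  fix l w l' w' assume s: "s = (l, w)" "s' = (l', w')"
  with assms(2) obtain d e where *: "d \<ge> 0" "e \<in> set (edges (simulator a K M G))" "source e = l"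
    "target e = l'" "enabled (v 0) (delay w d) (guard e)" "w' = reset (delay w d) (set (resets e))"
    by (auto simp: moves_def)
  then have "step (instantiate v (simulator a K M G)) s d (inst_edge v e) s'"
    unfolding s step_simulator[OF assms(1)] by blast
  moreover have "label (inst_edge v e) = 0" using label_simulator[OF *(2)] by (simp add: inst_edge_def)
  ultimately show ?thesis by blast
qed

lemma free_moves:
  assumes "l < M" "l' < M" "(l = 8) = (l' = 8)" "0 \<le> d" "4 * real a + 10 \<le> w 0 + d"
  shows "((l, w), (l', delay w d)) \<in> moves p (simulator a K M G)"
  by (rule movesI[where d = d and e = "mk_edge l [ClockConst 0 CGe (int (4 * a + 10))] [] l'"])
    (use assms in \<open>auto simp: edge_simulator_iff delay_def\<close>)

lemma moves_loc:
  assumes "fits K M G" "((l, w), (l', w')) \<in> moves p (simulator a K M G)"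
  shows "l' < M"
proof -
  from assms(2) obtain e where "e \<in> set (edges (simulator a K M G))" "target e = l'"
    by (auto simp: moves_def)
  with wf_simulator[OF assms(1), of a] show ?thesis by (auto simp: wf_pta_def wf_edge_def)
qed

lemma path_trace:
  assumes G: "fits K M G" and s: "s 0 = (10, \<lambda>_. 0)" "\<And>i. (s i, s (Suc i)) \<in> moves (v 0) (simulator a K M G)"
  shows "(\<lambda>i. Some (fst (s i), 0)) \<in> Traces (instantiate v (simulator a K M G))"
proof -
  let ?T = "instantiate v (simulator a K M G)"
  have "\<forall>i. \<exists>d e. step ?T (s i) d e (s (Suc i)) \<and> label e = 0"
    using moves_step[where v = v, OF G s(2)] by blast
  then obtain d e where "\<And>i. step ?T (s i) (d i) (e i) (s (Suc i)) \<and> label (e i) = 0"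
    by metis
  then have "is_run ?T \<infinity> s d e" "untimed_trace \<infinity> s e = (\<lambda>i. Some (fst (s i), 0))"
    using s(1) by (auto simp: is_run_def untimed_trace_def instantiate_def sat_def)
  then show ?thesis unfolding Traces_def by (metis (mono_tags, lifting) mem_Collect_eq)
qed

definition reaches_final :: "real \<Rightarrow> pta \<Rightarrow> bool" where
  "reaches_final p A \<longleftrightarrow> (\<exists>w. ((10, \<lambda>_. 0), (8, w)) \<in> (moves p A)\<^sup>*)"

definition free_traces :: "nat \<Rightarrow> trace set" where
  "free_traces M = {\<lambda>i. Some (l i, 0) | l. l 0 = 10 \<and> (\<forall>i. l i < M \<and> l i \<noteq> 8)}"

text \<open>Waiting long enough in the initial location enables all free edges for good, which
  realises every sequence in \<open>free_traces\<close>. Some free edge is available after a delay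
  in every state, so maximal runs are infinite. A trace outside \<open>free_traces\<close> therefore
  has to visit location \<open>8\<close>.\<close>

lemma Traces_simulator:
  assumes G: "fits K M G"
  shows "Traces (instantiate v (simulator a K M G)) = free_traces M \<longleftrightarrow>
    \<not> reaches_final (v 0) (simulator a K M G)"
proof
  let ?T = "instantiate v (simulator a K M G)" and ?R = "moves (v 0) (simulator a K M G)"
  assume eq: "Traces ?T = free_traces M"
  show "\<not> reaches_final (v 0) (simulator a K M G)"
  proof
    assume "reaches_final (v 0) (simulator a K M G)"
    then obtain w n where "((10, \<lambda>_. 0), (8, w)) \<in> ?R ^^ n"
      unfolding reaches_final_def by (meson rtrancl_imp_relpow)
    then obtain f where f: "f 0 = (10, \<lambda>_. 0)" "f n = (8, w)" "\<And>i. i < n \<Longrightarrow> (f i, f (Suc i)) \<in> ?R"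
      unfolding relpow_fun_conv by blast
    \<comment> \<open>A trace records the source of each step, so the visit to \<open>8\<close> must
      be continued. This delay enables the free loop there, which extends the finite path to an
      infinite run.\<close>
    define d where "d = max 0 (4 * real a + 10 - w 0)"
    have d: "0 \<le> d" "4 * real a + 10 \<le> w 0 + d" by (auto simp: d_def)
    have M: "8 < M" using G by (auto simp: fits_def)
    have "((8, delay w d), (8, delay (delay w d) 0)) \<in> ?R"
      using d M by (intro free_moves) (auto simp: delay_def)
    then have loop: "((8, delay w d), (8, delay w d)) \<in> ?R" by simp
    have enter: "((8, w), (8, delay w d)) \<in> ?R" using d M by (intro free_moves) auto
    define s where "s i = (if i \<le> n then f i else (8, delay w d))" for i
    have "s 0 = (10, \<lambda>_. 0)" using f(1) by (simp add: s_def)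
    moreover have "(s i, s (Suc i)) \<in> ?R" for i
    proof (cases i n rule: linorder_cases)
      case less
      then show ?thesis using f(3) by (simp add: s_def)
    next
      case equal
      then show ?thesis using f(2) enter by (simp add: s_def)
    next
      case greater
      then show ?thesis using loop by (simp add: s_def)
    qed
    ultimately have "(\<lambda>i. Some (fst (s i), 0)) \<in> free_traces M"
      unfolding eq[symmetric] by (rule path_trace[where v = v and s = s, OF G])
    then obtain l where l: "(\<lambda>i. Some (fst (s i), 0 :: nat)) = (\<lambda>i. Some (l i, 0))" "\<forall>i. l i \<noteq> 8"
      by (auto simp: free_traces_def)
    from fun_cong[OF l(1), of n] have "fst (s n) = l n" by simp
    with l(2) f(2) show False by (auto simp: s_def)
  qed
next
  let ?T = "instantiate v (simulator a K M G)" and ?R = "moves (v 0) (simulator a K M G)"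
  assume safe: "\<not> reaches_final (v 0) (simulator a K M G)"
  show "Traces ?T = free_traces M"
  proof (intro equalityI subsetI)
    fix t assume "t \<in> Traces ?T"
    then obtain N s d e where t: "t = untimed_trace N s e" and run: "is_run ?T N s d e"
      by (auto simp: Traces_def)
    have s0: "s 0 = (10, \<lambda>_. 0)" using run by (simp add: is_run_def instantiate_def)
    have steps: "step ?T (s i) (d i) (e i) (s (Suc i))" if "enat i < N" for i
      using run that by (auto simp: is_run_def)
    have reach: "(s 0, s i) \<in> ?R\<^sup>* \<and> fst (s i) < M" if "enat i \<le> N" for i
      using that
    proof (induction i)
      case 0
      then show ?case using s0 G by (simp add: fits_def)
    next
      case (Suc i)
      then have "enat i < N" using Suc_ile_eq by blast
      then have "(s i, s (Suc i)) \<in> ?R" using step_moves[OF G steps] by blast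
      moreover have "fst (s (Suc i)) < M"
        using moves_loc[OF G] calculation by (metis prod.collapse)
      moreover have "(s 0, s i) \<in> ?R\<^sup>*" using Suc.IH \<open>enat i < N\<close> by auto
      ultimately show ?case by (auto intro: rtrancl.rtrancl_into_rtrancl)
    qed
    have "N = \<infinity>"
    proof (rule ccontr)
      assume "N \<noteq> \<infinity>"
      then obtain n where n: "N = enat n" by auto
      obtain l w where lw: "s n = (l, w)" by (cases "s n")
      have "l < M" using reach[of n] n lw by simp
      then have "((l, w), (l, delay w (max 0 (4 * real a + 10 - w 0)))) \<in> ?R"
        by (intro free_moves) auto
      from moves_step[where v = v, OF G this] have "\<exists>d' e' s'. step ?T (s n) d' e' s'" unfolding lw by blast
      then show False using run n by (auto simp: is_run_def)
    qed
    have "t i = Some (fst (s i), 0)" for i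
      using steps[of i] step_moves[OF G] t \<open>N = \<infinity>\<close> by (auto simp: untimed_trace_def)
    then have "t = (\<lambda>i. Some (fst (s i), 0))" by (rule ext)
    moreover have "fst (s i) \<noteq> 8" for i
    proof
      assume "fst (s i) = 8"
      then have "((10, \<lambda>_. 0), (8, snd (s i))) \<in> ?R\<^sup>*"
        using reach[of i] \<open>N = \<infinity>\<close> s0 by (metis enat_ord_simps(3) prod.collapse)
      then show False using safe by (auto simp: reaches_final_def)
    qed
    moreover have "fst (s i) < M" for i using reach[of i] \<open>N = \<infinity>\<close> by simp
    moreover have "fst (s 0) = 10" by (simp add: s0)
    ultimately show "t \<in> free_traces M"
      unfolding free_traces_def by (intro CollectI exI[of _ "\<lambda>i. fst (s i)"]) auto
  next
    fix t assume "t \<in> free_traces M"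
    then obtain l where l: "t = (\<lambda>i. Some (l i, 0))" "l 0 = 10" "\<And>i. l i < M" "\<And>i. l i \<noteq> 8"
      by (auto simp: free_traces_def)
    \<comment> \<open>Free edges reset nothing, so after a first delay of \<open>4 * a + 10\<close>
      all clocks keep this value and all later steps take no time.\<close>
    define w :: cval where "w = (\<lambda>_. 4 * real a + 10)"
    define s where "s i = (l i, if i = 0 then (\<lambda>_. 0) else w)" for i
    have "(s i, s (Suc i)) \<in> ?R" for i
    proof (cases "i = 0")
      case True
      have "((l 0, \<lambda>_. 0), (l (Suc 0), delay (\<lambda>_. 0) (4 * real a + 10))) \<in> ?R"
        by (rule free_moves) (use l(3,4) in auto)
      then show ?thesis using True by (simp add: s_def w_def delay_def)
    next
      case False
      have "((l i, w), (l (Suc i), delay w 0)) \<in> ?R"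
        by (rule free_moves) (use l(3,4) in \<open>auto simp: w_def\<close>)
      then show ?thesis using False by (simp add: s_def)
    qed
    from path_trace[where v = v and s = s, OF G _ this] l(2) show "t \<in> Traces ?T"
      by (simp add: s_def l(1))
  qed
qed

section \<open>Loading the inputs\<close>

definition loaded :: "(nat \<Rightarrow> nat) \<Rightarrow> nat \<Rightarrow> nat \<Rightarrow> nat \<Rightarrow> nat" where
  "loaded N i m = (\<lambda>r. if r < i then N r else if r = i then m else 0)"

text \<open>Register \<open>i\<close> is incremented for as long as clock \<open>1\<close> prescribes, so that the input occurs in the
  automaton only as a constant of one guard.\<close>

definition load_edge :: "nat \<Rightarrow> nat \<Rightarrow> (nat \<Rightarrow> nat) \<Rightarrow> nat \<Rightarrow> nat \<times> clock_op option \<times> nat" where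
  "load_edge a b N i = (i, Some (Elapsed (inc_time a b * N i)), Suc i)"

text \<open>Nodes \<open>0\<close>, \<open>1\<close> and \<open>2\<close> carry the loading loops,
  the program leads from \<open>3\<close> to \<open>4\<close>, and \<open>5\<close> is reserved for
  the initial location. An increment has fewer than \<open>a + b\<close> inner nodes, which gives
  the offsets. The inputs do not occur here, so the code of this part can itself be an
  input.\<close>

definition control_body :: "nat \<Rightarrow> nat \<Rightarrow> counter_op prog \<Rightarrow> clock_op graph" where
  "control_body a b c =
     graph (counter_impl a b (Inc 0)) 0 0 6 @ graph (counter_impl a b (Inc 1)) 1 1 (6 + (a + b)) @
     graph (counter_impl a b (Inc 2)) 2 2 (6 + 2 * (a + b)) @
     graph (expand (counter_impl a b) c) 3 4 (6 + 3 * (a + b))"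

definition control :: "nat \<Rightarrow> nat \<Rightarrow> counter_op prog \<Rightarrow> (nat \<Rightarrow> nat) \<Rightarrow> clock_op graph" where
  "control a b c N =
     load_edge a b N 0 # load_edge a b N 1 # load_edge a b N 2 # control_body a b c"

lemma fresh_repeat: "fresh (repeat x n) = n"
  by (induction n) auto

lemma fresh_inc: "0 < a \<Longrightarrow> 0 < b \<Longrightarrow> fresh (counter_impl a b (Inc r)) < a + b"
  by (simp add: fresh_repeat)

lemma inductive_on_restrict:
  assumes "inductive_on I G A" "\<And>e w w'. (w, w') \<in> label_sem I e \<Longrightarrow> w \<in> B \<Longrightarrow> w' \<in> B"
  shows "inductive_on I G (\<lambda>x. A x \<inter> B)"
  using assms unfolding inductive_on_def by fast

lemma control_nodes:
  assumes ab: "0 < a" "0 < b" and "(x, e, y) \<in> set (control a b c N)"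
  shows "x \<noteq> 5" "x < 6 + 3 * (a + b) + fresh (expand (counter_impl a b) c)"
    "y < 6 + 3 * (a + b) + fresh (expand (counter_impl a b) c)"
proof -
  have *: "(x < 5 \<or> 6 \<le> x \<and> x < 6 + 3 * (a + b)) \<and> (y < 5 \<or> 6 \<le> y \<and> y < 6 + 3 * (a + b))"
    if "(x, e, y) \<in> set (graph (counter_impl a b (Inc i)) i i (6 + i * (a + b)))" "i < 3" for i
  proof -
    have "6 + i * (a + b) + fresh (counter_impl a b (Inc i)) < 6 + Suc i * (a + b)"
      using fresh_inc[OF ab, of i] by simp
    also have "\<dots> \<le> 6 + 3 * (a + b)" using that(2) by (intro add_left_mono mult_right_mono) auto
    finally show ?thesis using graph_nodes[OF that(1)] that(2) by auto
  qed
  let ?top = "6 + 3 * (a + b) + fresh (expand (counter_impl a b) c)"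
  from assms(3) consider "(x, e, y) \<in> {load_edge a b N 0, load_edge a b N 1, load_edge a b N 2}"
    | "(x, e, y) \<in> set (graph (counter_impl a b (Inc 0)) 0 0 6)"
    | "(x, e, y) \<in> set (graph (counter_impl a b (Inc 1)) 1 1 (6 + (a + b)))"
    | "(x, e, y) \<in> set (graph (counter_impl a b (Inc 2)) 2 2 (6 + 2 * (a + b)))"
    | "(x, e, y) \<in> set (graph (expand (counter_impl a b) c) 3 4 (6 + 3 * (a + b)))"
    unfolding control_def control_body_def set_append list.set by blast
  then have "x \<noteq> 5 \<and> x < ?top \<and> y < ?top"
  proof cases
    case 1
    then show ?thesis by (auto simp: load_edge_def)
  next
    case 2
    with *[of 0] show ?thesis by (auto simp del: counter_impl.simps)
  next
    case 3
    with *[of 1] show ?thesis by (auto simp del: counter_impl.simps)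
  next
    case 4
    with *[of 2] show ?thesis by (auto simp del: counter_impl.simps)
  next
    case 5
    from graph_nodes[OF this] show ?thesis by auto
  qed
  then show "x \<noteq> 5" "x < 6 + 3 * (a + b) + fresh (expand (counter_impl a b) c)"
    "y < 6 + 3 * (a + b) + fresh (expand (counter_impl a b) c)" by auto
qed

lemma graph_ops: "(x, Some z, y) \<in> set (graph c i j n) \<Longrightarrow> z \<in> prog_ops c"
proof (induction c arbitrary: i j n)
  case (Seq c d)
  then show ?case by simp blast
next
  case (Star c)
  then show ?case by simp
qed simp

lemma prog_ops_expand: "prog_ops (expand f c) = (\<Union>x\<in>prog_ops c. prog_ops (f x))"
  by (induction c) auto

lemma prog_ops_repeat: "prog_ops (repeat x n) = {x}"
  by (induction n) auto

lemma op_reg_impl: "z \<in> prog_ops (counter_impl a b x) \<Longrightarrow> op_reg z = reg_of x"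
  by (cases x) (auto simp: prog_ops_repeat)

lemma control_regs:
  assumes K: "3 < K" "\<forall>x\<in>prog_ops c. reg_of x < K" and z: "(x, Some z, y) \<in> set (control a b c N)"
  shows "op_reg z < K"
proof -
  from z consider "z \<in> Elapsed ` UNIV" | "\<exists>r\<in>{0, 1, 2}. z \<in> prog_ops (counter_impl a b (Inc r))"
    | "z \<in> prog_ops (expand (counter_impl a b) c)"
    unfolding control_def control_body_def load_edge_def
    by (auto simp del: counter_impl.simps dest!: graph_ops)
  then show ?thesis
  proof cases
    case 2
    then obtain r where r: "r \<in> {0, 1, 2}" "z \<in> prog_ops (counter_impl a b (Inc r))" by blast
    have "op_reg z = r" using op_reg_impl[OF r(2)] by simp
    with r(1) K(1) show ?thesis by auto
  next
    case 3
    then obtain u where "u \<in> prog_ops c" "z \<in> prog_ops (counter_impl a b u)"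
      by (auto simp: prog_ops_expand)
    then show ?thesis using K(2) op_reg_impl by metis
  qed (use K(1) in auto)
qed

text \<open>At node \<open>i < 3\<close> clock \<open>1\<close> counts the increments so far, so the
  guard of the loading edge forces \<open>m = N i\<close> even for \<open>\<eta> = 0\<close>, where
  the register clocks reveal nothing. As the program has no run from the loaded inputs, the empty
  set is a valid assertion at the final node.\<close>

lemma control_annotation:
  assumes ab: "0 < a" "0 < b" and K: "3 \<le> K" and \<eta>: "\<eta> = real a - real b * p"
    and blocked: "\<And>w w'. represents K \<eta> (loaded N 3 0) w \<Longrightarrow>
      (w, w') \<notin> sem (clock_sem a K p) (expand (counter_impl a b) c)"
  shows "\<exists>A. inductive_on (clock_sem a K p) (control a b c N) A \<and> A 4 = {} \<and> A 5 = {} \<and>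
    start_val \<in> A 0 \<and> (\<forall>i. \<forall>w\<in>A i. w 0 = 0 \<and> bounded_regs a K w)"
proof -
  let ?I = "clock_sem a K p" and ?D = "inc_time a b"
  have D: "0 < ?D" using ab by (simp add: inc_time_def)
  define A0 where "A0 i = (if i < 3
      then {w. \<exists>m. represents K \<eta> (loaded N i m) w \<and> w 1 = real (m * ?D)}
      else if i = 3 then {w. represents K \<eta> (loaded N 3 0) w} else {})" for i
  have inc: "sem ?I (counter_impl a b (Inc i)) `` A0 i \<subseteq> A0 i" if "i < 3" for i
  proof clarify
    fix w w' assume w: "w \<in> A0 i" and s: "(w, w') \<in> sem ?I (counter_impl a b (Inc i))"
    from w that obtain m where m: "represents K \<eta> (loaded N i m) w" "w 1 = real (m * ?D)"
      by (auto simp: A0_def)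
    have w': "w' = shift K i \<eta> (real ?D) w" unfolding \<eta> by (rule inc_sound[OF ab s])
    have "represents K \<eta> ((loaded N i m)(i := Suc m)) w'"
      unfolding w' using that K by (intro represents_shift[OF m(1)]) (auto simp: loaded_def algebra_simps)
    moreover have "(loaded N i m)(i := Suc m) = loaded N i (Suc m)" by (auto simp: loaded_def)
    moreover have "w' 1 = real (Suc m * ?D)"
      unfolding w' using m(2) by (simp add: shift_def is_reg_def algebra_simps)
    ultimately show "w' \<in> A0 i" using that by (auto simp: A0_def algebra_simps intro!: exI[of _ "Suc m"])
  qed
  have load: "w(1 := 0) \<in> A0 (Suc i)" if "w \<in> A0 i" "w 1 = real (?D * N i)" "i < 3" for i w
  proof -
    from that obtain m where m: "represents K \<eta> (loaded N i m) w" "w 1 = real (m * ?D)"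
      by (auto simp: A0_def)
    have "m = N i" using m(2) that(2) D by (simp add: mult.commute)
    have "loaded N i m = loaded N (Suc i) 0"
      using \<open>m = N i\<close> by (auto simp: loaded_def fun_eq_iff less_Suc_eq)
    then have "represents K \<eta> (loaded N (Suc i) 0) (w(1 := 0))"
      using m(1) by (simp add: represents_def)
    moreover have "Suc i < 3 \<or> Suc i = 3" using that(3) by linarith
    ultimately show ?thesis by (auto simp: A0_def intro!: exI[of _ 0])
  qed
  let ?n = "\<lambda>i::nat. 6 + i * (a + b)"
  have next_n: "?n i + fresh (counter_impl a b (Inc r)) \<le> ?n (Suc i)" for i r
    using fresh_inc[OF ab, of r] by simp
  \<comment> \<open>The loops are annotated one after the other. Each application changes only its
    own block of inner nodes, so the earlier annotations survive.\<close>
  have inc_annotation: "\<exists>A'. (\<forall>x. x \<notin> {?n i..<?n k} \<longrightarrow> A' x = A x) \<and>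
      inductive_on ?I (graph (counter_impl a b (Inc i)) i i (?n i)) A'"
    if "i < 3" "A i = A0 i" "k = Suc i" for i k A
  proof -
    have lt: "i < ?n i" using that(1) by simp
    have "sem ?I (counter_impl a b (Inc i)) `` A i \<subseteq> A i" using inc[OF that(1)] that(2) by (simp only:)
    from graph_annotation[where A = A, OF lt lt this]
    obtain A' where A': "\<forall>x. x \<notin> {?n i..<?n i + fresh (counter_impl a b (Inc i))} \<longrightarrow> A' x = A x"
      "inductive_on ?I (graph (counter_impl a b (Inc i)) i i (?n i)) A'"
      by blast
    moreover have "{?n i..<?n i + fresh (counter_impl a b (Inc i))} \<subseteq> {?n i..<?n k}"
      using next_n[of i i] unfolding that(3) ivl_subset by blast
    then have "\<forall>x. x \<notin> {?n i..<?n k} \<longrightarrow> A' x = A x"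
      using A'(1) by blast
    ultimately show ?thesis by blast
  qed
  have "\<exists>A'. (\<forall>x. x \<notin> {?n 0..<?n 1} \<longrightarrow> A' x = A0 x) \<and>
      inductive_on ?I (graph (counter_impl a b (Inc 0)) 0 0 (?n 0)) A'"
    by (rule inc_annotation) simp_all
  then obtain A1 where A1: "\<And>x. x \<notin> {?n 0..<?n 1} \<Longrightarrow> A1 x = A0 x"
    "inductive_on ?I (graph (counter_impl a b (Inc 0)) 0 0 (?n 0)) A1"
    by blast
  have "\<exists>A'. (\<forall>x. x \<notin> {?n 1..<?n 2} \<longrightarrow> A' x = A1 x) \<and>
      inductive_on ?I (graph (counter_impl a b (Inc 1)) 1 1 (?n 1)) A'"
    by (rule inc_annotation) (use A1(1)[of 1] in simp_all)
  then obtain A2 where A2: "\<And>x. x \<notin> {?n 1..<?n 2} \<Longrightarrow> A2 x = A1 x"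
    "inductive_on ?I (graph (counter_impl a b (Inc 1)) 1 1 (?n 1)) A2"
    by blast
  have "\<exists>A'. (\<forall>x. x \<notin> {?n 2..<?n 3} \<longrightarrow> A' x = A2 x) \<and>
      inductive_on ?I (graph (counter_impl a b (Inc 2)) 2 2 (?n 2)) A'"
    by (rule inc_annotation) (use A1(1)[of 2] A2(1)[of 2] in simp_all)
  then obtain A3 where A3: "\<And>x. x \<notin> {?n 2..<?n 3} \<Longrightarrow> A3 x = A2 x"
    "inductive_on ?I (graph (counter_impl a b (Inc 2)) 2 2 (?n 2)) A3"
    by blast
  have low: "A3 x = A0 x" if "x < 6" for x
    using that A1(1)[of x] A2(1)[of x] A3(1)[of x] by simp
  have "sem ?I (expand (counter_impl a b) c) `` A3 3 \<subseteq> A3 4"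
    using blocked low[of 3] low[of 4] by (auto simp: A0_def)
  from graph_annotation[where A = A3 and n = "?n 3", OF _ _ this]
  obtain A4 where A4: "\<And>x. x \<notin> {?n 3..<?n 3 + fresh (expand (counter_impl a b) c)} \<Longrightarrow> A4 x = A3 x"
    "inductive_on ?I (graph (expand (counter_impl a b) c) 3 4 (?n 3)) A4"
    by auto
  have low4: "A4 x = A0 x" if "x < 6" for x
    using that A4(1)[of x] low[of x] by simp
  have inc4: "inductive_on ?I (graph (counter_impl a b (Inc i)) i i (?n i)) A4"
    if ind: "inductive_on ?I (graph (counter_impl a b (Inc i)) i i (?n i)) A'"
      and i: "i < 3" and k: "k = Suc i"
      and same: "\<And>x. x < 6 \<or> ?n i \<le> x \<and> x < ?n k \<Longrightarrow> A4 x = A' x" for i k A'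
  proof (rule inductive_on_cong[OF ind])
    fix x e y assume e: "(x, e, y) \<in> set (graph (counter_impl a b (Inc i)) i i (?n i))"
    have "x < 6 \<or> ?n i \<le> x \<and> x < ?n k" "y < 6 \<or> ?n i \<le> y \<and> y < ?n k"
      using graph_nodes[OF e] i next_n[of i i] unfolding k by auto
    then show "A4 x = A' x \<and> A4 y = A' y" using same by blast
  qed
  have "inductive_on ?I (graph (counter_impl a b (Inc 0)) 0 0 (?n 0)) A4"
  proof (rule inc4[where k = 1, OF A1(2)])
    fix x assume "x < 6 \<or> ?n 0 \<le> x \<and> x < ?n 1"
    then show "A4 x = A1 x"
    proof
      assume "x < 6"
      then show ?thesis using low4[of x] A1(1)[of x] by simp
    next
      assume "?n 0 \<le> x \<and> x < ?n 1"
      then show ?thesis using A2(1)[of x] A3(1)[of x] A4(1)[of x] by simp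
    qed
  qed simp_all
  moreover have "inductive_on ?I (graph (counter_impl a b (Inc 1)) 1 1 (?n 1)) A4"
  proof (rule inc4[where k = 2, OF A2(2)])
    fix x assume "x < 6 \<or> ?n 1 \<le> x \<and> x < ?n 2"
    then show "A4 x = A2 x"
    proof
      assume "x < 6"
      then show ?thesis using low4[of x] A1(1)[of x] A2(1)[of x] by simp
    next
      assume "?n 1 \<le> x \<and> x < ?n 2"
      then show ?thesis using A3(1)[of x] A4(1)[of x] by simp
    qed
  qed simp_all
  moreover have "inductive_on ?I (graph (counter_impl a b (Inc 2)) 2 2 (?n 2)) A4"
  proof (rule inc4[where k = 3, OF A3(2)])
    fix x assume "x < 6 \<or> ?n 2 \<le> x \<and> x < ?n 3"
    then show "A4 x = A3 x"
    proof
      assume "x < 6"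
      then show ?thesis using low4[of x] low[of x] by simp
    next
      assume "?n 2 \<le> x \<and> x < ?n 3"
      then show ?thesis using A4(1)[of x] by simp
    qed
  qed simp_all
  ultimately have body: "inductive_on ?I (control_body a b c) A4"
    using A4(2) by (simp add: control_body_def inductive_on_append del: counter_impl.simps)
  have "inductive_on ?I [load_edge a b N i] A4" if "i < 3" for i
    using load[of _ i] that low4[of i] low4[of "Suc i"] by (auto simp: inductive_on_def load_edge_def)
  from this[of 0] this[of 1] this[of 2] body have ind: "inductive_on ?I (control a b c N) A4"
    by (simp add: control_def inductive_on_def)
  \<comment> \<open>Intersecting with \<open>B\<close> supplies what \<open>simulator_sound\<close>
    requires of valuations at nodes; \<open>clock_sem_preserves\<close> shows that every label
    preserves it.\<close>
  define B where "B = {w. w 0 = 0 \<and> bounded_regs a K w}"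
  have "inductive_on ?I (control a b c N) (\<lambda>x. A4 x \<inter> B)"
    using ind by (rule inductive_on_restrict) (auto simp: B_def dest: clock_sem_preserves)
  moreover have "start_val \<in> A4 0 \<inter> B"
  proof -
    have "represents K \<eta> (loaded N 0 0) start_val"
      by (simp add: represents_def start_val_def loaded_def)
    moreover have "bounded_regs a K start_val"
      by (auto simp: bounded_regs_def start_val_def is_reg_def)
    ultimately show ?thesis
      unfolding low4[of 0, simplified] by (auto simp: A0_def B_def start_val_def intro!: exI[of _ 0])
  qed
  moreover have "A4 4 \<inter> B = {}" "A4 5 \<inter> B = {}"
    using low4[of 4] low4[of 5] by (auto simp: A0_def)
  ultimately show ?thesis
    by (intro exI[of _ "\<lambda>x. A4 x \<inter> B"]) (auto simp: B_def)
qed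

lemma control_path:
  assumes ab: "0 < a" "0 < b" and K: "3 \<le> K" and \<eta>: "\<eta> = real a - real b * p" and p: "0 \<le> p"
    and small: "\<bar>\<eta>\<bar> * real (N 0 + N 1 + N 2 + 2) < 1"
    and final: "\<And>w. represents K \<eta> (loaded N 3 0) w \<Longrightarrow>
      \<exists>w'. (w, w') \<in> sem (clock_sem a K p) (expand (counter_impl a b) c)"
  shows "\<exists>w. ((0, start_val), (4, w)) \<in> (graph_step (clock_sem a K p) (control a b c N))\<^sup>*"
proof -
  let ?I = "clock_sem a K p" and ?D = "inc_time a b" and ?n = "\<lambda>i::nat. 6 + i * (a + b)"
  let ?R = "graph_step ?I (control a b c N)"
  have inc_graph: "set (graph (counter_impl a b (Inc i)) i i (?n i)) \<subseteq> set (control a b c N)" if "i < 3" for i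
  proof -
    have "i = 0 \<or> i = 1 \<or> i = 2" using that by auto
    then show ?thesis by (auto simp: control_def control_body_def simp del: counter_impl.simps)
  qed
  have load: "\<exists>w'. ((i, w), (Suc i, w')) \<in> ?R\<^sup>* \<and> represents K \<eta> (loaded N (Suc i) 0) w' \<and> w' 1 = 0"
    if "i < 3" "represents K \<eta> (loaded N i 0) w" "w 1 = 0" for i w
  proof -
    have "\<exists>w'. ((i, w), (i, w')) \<in> ?R\<^sup>* \<and> represents K \<eta> (loaded N i m) w' \<and> w' 1 = real (m * ?D)"
      if "m \<le> N i" for m
      using that
    proof (induction m)
      case 0
      then show ?case using \<open>represents K \<eta> (loaded N i 0) w\<close> \<open>w 1 = 0\<close> by (intro exI[of _ w]) auto
    next
      case (Suc m)
      then obtain w1 where w1: "((i, w), (i, w1)) \<in> ?R\<^sup>*" "represents K \<eta> (loaded N i m) w1"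
        "w1 1 = real (m * ?D)" by auto
      let ?w = "shift K i \<eta> (real ?D) w1"
      \<comment> \<open>While loading, no register exceeds its final content, so a single bound on
        \<eta> serves all increments.\<close>
      have "reg_sum K (loaded N i m) \<le> (\<Sum>r<K. if r < 3 then N r else 0)"
        unfolding reg_sum_def using Suc.prems \<open>i < 3\<close> by (intro sum_mono) (auto simp: loaded_def)
      also have "\<dots> = (\<Sum>r<3. N r)"
        using K by (intro sum.mono_neutral_cong_right) auto
      also have "\<dots> = N 0 + N 1 + N 2" by (simp add: eval_nat_numeral)
      finally have "\<bar>\<eta>\<bar> * real (reg_sum K (loaded N i m) + 2) \<le> \<bar>\<eta>\<bar> * real (N 0 + N 1 + N 2 + 2)"
        by (intro mult_left_mono) auto
      with small have "\<bar>\<eta>\<bar> * real (reg_sum K (loaded N i m) + 2) < 1" by simp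
      from inc_complete[OF ab \<eta> p w1(2) this, of i] have "(w1, ?w) \<in> sem ?I (counter_impl a b (Inc i))"
        using \<open>i < 3\<close> K by simp
      from graph_path[OF this inc_graph[OF \<open>i < 3\<close>]] have "((i, w1), (i, ?w)) \<in> ?R\<^sup>*" .
      with w1(1) have "((i, w), (i, ?w)) \<in> ?R\<^sup>*" by (rule rtrancl_trans)
      moreover have "represents K \<eta> ((loaded N i m)(i := Suc m)) ?w"
        using \<open>i < 3\<close> K by (intro represents_shift[OF w1(2)]) (auto simp: loaded_def algebra_simps)
      moreover have "(loaded N i m)(i := Suc m) = loaded N i (Suc m)" by (auto simp: loaded_def)
      moreover have "?w 1 = real (Suc m * ?D)"
        using w1(3) by (simp add: shift_def is_reg_def algebra_simps)
      ultimately show ?case by auto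
    qed
    then obtain w1 where w1: "((i, w), (i, w1)) \<in> ?R\<^sup>*" "represents K \<eta> (loaded N i (N i)) w1"
      "w1 1 = real (N i * ?D)" by auto
    have "load_edge a b N i \<in> set (control a b c N)"
    proof -
      have "i = 0 \<or> i = 1 \<or> i = 2" using that by auto
      then show ?thesis by (auto simp: control_def)
    qed
    then have "((i, w1), (Suc i, w1(1 := 0))) \<in> ?R"
      using w1(3) by (auto simp: graph_step_def load_edge_def mult.commute
          intro!: exI[of _ "Some (Elapsed (?D * N i))"])
    with w1(1) have "((i, w), (Suc i, w1(1 := 0))) \<in> ?R\<^sup>*" by (rule rtrancl_into_rtrancl)
    moreover have "loaded N i (N i) = loaded N (Suc i) 0"
      by (auto simp: loaded_def fun_eq_iff less_Suc_eq)
    then have "represents K \<eta> (loaded N (Suc i) 0) (w1(1 := 0))"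
      using w1(2) by (simp add: represents_def)
    ultimately show ?thesis by auto
  qed
  have "represents K \<eta> (loaded N 0 0) start_val" "start_val 1 = 0"
    by (simp_all add: represents_def start_val_def loaded_def)
  from load[OF _ this] obtain w1 where w1: "((0, start_val), (1, w1)) \<in> ?R\<^sup>*"
    "represents K \<eta> (loaded N 1 0) w1" "w1 1 = 0" by auto
  from load[OF _ w1(2,3)] obtain w2 where w2: "((1, w1), (2, w2)) \<in> ?R\<^sup>*"
    "represents K \<eta> (loaded N 2 0) w2" "w2 1 = 0" by (auto simp: numeral_2_eq_2)
  from load[OF _ w2(2,3)] obtain w3 where w3: "((2, w2), (3, w3)) \<in> ?R\<^sup>*"
    "represents K \<eta> (loaded N 3 0) w3" by (auto simp: numeral_3_eq_3)
  from final[OF w3(2)] obtain w4 where "(w3, w4) \<in> sem ?I (expand (counter_impl a b) c)" by blast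
  then have "((3, w3), (4, w4)) \<in> ?R\<^sup>*"
    by (rule graph_path[of _ _ _ _ _ _ "6 + 3 * (a + b)"]) (auto simp: control_def control_body_def)
  with w1(1) w2(1) w3(1) show ?thesis by (meson rtrancl_trans)
qed

section \<open>Computing the encoding\<close>

definition computable :: "nat \<Rightarrow> (nat list \<Rightarrow> nat) \<Rightarrow> bool" where
  "computable n \<phi> \<longleftrightarrow> (\<exists>f. \<forall>xs. length xs = n \<longrightarrow> rec_eval f xs (\<phi> xs))"

lemma computable_const: "computable n (\<lambda>xs. c)"
proof -
  have "\<exists>f. \<forall>xs. rec_eval f xs c"
  proof (induction c)
    case 0
    then show ?case by (blast intro: eval_Zero)
  next
    case (Suc c)
    then obtain f where "\<And>xs. rec_eval f xs c" by blast
    then have "rec_eval (Comp Succ [f]) xs (Suc c)" for xs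
      by (intro eval_Comp[of xs _ "[c]"]) (auto intro: eval_Succ)
    then show ?case by blast
  qed
  then show ?thesis by (auto simp: computable_def)
qed

lemma computable_nth:
  assumes "i < n"
  shows "computable n (\<lambda>xs. xs ! i)"
  unfolding computable_def using assms by (intro exI[of _ "Proj i"]) (auto intro: eval_Proj)

lemma computable_Comp1:
  assumes "\<And>x. rec_eval g [x] (h x)" "computable n \<phi>"
  shows "computable n (\<lambda>xs. h (\<phi> xs))"
proof -
  obtain f where f: "\<And>xs. length xs = n \<Longrightarrow> rec_eval f xs (\<phi> xs)"
    using assms(2) by (auto simp: computable_def)
  have "rec_eval (Comp g [f]) xs (h (\<phi> xs))" if "length xs = n" for xs
    using f[OF that] by (intro eval_Comp[of xs _ "[\<phi> xs]"] assms(1)) simp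
  then show ?thesis unfolding computable_def by blast
qed

lemma computable_Comp2:
  assumes "\<And>x y. rec_eval g [x, y] (h x y)" "computable n \<phi>" "computable n \<psi>"
  shows "computable n (\<lambda>xs. h (\<phi> xs) (\<psi> xs))"
proof -
  obtain f where f: "\<And>xs. length xs = n \<Longrightarrow> rec_eval f xs (\<phi> xs)"
    using assms(2) by (auto simp: computable_def)
  obtain f' where f': "\<And>xs. length xs = n \<Longrightarrow> rec_eval f' xs (\<psi> xs)"
    using assms(3) by (auto simp: computable_def)
  have "rec_eval (Comp g [f, f']) xs (h (\<phi> xs) (\<psi> xs))" if "length xs = n" for xs
    using f[OF that] f'[OF that] by (intro eval_Comp[of xs _ "[\<phi> xs, \<psi> xs]"] assms(1)) simp
  then show ?thesis unfolding computable_def by blast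
qed

definition rec_add :: recf where
  "rec_add = PrimRec (Proj 0) (Comp Succ [Proj 1])"

definition rec_triangle :: recf where
  "rec_triangle = PrimRec Zero (Comp rec_add [Comp Succ [Proj 0], Proj 1])"

lemma eval_Proj': "i < length xs \<Longrightarrow> y = xs ! i \<Longrightarrow> rec_eval (Proj i) xs y"
  by (simp add: eval_Proj)

lemma eval_add: "rec_eval rec_add [x, y] (x + y)"
  unfolding rec_add_def
proof (induction x)
  case 0
  show ?case by (simp, rule eval_PrimRec_0, rule eval_Proj') simp_all
next
  case (Suc x)
  have "rec_eval (Comp Succ [Proj 1]) [x, x + y, y] (Suc (x + y))"
    by (rule eval_Comp[of _ _ "[x + y]"]) (auto intro: eval_Succ eval_Proj')
  from eval_PrimRec_Suc[OF Suc this] show ?case by simp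
qed

lemma eval_triangle: "rec_eval rec_triangle [n] (triangle n)"
  unfolding rec_triangle_def
proof (induction n)
  case 0
  show ?case by (simp, rule eval_PrimRec_0, rule eval_Zero)
next
  case (Suc n)
  have "rec_eval (Comp Succ [Proj 0]) [n, triangle n] (Suc n)"
    by (rule eval_Comp[of _ _ "[n]"]) (auto intro: eval_Succ eval_Proj')
  moreover have "rec_eval (Proj 1) [n, triangle n] (triangle n)"
    by (rule eval_Proj') simp_all
  ultimately have "rec_eval (Comp rec_add [Comp Succ [Proj 0], Proj 1]) [n, triangle n] (Suc n + triangle n)"
    by (intro eval_Comp[of _ _ "[Suc n, triangle n]"] eval_add) simp
  from eval_PrimRec_Suc[OF Suc this] show ?case by (simp add: add.commute)
qed

lemma computable_Suc: "computable n \<phi> \<Longrightarrow> computable n (\<lambda>xs. Suc (\<phi> xs))"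
  by (rule computable_Comp1[OF eval_Succ])

lemma computable_add:
  "computable n \<phi> \<Longrightarrow> computable n \<psi> \<Longrightarrow> computable n (\<lambda>xs. \<phi> xs + \<psi> xs)"
  by (rule computable_Comp2[OF eval_add])

lemma computable_mult: "computable n \<phi> \<Longrightarrow> computable n (\<lambda>xs. c * \<phi> xs)"
proof (induction c)
  case 0
  then show ?case by (simp add: computable_const)
next
  case (Suc c)
  then show ?case by (simp add: computable_add)
qed

lemma computable_prod_encode:
  assumes "computable n \<phi>" "computable n \<psi>"
  shows "computable n (\<lambda>xs. prod_encode (\<phi> xs, \<psi> xs))"
  unfolding prod_encode_def prod.case
  by (rule computable_add[OF computable_Comp1[OF eval_triangle computable_add] assms(1)]) (fact assms)+

lemma computable_list_encode_Nil: "computable n (\<lambda>xs. list_encode [])"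
  by (rule computable_const)

lemma computable_list_encode_Cons:
  assumes "computable n \<phi>" "computable n (\<lambda>xs. list_encode (\<psi> xs))"
  shows "computable n (\<lambda>xs. list_encode (\<phi> xs # \<psi> xs))"
  unfolding list_encode.simps by (intro computable_Suc computable_prod_encode assms)

lemmas computable_intros =
  computable_list_encode_Nil computable_list_encode_Cons computable_prod_encode computable_mult
  computable_Suc computable_nth computable_const

text \<open>The guard on clock \<open>1\<close> is spelled out as a list to make the dependence on
  \<open>n\<close> arithmetical: \<open>int_encode\<close> maps a nonnegative integer to its double,
  whence the factor \<open>2\<close>.\<close>

definition load_edge_code :: "nat \<Rightarrow> nat \<Rightarrow> nat \<Rightarrow> nat \<Rightarrow> nat" where
  "load_edge_code a b i n = list_encode
     [2 * i, list_encode [enc_atom (ClockConst 0 CEq 0), list_encode [1, 1, 2, 2 * inc_time a b * n]],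
      0, list_encode [1], 2 * Suc i]"

text \<open>The three arguments, which are also the inputs of the simulated program, are the code of the
  locations, the code of the invariants and the code of those edges that do not depend on the inputs.\<close>

definition instance_code :: "nat \<Rightarrow> nat \<Rightarrow> nat \<Rightarrow> nat list \<Rightarrow> nat" where
  "instance_code a b q xs = prod_encode (list_encode
     [list_encode [0], xs ! 0, 10, xs ! 0, list_encode [0], xs ! 1,
      Suc (prod_encode (load_edge_code a b 0 (xs ! 0),
      Suc (prod_encode (load_edge_code a b 1 (xs ! 1),
      Suc (prod_encode (load_edge_code a b 2 (xs ! 2), xs ! 2))))))], list_encode [q])"

lemma computable_load_edge_code:
  "computable n \<phi> \<Longrightarrow> computable n (\<lambda>xs. load_edge_code a b i (\<phi> xs))"
  unfolding load_edge_code_def by (intro computable_intros)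

lemma computable_instance_code: "computable 3 (instance_code a b q)"
  unfolding instance_code_def
  by (intro computable_intros computable_load_edge_code computable_nth) simp_all

lemma enc_load_edge:
  "map enc_edge (op_edges a K k (load_edge a b N i)) = [load_edge_code a b i (N i)]"
  by (simp add: load_edge_def enc_edge_def mk_edge_def enc_constraint_def load_edge_code_def
      int_encode_def sum_encode_def nat_mult_distrib mult.assoc del: list_encode.simps)

text \<open>\<open>list_encode\<close> builds the code of a list from its head and the code of its
  tail. The loading edges come first, so the code of the remaining edges enters as the single number
  \<open>N 2\<close>. The equations for \<open>N\<close> mention \<open>M\<close> and
  \<open>c\<close> but not \<open>N\<close>, hence they can be met by definition.\<close>

lemma enc_instance_simulator:
  fixes v :: "param \<Rightarrow> rat"
  assumes "N 0 = list_encode [0..<M]"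
    "N 1 = list_encode (map (\<lambda>l. enc_constraint []) [0..<M])"
    "N 2 = list_encode (map enc_edge (edges_of a K 3 (control_body a b c) @ start_edge # free_edges a M))"
  shows "enc_instance (simulator a K M (control a b c N), v) =
    instance_code a b (enc_rat (v 0)) [N 0, N 1, N 2]"
proof -
  have "map enc_edge (edges (simulator a K M (control a b c N))) =
      map enc_edge (op_edges a K 0 (load_edge a b N 0)) @ map enc_edge (op_edges a K 1 (load_edge a b N 1)) @
      map enc_edge (op_edges a K 2 (load_edge a b N 2)) @
      map enc_edge (edges_of a K 3 (control_body a b c) @ start_edge # free_edges a M)"
    by (simp add: simulator_def control_def edges_of_def numeral_2_eq_2 numeral_3_eq_3)
  then have "list_encode (map enc_edge (edges (simulator a K M (control a b c N)))) =
      Suc (prod_encode (load_edge_code a b 0 (N 0),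
      Suc (prod_encode (load_edge_code a b 1 (N 1),
      Suc (prod_encode (load_edge_code a b 2 (N 2), N 2))))))"
    unfolding enc_load_edge assms(3) by simp
  then show ?thesis
    using assms(1,2) by (simp add: enc_instance_def enc_pta_def instance_code_def del: list_encode.simps)
qed

section \<open>Undecidability\<close>

text \<open>Register \<open>3\<close> receives the output of the compiled program. The decrement
  rejects output \<open>0\<close>, and it also blocks at \<open>\<eta> = 0\<close>, where a zero
  test alone would pass.\<close>

definition outputs_one :: "counter_op prog \<Rightarrow> counter_op prog" where
  "outputs_one c = Seq c (Seq (Op (Dec 3)) (Op (IsZero 3)))"

lemma outputs_one_sound:
  assumes ab: "0 < a" "0 < b" and K: "3 < K" "\<forall>x\<in>prog_ops c. reg_of x < K"
    and \<eta>: "\<eta> = real a - real b * p" and rep: "represents K \<eta> n w"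
    and run: "(w, w') \<in> sem (clock_sem a K p) (expand (counter_impl a b) (outputs_one c))"
  shows "\<eta> \<noteq> 0 \<and> (\<exists>n'. exec (outputs_one c) n n')"
proof -
  obtain w1 w2 where w1: "(w, w1) \<in> sem (clock_sem a K p) (expand (counter_impl a b) c)"
    "(w1, w2) \<in> sem (clock_sem a K p) (counter_impl a b (Dec 3))"
    using run by (auto simp: outputs_one_def simp del: counter_impl.simps)
  obtain n1 where n1: "represents K \<eta> n1 w1"
    using expand_sound[OF ab \<eta> K(2) rep w1(1)] by blast
  have "w1 (3 + 2) \<noteq> 1" using dec_sound[OF ab w1(2)] by blast
  moreover have "w1 (3 + 2) = 1 + real (n1 3) * \<eta>" using n1 K(1) by (simp only: represents_def)
  ultimately have "\<eta> \<noteq> 0" by auto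
  moreover have "\<forall>x\<in>prog_ops (outputs_one c). reg_of x < K"
    using K by (auto simp: outputs_one_def)
  ultimately show ?thesis using expand_sound[OF ab \<eta> _ rep run] by blast
qed

lemma reaches_final_sound:
  assumes ab: "0 < a" "0 < b" and K: "3 < K" "\<forall>x\<in>prog_ops c. reg_of x < K"
    and p: "0 \<le> p" "p \<le> real a + 1"
    and reach: "reaches_final p (simulator a K M (control a b (outputs_one c) N))"
  shows "real a - real b * p \<noteq> 0 \<and> (\<exists>n'. exec (outputs_one c) (loaded N 3 0) n')"
proof (rule ccontr)
  define \<eta> where "\<eta> = real a - real b * p"
  assume contr: "\<not> ?thesis"
  have "(w, w') \<notin> sem (clock_sem a K p) (expand (counter_impl a b) (outputs_one c))"
    if "represents K \<eta> (loaded N 3 0) w" for w w'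
    using outputs_one_sound[OF ab K \<eta>_def that] contr unfolding \<eta>_def by blast
  then obtain A where A: "inductive_on (clock_sem a K p) (control a b (outputs_one c) N) A"
    "A 4 = {}" "A 5 = {}" "start_val \<in> A 0" "\<And>i w. w \<in> A i \<Longrightarrow> w 0 = 0 \<and> bounded_regs a K w"
    using control_annotation[OF ab _ \<eta>_def, of K N "outputs_one c"] K(1) by auto
  have "x \<noteq> 5" if "(x, e, y) \<in> set (control a b (outputs_one c) N)" for x e y
    using control_nodes[OF ab that] by simp
  from simulator_sound[OF A this p] reach show False
    by (auto simp: reaches_final_def)
qed

lemma reaches_final_complete:
  assumes ab: "0 < a" "0 < b" and K: "3 < K" "\<forall>x\<in>prog_ops c. reg_of x < K"
    and run: "exec (outputs_one c) (loaded N 3 0) n'"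
  shows "\<exists>B>0. \<forall>p. 0 \<le> p \<longrightarrow> p \<le> real a + 1 \<longrightarrow> real a - real b * p \<noteq> 0 \<longrightarrow>
    \<bar>real a - real b * p\<bar> * B < 1 \<longrightarrow>
    reaches_final p (simulator a K M (control a b (outputs_one c) N))"
proof -
  have regs: "\<forall>x\<in>prog_ops (outputs_one c). reg_of x < K"
    using K by (auto simp: outputs_one_def)
  obtain B :: nat where B: "\<And>p w. 0 \<le> p \<Longrightarrow> real a - real b * p \<noteq> 0 \<Longrightarrow>
      \<bar>real a - real b * p\<bar> * real B < 1 \<Longrightarrow> represents K (real a - real b * p) (loaded N 3 0) w \<Longrightarrow>
      \<exists>w'. (w, w') \<in> sem (clock_sem a K p) (expand (counter_impl a b) (outputs_one c))"
    using expand_complete[OF ab regs run] by blast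
  define C where "C = N 0 + N 1 + N 2 + 2"
  show ?thesis
  proof (intro exI[of _ "real (B + C)"] conjI allI impI)
    show "real (B + C) > 0" by (simp add: C_def)
    fix p assume p: "0 \<le> p" "p \<le> real a + 1" "real a - real b * p \<noteq> 0"
      and small: "\<bar>real a - real b * p\<bar> * real (B + C) < 1"
    have "\<bar>real a - real b * p\<bar> * real B \<le> \<bar>real a - real b * p\<bar> * real (B + C)"
      "\<bar>real a - real b * p\<bar> * real C \<le> \<bar>real a - real b * p\<bar> * real (B + C)"
      by (intro mult_left_mono; simp)+
    with small have s: "\<bar>real a - real b * p\<bar> * real B < 1" "\<bar>real a - real b * p\<bar> * real C < 1"
      by linarith+
    obtain w where w: "((0, start_val), (4, w)) \<in>
        (graph_step (clock_sem a K p) (control a b (outputs_one c) N))\<^sup>*"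
      using control_path[OF ab _ refl p(1) s(2)[unfolded C_def] B[OF p(1,3) s(1)]] K(1) by auto
    have "bounded_regs a K start_val" "start_val 0 = 0"
      by (auto simp: bounded_regs_def start_val_def is_reg_def)
    from simulator_complete[OF w p(1,2) this(2,1)]
    have "((0, start_val), (8, w)) \<in> (moves p (simulator a K M (control a b (outputs_one c) N)))\<^sup>*"
      by simp
    with simulator_start show "reaches_final p (simulator a K M (control a b (outputs_one c) N))"
      unfolding reaches_final_def by (meson converse_rtrancl_into_rtrancl)
  qed
qed

text \<open>Diagonalisation: the simulated program asks \<open>f\<close> about the automaton at hand
  and halts exactly on the answer \<open>1\<close>. So the final location becomes reachable near
  \<open>a / b\<close> iff \<open>f\<close> claims that traces are preserved, that is, iff they are
  not.\<close>

lemma undecidable_around_rational: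
  fixes J :: "real set"
  assumes ab: "0 < a" "0 < b" and "0 < \<epsilon>"
    and J: "\<And>q. \<bar>q - real a / real b\<bar> < \<epsilon> \<Longrightarrow> q \<in> J"
  shows "\<not> decidable_problem enc_instance (one_param_instances J) (robust_trace_preservation J)"
proof
  assume "decidable_problem enc_instance (one_param_instances J) (robust_trace_preservation J)"
  then obtain f where f: "\<And>x. x \<in> one_param_instances J \<Longrightarrow>
      rec_eval f [enc_instance x] (if robust_trace_preservation J x then 1 else 0)"
    unfolding decidable_problem_def by blast
  define v0 :: rat where "v0 = of_nat a / of_nat b"
  have v0: "real_of_rat v0 = real a / real b" "0 \<le> v0"
    by (simp_all add: v0_def of_rat_divide)
  define v :: "param \<Rightarrow> rat" where "v = (\<lambda>p\<in>{0}. v0)"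
  obtain g where g: "\<And>xs. length xs = 3 \<Longrightarrow> rec_eval g xs (instance_code a b (enc_rat v0) xs)"
    using computable_instance_code[of a b "enc_rat v0"] by (auto simp: computable_def)
  define c where "c = code (Comp f [g]) [0, 1, 2] 3 4"
  obtain K where K: "3 < K" "\<forall>x\<in>prog_ops c. reg_of x < K"
  proof
    let ?K = "Suc (Max (insert 3 (reg_of ` prog_ops c)))"
    have fin: "finite (insert 3 (reg_of ` prog_ops c))" by (simp add: finite_prog_ops)
    show "3 < ?K" unfolding less_Suc_eq_le by (rule Max_ge[OF fin]) simp
    show "\<forall>x\<in>prog_ops c. reg_of x < ?K" using Max_ge[OF fin] by (auto simp: less_Suc_eq_le)
  qed
  define n where "n = 6 + 3 * (a + b) + fresh (expand (counter_impl a b) (outputs_one c))"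
  \<comment> \<open>\<open>M\<close> exceeds all numbers of locations and clocks. The three loading
    edges are counted without referring to the inputs, so that \<open>N\<close> can be defined from
    \<open>M\<close> afterwards.\<close>
  define M where "M = 2 * n + 2 * (3 + length (control_body a b (outputs_one c))) + K + 11"
  define N where "N i = (if i = 0 then list_encode [0..<M]
    else if i = 1 then list_encode (map (\<lambda>l. enc_constraint []) [0..<M])
    else list_encode (map enc_edge
      (edges_of a K 3 (control_body a b (outputs_one c)) @ start_edge # free_edges a M)))" for i :: nat
  define G where "G = control a b (outputs_one c) N"
  define A where "A = simulator a K M G"
  have fits: "fits K M G"
  proof -
    have K': "3 < K" "\<forall>x\<in>prog_ops (outputs_one c). reg_of x < K"
      using K by (auto simp: outputs_one_def)
    have "2 * x < M \<and> 2 * y < M \<and> (\<forall>z. e = Some z \<longrightarrow> op_reg z < K)" if "(x, e, y) \<in> set G" for x e y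
    proof -
      have "x < n" "y < n" using control_nodes[OF ab that[unfolded G_def]] by (simp_all add: n_def)
      moreover have "op_reg z < K" if "e = Some z" for z
        by (rule control_regs[OF K'(1,2)]) (use \<open>(x, e, y) \<in> set G\<close> that in \<open>auto simp: G_def\<close>)
      ultimately show ?thesis by (auto simp: M_def)
    qed
    moreover have "length G = 3 + length (control_body a b (outputs_one c))"
      by (simp add: G_def control_def)
    then have "2 * length G < M" "K + 2 < M" "10 < M" by (simp_all add: M_def)
    ultimately show ?thesis
      using K(1) unfolding fits_def by auto
  qed
  have params: "set (params A) = {0}" by (simp add: A_def)
  have val_iff: "u \<in> valuations J A \<longleftrightarrow> (\<exists>q. u = (\<lambda>p\<in>{0}. q) \<and> 0 \<le> q \<and> real_of_rat q \<in> J)" for u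
    unfolding valuations_def params
    by (auto simp: PiE_iff extensional_def fun_eq_iff restrict_def)
  have v: "v \<in> valuations J A"
    unfolding val_iff using v0 J[of "real a / real b"] \<open>0 < \<epsilon>\<close> by (auto simp: v_def)
  have inst: "(A, v) \<in> one_param_instances J"
    using wf_simulator[OF fits] v by (simp add: one_param_instances_def params) (simp add: A_def)
  have traces: "Traces (instantiate u A) = free_traces M \<longleftrightarrow> \<not> reaches_final (u 0) A" for u
    unfolding A_def by (rule Traces_simulator[OF fits])
  have "enc_instance (A, v) = instance_code a b (enc_rat v0) [N 0, N 1, N 2]"
    unfolding A_def G_def by (subst enc_instance_simulator) (simp_all add: N_def v_def)
  then have "rec_eval (Comp f [g]) [N 0, N 1, N 2] (if robust_trace_preservation J (A, v) then 1 else 0)"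
    using f[OF inst] g[of "[N 0, N 1, N 2]"] by (intro eval_Comp[of _ _ "[enc_instance (A, v)]"]) auto
  then have answer: "rec_eval (Comp f [g]) [N 0, N 1, N 2] y \<longleftrightarrow>
      y = (if robust_trace_preservation J (A, v) then 1 else 0)" for y
    by (auto dest: rec_eval_unique)
  define halts where "halts \<longleftrightarrow> (\<exists>n'. exec (outputs_one c) (loaded N 3 0) n')"
  have halts: "halts \<longleftrightarrow> robust_trace_preservation J (A, v)"
  proof -
    have rd: "ready [0, 1, 2] 3 4 (loaded N 3 0)"
      by (auto simp: ready_def loaded_def)
    have args: "map (loaded N 3 0) [0, 1, 2] = [N 0, N 1, N 2]" by (simp add: loaded_def)
    have c: "exec c (loaded N 3 0) s \<longleftrightarrow>
        s = (loaded N 3 0)(3 := if robust_trace_preservation J (A, v) then 1 else 0)" for s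
      unfolding c_def implementsD[OF implements_code rd] args answer by auto
    show ?thesis unfolding halts_def outputs_one_def exec_Seq c by auto
  qed
  have le: "real a / real b \<le> real a"
    using ab by (simp add: divide_le_eq mult_le_cancel_left1)
  have at_v: "real a - real b * (real a / real b) = 0" using ab by simp
  have offset: "real a - real b * (real a / real b + x) = - (real b * x)" for x
    using ab by (simp add: algebra_simps)
  have at_v_free: "Traces (instantiate (\<lambda>p. real_of_rat (v p)) A) = free_traces M"
    unfolding traces using reaches_final_sound[OF ab K, of "real a / real b" M N] at_v le
    by (auto simp: A_def G_def v_def v0)
  have robust: "robust_trace_preservation J (A, v) \<longleftrightarrow>
      (\<exists>u\<in>valuations J A. u \<noteq> v \<and>
        (\<forall>k\<in>{0..1}. \<not> reaches_final (k * real_of_rat (v 0) + (1 - k) * real_of_rat (u 0)) A))"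
    unfolding robust_trace_preservation_def prod.case at_v_free traces by (rule refl)
  show False
  proof (cases halts)
    case True
    then obtain B where B: "B > 0" "\<And>p. 0 \<le> p \<Longrightarrow> p \<le> real a + 1 \<Longrightarrow> real a - real b * p \<noteq> 0 \<Longrightarrow>
        \<bar>real a - real b * p\<bar> * B < 1 \<Longrightarrow> reaches_final p A"
      unfolding halts_def A_def G_def using reaches_final_complete[OF ab K] by meson
    from True halts robust obtain u where u: "u \<in> valuations J A" "u \<noteq> v"
      and safe: "\<And>k. k \<in> {0..1} \<Longrightarrow> \<not> reaches_final (k * real_of_rat (v 0) + (1 - k) * real_of_rat (u 0)) A"
      by blast
    obtain q where q: "u = (\<lambda>p\<in>{0}. q)" "0 \<le> q" "q \<noteq> v0"
      using u unfolding val_iff v_def by auto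
    define \<Delta> where "\<Delta> = real_of_rat q - real a / real b"
    have "\<Delta> \<noteq> 0" unfolding \<Delta>_def v0(1)[symmetric] using q(3) by simp
    \<comment> \<open>A fraction of the segment from \<open>v\<close> towards \<open>u\<close> with
      \<open>t * \<bar>\<Delta>\<bar> < 1\<close>, which keeps \<open>p\<close> below
      \<open>a + 1\<close>, and \<open>t * (b * B * \<bar>\<Delta>\<bar>) < 1\<close>, which makes
      \<eta> small enough for the halting run; it is positive, so \<eta> does not vanish.\<close>
    define t where "t = 1 / (1 + (real b * B + 1) * (\<bar>\<Delta>\<bar> + 1))"
    have den: "1 + (real b * B + 1) * (\<bar>\<Delta>\<bar> + 1) > 1"
      using ab B(1) by (simp add: add_pos_nonneg)
    have t: "0 < t" "t \<le> 1" using den by (auto simp: t_def)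
    have "0 \<le> real b * B * \<bar>\<Delta>\<bar>" "0 \<le> real b * B" using B(1) by auto
    then have "\<bar>\<Delta>\<bar> < 1 + (real b * B + 1) * (\<bar>\<Delta>\<bar> + 1)"
      "real b * B * \<bar>\<Delta>\<bar> < 1 + (real b * B + 1) * (\<bar>\<Delta>\<bar> + 1)"
      by (simp_all add: algebra_simps)
    then have td: "t * \<bar>\<Delta>\<bar> < 1" "t * (real b * B * \<bar>\<Delta>\<bar>) < 1"
      using den by (simp_all add: t_def)
    define p where "p = real a / real b + t * \<Delta>"
    have p_eq: "(1 - t) * real_of_rat (v 0) + (1 - (1 - t)) * real_of_rat (u 0) = p"
    proof -
      have comb: "(1 - t) * x + (1 - (1 - t)) * y = x + t * (y - x)" for x y :: real
        by (simp add: algebra_simps)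
      show ?thesis unfolding comb p_def by (simp add: v_def q(1) v0 \<Delta>_def)
    qed
    have "0 \<le> p"
      unfolding p_eq[symmetric] using t q(2) v0(2) by (simp add: v_def q(1))
    moreover have "t * \<Delta> \<le> t * \<bar>\<Delta>\<bar>" using t by (intro mult_left_mono) auto
    then have "p \<le> real a + 1" using le td(1) unfolding p_def by linarith
    moreover have "real a - real b * p = - (real b * (t * \<Delta>))" unfolding p_def by (rule offset)
    then have "real a - real b * p \<noteq> 0" "\<bar>real a - real b * p\<bar> * B < 1"
      using td(2) t ab \<open>\<Delta> \<noteq> 0\<close> by (simp_all add: abs_mult mult_ac)
    ultimately have "reaches_final p A" by (rule B(2))
    then show False using safe[of "1 - t"] t unfolding p_eq by auto
  next
    case False
    \<comment> \<open>The bound \<epsilon> keeps the new value in \<open>J\<close>, and the bound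
      \<open>1\<close> keeps the whole segment below \<open>a + 1\<close>. As the program does not
      halt, any such positive \<delta> will do.\<close>
    obtain \<delta> :: rat where \<delta>: "0 < real_of_rat \<delta>" "real_of_rat \<delta> < min \<epsilon> 1"
      using of_rat_dense[of 0 "min \<epsilon> 1"] \<open>0 < \<epsilon>\<close> by auto
    define u where "u = (\<lambda>p\<in>{0::param}. v0 + \<delta>)"
    have "u \<in> valuations J A"
      unfolding val_iff using \<delta> v0 J[of "real a / real b + real_of_rat \<delta>"]
      by (intro exI[of _ "v0 + \<delta>"]) (auto simp: u_def of_rat_add)
    moreover have "u \<noteq> v"
    proof
      assume "u = v"
      then have "u 0 = v 0" by simp
      then show False using \<delta>(1) by (simp add: u_def v_def)
    qed
    moreover have "\<not> reaches_final (k * real_of_rat (v 0) + (1 - k) * real_of_rat (u 0)) A"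
      if "k \<in> {0..1}" for k
    proof
      assume reach: "reaches_final (k * real_of_rat (v 0) + (1 - k) * real_of_rat (u 0)) A"
      have eq: "k * real_of_rat (v 0) + (1 - k) * real_of_rat (u 0) =
          real a / real b + (1 - k) * real_of_rat \<delta>"
      proof -
        have comb: "k * x + (1 - k) * (x + y) = x + (1 - k) * y" for x y :: real
          by (simp add: algebra_simps)
        have "real_of_rat (v 0) = real a / real b" "real_of_rat (u 0) = real a / real b + real_of_rat \<delta>"
          by (simp_all add: u_def v_def v0 of_rat_add)
        then show ?thesis by (simp only: comb)
      qed
      have "0 \<le> (1 - k) * real_of_rat \<delta>" using that \<delta>(1) by simp
      moreover have "(1 - k) * real_of_rat \<delta> \<le> 1 * 1"
        using that \<delta> by (intro mult_mono) simp_all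
      ultimately have "0 \<le> real a / real b + (1 - k) * real_of_rat \<delta>"
        "real a / real b + (1 - k) * real_of_rat \<delta> \<le> real a + 1"
        using le by auto
      from reaches_final_sound[OF ab K this] reach show False
        using False unfolding eq halts_def A_def G_def by blast
    qed
    ultimately have "robust_trace_preservation J (A, v)" unfolding robust by blast
    with False halts show False by simp
  qed
qed

theorem theorem3p11:
  shows "\<not> decidable_problem enc_instance (one_param_instances {0..})
             (robust_trace_preservation {0..})
    \<and> (\<forall>J :: real set. is_interval J \<and> bounded J \<and> J \<subseteq> {0..} \<and> (\<exists>a\<in>J. \<exists>b\<in>J. a < b) \<longrightarrow>
         \<not> decidable_problem enc_instance (one_param_instances J)
             (robust_trace_preservation J))"
proof (intro conjI allI impI)
  show "\<not> decidable_problem enc_instance (one_param_instances {0..}) (robust_trace_preservation {0..})"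
    \<comment> \<open>The given parameter value is \<open>1\<close>; every number at distance less
      than \<open>1\<close> from it is positive.\<close>
    by (rule undecidable_around_rational[of 1 1 1]) auto
next
  fix J :: "real set"
  assume J: "is_interval J \<and> bounded J \<and> J \<subseteq> {0..} \<and> (\<exists>a\<in>J. \<exists>b\<in>J. a < b)"
  then obtain x y where xy: "x \<in> J" "y \<in> J" "x < y" "0 \<le> x" by auto
  \<comment> \<open>A rational strictly between two points of \<open>J\<close> has a neighbourhood
    inside the interval; its numerator and denominator, both positive, become the constants of the
    simulator.\<close>
  from of_rat_dense[OF xy(3)] obtain r :: rat where r: "x < real_of_rat r" "real_of_rat r < y" by blast
  then have "0 < r" using xy(4) by (metis le_less_trans zero_less_of_rat_iff)
  obtain m k where mk: "quotient_of r = (m, k)" by fastforce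
  then have k: "k > 0" "r = of_int m / of_int k" by (auto intro: quotient_of_denom_pos quotient_of_div)
  then have m: "m > 0" using \<open>0 < r\<close> by (simp add: zero_less_divide_iff)
  have eq: "real (nat m) / real (nat k) = real_of_rat r"
    using k m by (simp add: of_rat_divide)
  show "\<not> decidable_problem enc_instance (one_param_instances J) (robust_trace_preservation J)"
  proof (rule undecidable_around_rational[of "nat m" "nat k" "min (real_of_rat r - x) (y - real_of_rat r)"])
    fix q assume "\<bar>q - real (nat m) / real (nat k)\<bar> < min (real_of_rat r - x) (y - real_of_rat r)"
    then have "x \<le> q" "q \<le> y" unfolding eq by auto
    then show "q \<in> J" using J xy(1,2) by (meson mem_is_interval_1_I)
  qed (use k m r in auto)
qed

end
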